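(* Let $\Gamma$ be the cyclic group of order $2$, let $(\tilde G,\tilde p)$ be a $\mathcal{C}_s$-generic framework in $\mathbb{R}^2$ (where $\mathcal{C}_s=\{\mathrm{id},\sigma\}$ and $\sigma$ is the reflection in the $y$-axis), and let $(G,\psi,p)$ be its $\mathcal{C}_s$-gain framework. Then $(\tilde G,\tilde p)$ is infinitesimally rigid if and only if both of the following hold: (a) $(G,\psi)$ has a $(2,1,3,1)$-gain-tight spanning subgraph; (b) $(G,\psi)$ has a $(2,1,3,2)$-gain-tight spanning subgraph.
   Context: **Frameworks.** A framework in $\mathbb{R}^2$ is a pair $(\tilde G,\tilde p)$ with $\tilde G$ a finite simple graph and $\tilde p:V(\tilde G)\to\mathbb{R}^2$ injective; it is assumed that $\tilde p(V(\tilde G))$ affinely spans $\mathbb{R}^2$. An infinitesimal motion is $m:V(\tilde G)\to\mathbb{R}^2$ with $(\tilde p(u)-\tilde p(v))^T(m(u)-m(v))=0$ for all edges $\{u,v\}$; it is trivial if $m(u)=M\tilde p(u)+t$ for a fixed skew-symmetric $M$ and vector $t$. $(\tilde G,\tilde p)$ is infinitesimally rigid if all its infinitesimal motions are trivial. The rigidity matrix $R(\tilde G,\tilde p)$ has one row per edge, the row of $\{u,v\}$ having $(\tilde p(u)-\tilde p(v))^T$ in the two columns of $u$, $(\tilde p(v)-\tilde p(u))^T$ in the two columns of $v$, and zeros elsewhere. **Symmetry.** $\Gamma=\langle\gamma\rangle$ acts on $\tilde G$ by graph automorphisms, and $\tau:\Gamma\to O(\mathbb{R}^2)$ is the faithful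 representation with image $\mathcal{C}_s$. $(\tilde G,\tilde p)$ is $\mathcal{C}_s$-symmetric if $\tau(g)\tilde p(v)=\tilde p(gv)$ for all $g\in\Gamma$, $v\in V(\tilde G)$. It is $\mathcal{C}_s$-generic if it is $\mathcal{C}_s$-symmetric and $\operatorname{rank}R(\tilde G,\tilde p)\ge\operatorname{rank}R(\tilde G,\tilde q)$ for all $\mathcal{C}_s$-symmetric realisations $(\tilde G,\tilde q)$ (same action on $\tilde G$). A vertex is fixed if it is fixed by all of $\Gamma$, free if its stabiliser is trivial. **Quotient gain graph.** $G=\tilde G/\Gamma$ is the multigraph whose vertices and edges are the vertex orbits and edge orbits of $\tilde G$; $V_0(G)$ is the set of orbits of fixed vertices (fixed vertices of $G$) and $\overline{V(G)}$ the set of orbits of free vertices (free vertices of $G$). Choose a representative $v^\star$ of each vertex orbit $v$ and an orientation of each edge of $G$. The gain $\psi(e)\in\Gamma$ of an edge $e=(u,v)$ of $G$ is: the unique $g$ with $\{u^\star,gv^\star\}\in e$ if $u,v$ are both free (for a loop, up to inversion); an arbitrary element of $\Gamma$ if exactly one of $u,v$ is fixed; $\mathrm{id}$ if both are fixed. Put $p(v)=\tilde p(v^\star)$. Then $(G,\psi)$ is a quotient $\Gamma$-gain graph and $(G,\psi,p)$ the $\mathcal{C}_s$-gain framework of $(\tilde G,\tilde p)$. **Sparsity.** For a subgraph $H$ of $G$, $V_0(H)=V(H)\cap V_0(G)$ and $\overline{V(H)}=V(H)\cap\overline{V(G)}$. The gain of a walk is the product of the $\psi(e)^{\pm1}$ along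 it, exponent $+1$ if $e$ is traversed along its orientation and $-1$ otherwise. $H$ is balanced if, after deleting all fixed vertices and their incident edges, every cycle (including loops and cycles formed by two parallel edges) has gain $\mathrm{id}$. $(G,\psi)$ is $(2,m,3,l)$-gain-sparse if (1) $|E(H)|\le 2|V(H)|-3$ for every balanced subgraph $H$ with $E(H)\ne\emptyset$, and (2) $|E(H)|\le 2|\overline{V(H)}|+m|V_0(H)|-l$ for every subgraph $H$ with $E(H)\neq\emptyset$. It is $(2,m,3,l)$-gain-tight if moreover $|E(G)|=2|\overline{V(G)}|+m|V_0(G)|-l$. A spanning subgraph has vertex set $V(G)$ and carries the restricted gains. *)

theory Defs
  imports
    "HOL-Analysis.Analysis"
    "HOL-Algebra.Elementary_Groups"
    "HOL-Algebra.Group_Action"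
    "Graph_Theory.Arc_Walk"
    "Graph_Theory.Digraph_Component"
begin

text \<open>
  The vertex set of the framework graph is a finite type \<open>'v\<close>, and the graph is given by
  its set of edges.
\<close>

definition simple_graph :: "'v set set \<Rightarrow> bool" where
  "simple_graph E \<longleftrightarrow> (\<forall>e\<in>E. card e = 2)"

definition framework :: "'v::finite set set \<Rightarrow> ('v \<Rightarrow> real^2) \<Rightarrow> bool" where
  "framework E p \<longleftrightarrow> simple_graph E \<and> inj p \<and> affine hull (range p) = UNIV"

definition infinitesimal_motion ::
    "'v::finite set set \<Rightarrow> ('v \<Rightarrow> real^2) \<Rightarrow> ('v \<Rightarrow> real^2) \<Rightarrow> bool" where
  "infinitesimal_motion E p m \<longleftrightarrow>
     (\<forall>u v. {u, v} \<in> E \<longrightarrow> (p u - p v) \<bullet> (m u - m v) = 0)"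

definition trivial_motion :: "('v::finite \<Rightarrow> real^2) \<Rightarrow> ('v \<Rightarrow> real^2) \<Rightarrow> bool" where
  "trivial_motion p m \<longleftrightarrow>
     (\<exists>(M :: real^2^2) t. transpose M = - M \<and> (\<forall>u. m u = M *v p u + t))"

definition infinitesimally_rigid :: "'v::finite set set \<Rightarrow> ('v \<Rightarrow> real^2) \<Rightarrow> bool" where
  "infinitesimally_rigid E p \<longleftrightarrow>
     (\<forall>m. infinitesimal_motion E p m \<longrightarrow> trivial_motion p m)"

text \<open>
  The row of the rigidity matrix at the edge \<open>e\<close>.  The two columns belonging to a vertex \<open>w\<close>
  are the two coordinates of the block at \<open>w\<close>; for \<open>w \<in> e\<close> the other end of \<open>e\<close> is the
  unique element of \<open>e - {w}\<close>.
\<close>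
definition rigidity_row :: "('v::finite \<Rightarrow> real^2) \<Rightarrow> 'v set \<Rightarrow> real^2^'v" where
  "rigidity_row p e = (\<chi> w. if w \<in> e then p w - p (the_elem (e - {w})) else 0)"

text \<open>
  The rank of the rigidity matrix.  As in the library definition of \<open>rank\<close>, the rank is the
  dimension of the set of rows; the rows here are indexed by the set \<open>E\<close> instead of a type.
\<close>
definition rigidity_rank :: "'v::finite set set \<Rightarrow> ('v \<Rightarrow> real^2) \<Rightarrow> nat" where
  "rigidity_rank E p = dim (rigidity_row p ` E)"

definition graph_automorphism :: "'v set set \<Rightarrow> ('v \<Rightarrow> 'v) \<Rightarrow> bool" where
  "graph_automorphism E f \<longleftrightarrow> bij f \<and> (\<forall>u v. {f u, f v} \<in> E \<longleftrightarrow> {u, v} \<in> E)"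

definition acts_on_graph :: "'g monoid \<Rightarrow> ('g \<Rightarrow> 'v \<Rightarrow> 'v) \<Rightarrow> 'v set set \<Rightarrow> bool" where
  "acts_on_graph \<Gamma> \<phi> E \<longleftrightarrow>
     group_action \<Gamma> UNIV \<phi> \<and> (\<forall>g\<in>carrier \<Gamma>. graph_automorphism E (\<phi> g))"

definition orthogonal_group :: "(real^2^2) monoid" where
  "orthogonal_group = \<lparr>carrier = {A. orthogonal_matrix A}, mult = (**), one = mat 1\<rparr>"

text \<open>The reflection \<open>(x, y) \<mapsto> (- x, y)\<close> in the \<open>y\<close>-axis.\<close>
definition reflection :: "real^2^2" where
  "reflection = vector [vector [- 1, 0], vector [0, 1]]"

definition Cs_representation :: "'g monoid \<Rightarrow> ('g \<Rightarrow> real^2^2) \<Rightarrow> bool" where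
  "Cs_representation \<Gamma> \<tau> \<longleftrightarrow>
     \<tau> \<in> hom \<Gamma> orthogonal_group \<and> inj_on \<tau> (carrier \<Gamma>) \<and> \<tau> ` carrier \<Gamma> = {mat 1, reflection}"

definition symmetric_framework ::
    "'g monoid \<Rightarrow> ('g \<Rightarrow> 'v \<Rightarrow> 'v) \<Rightarrow> ('g \<Rightarrow> real^2^2) \<Rightarrow> 'v::finite set set \<Rightarrow> ('v \<Rightarrow> real^2) \<Rightarrow> bool"
  where
  "symmetric_framework \<Gamma> \<phi> \<tau> E p \<longleftrightarrow>
     framework E p \<and> (\<forall>g\<in>carrier \<Gamma>. \<forall>v. \<tau> g *v p v = p (\<phi> g v))"

definition generic_framework ::
    "'g monoid \<Rightarrow> ('g \<Rightarrow> 'v \<Rightarrow> 'v) \<Rightarrow> ('g \<Rightarrow> real^2^2) \<Rightarrow> 'v::finite set set \<Rightarrow> ('v \<Rightarrow> real^2) \<Rightarrow> bool"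
  where
  "generic_framework \<Gamma> \<phi> \<tau> E p \<longleftrightarrow>
     symmetric_framework \<Gamma> \<phi> \<tau> E p \<and>
     (\<forall>q. symmetric_framework \<Gamma> \<phi> \<tau> E q \<longrightarrow> rigidity_rank E p \<ge> rigidity_rank E q)"

text \<open>
  Vertices of the quotient graph are vertex orbits, and its edges are edge orbits, i.e. orbits
  under the induced action \<open>g \<mapsto> (\<lambda>e. \<phi> g ` e)\<close>.  The name \<open>orbit\<close> alone would be ambiguous
  (orbits of a permutation).
\<close>

abbreviation vertex_orbit :: "'g monoid \<Rightarrow> ('g \<Rightarrow> 'v \<Rightarrow> 'v) \<Rightarrow> 'v \<Rightarrow> 'v set" where
  "vertex_orbit \<Gamma> \<phi> v \<equiv> Group_Action.orbit \<Gamma> \<phi> v"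

definition edge_orbits :: "'g monoid \<Rightarrow> ('g \<Rightarrow> 'v \<Rightarrow> 'v) \<Rightarrow> 'v set set \<Rightarrow> 'v set set set" where
  "edge_orbits \<Gamma> \<phi> E = Group_Action.orbits \<Gamma> E (\<lambda>g e. \<phi> g ` e)"

definition fixed_vertices :: "'g monoid \<Rightarrow> ('g \<Rightarrow> 'v \<Rightarrow> 'v) \<Rightarrow> 'v set set" where
  "fixed_vertices \<Gamma> \<phi> = {vertex_orbit \<Gamma> \<phi> v | v. stabilizer \<Gamma> \<phi> v = carrier \<Gamma>}"

definition free_vertices :: "'g monoid \<Rightarrow> ('g \<Rightarrow> 'v \<Rightarrow> 'v) \<Rightarrow> 'v set set" where
  "free_vertices \<Gamma> \<phi> = {vertex_orbit \<Gamma> \<phi> v | v. stabilizer \<Gamma> \<phi> v = {\<one>\<^bsub>\<Gamma>\<^esub>}}"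

text \<open>
  The pair \<open>(G, \<psi>)\<close> is a quotient gain graph for the vertex representatives \<open>rep\<close>.  The
  multigraph \<open>G\<close> is stored together with its chosen edge orientation, as a directed
  multigraph.  Its orientation is arbitrary: only the unordered pair of ends is prescribed.
  For a gain between a free and a fixed vertex only membership in \<open>\<Gamma>\<close> is required.
\<close>
definition quotient_gain_graph ::
    "'g monoid \<Rightarrow> ('g \<Rightarrow> 'v \<Rightarrow> 'v) \<Rightarrow> 'v set set \<Rightarrow> ('v set \<Rightarrow> 'v) \<Rightarrow>
     ('v set, 'v set set) pre_digraph \<Rightarrow> ('v set set \<Rightarrow> 'g) \<Rightarrow> bool" where
  "quotient_gain_graph \<Gamma> \<phi> E rep G \<psi> \<longleftrightarrow>
     verts G = Group_Action.orbits \<Gamma> UNIV \<phi> \<and>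
     arcs G = edge_orbits \<Gamma> \<phi> E \<and>
     (\<forall>e\<in>arcs G. \<forall>d\<in>e. {tail G e, head G e} = vertex_orbit \<Gamma> \<phi> ` d) \<and>
     (\<forall>v\<in>verts G. rep v \<in> v) \<and>
     (\<forall>e\<in>arcs G. \<psi> e \<in> carrier \<Gamma> \<and>
        (tail G e \<in> free_vertices \<Gamma> \<phi> \<and> head G e \<in> free_vertices \<Gamma> \<phi> \<longrightarrow>
           {rep (tail G e), \<phi> (\<psi> e) (rep (head G e))} \<in> e) \<and>
        (tail G e \<in> fixed_vertices \<Gamma> \<phi> \<and> head G e \<in> fixed_vertices \<Gamma> \<phi> \<longrightarrow>
           \<psi> e = \<one>\<^bsub>\<Gamma>\<^esub>))"

definition gain_framework ::
    "'g monoid \<Rightarrow> ('g \<Rightarrow> 'v \<Rightarrow> 'v) \<Rightarrow> 'v::finite set set \<Rightarrow> ('v \<Rightarrow> real^2) \<Rightarrow> ('v set \<Rightarrow> 'v) \<Rightarrow>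
     ('v set, 'v set set) pre_digraph \<Rightarrow> ('v set set \<Rightarrow> 'g) \<Rightarrow> ('v set \<Rightarrow> real^2) \<Rightarrow> bool" where
  "gain_framework \<Gamma> \<phi> E p rep G \<psi> q \<longleftrightarrow>
     quotient_gain_graph \<Gamma> \<phi> E rep G \<psi> \<and> (\<forall>v\<in>verts G. q v = p (rep v))"

text \<open>
  Undirected walks of \<open>G\<close> are the walks of the digraph in which every arc \<open>e\<close> is
  replaced by \<open>(e, True)\<close>, which follows the orientation, and \<open>(e, False)\<close>, which reverses it.
\<close>
definition two_way :: "('a, 'b) pre_digraph \<Rightarrow> ('a, 'b \<times> bool) pre_digraph" where
  "two_way G =
     \<lparr>verts = verts G, arcs = arcs G \<times> UNIV,
      tail = (\<lambda>(e, forward). if forward then tail G e else head G e),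
      head = (\<lambda>(e, forward). if forward then head G e else tail G e)\<rparr>"

text \<open>
  Distinctness of the underlying edges only excludes traversing a single edge back and forth;
  loops and pairs of parallel edges are cycles.
\<close>
definition undirected_cycle :: "('a, 'b) pre_digraph \<Rightarrow> ('b \<times> bool) list \<Rightarrow> bool" where
  "undirected_cycle G c \<longleftrightarrow> pre_digraph.cycle (two_way G) c \<and> distinct (map fst c)"

definition walk_gain :: "'g monoid \<Rightarrow> ('b \<Rightarrow> 'g) \<Rightarrow> ('b \<times> bool) list \<Rightarrow> 'g" where
  "walk_gain \<Gamma> \<psi> c =
     foldr (\<lambda>(e, forward) g. (if forward then \<psi> e else inv\<^bsub>\<Gamma>\<^esub> (\<psi> e)) \<otimes>\<^bsub>\<Gamma>\<^esub> g) c \<one>\<^bsub>\<Gamma>\<^esub>"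

definition balanced ::
    "'g monoid \<Rightarrow> ('g \<Rightarrow> 'v \<Rightarrow> 'v) \<Rightarrow> ('b \<Rightarrow> 'g) \<Rightarrow> ('v set, 'b) pre_digraph \<Rightarrow> bool" where
  "balanced \<Gamma> \<phi> \<psi> H \<longleftrightarrow>
     (\<forall>c. undirected_cycle (H \<restriction> (verts H - fixed_vertices \<Gamma> \<phi>)) c \<longrightarrow>
        walk_gain \<Gamma> \<psi> c = \<one>\<^bsub>\<Gamma>\<^esub>)"

text \<open>The right-hand side \<open>2 |free vertices| + m |fixed vertices| - l\<close>, as an integer.\<close>
definition sparsity_count ::
    "'g monoid \<Rightarrow> ('g \<Rightarrow> 'v \<Rightarrow> 'v) \<Rightarrow> int \<Rightarrow> int \<Rightarrow> ('v set, 'b) pre_digraph \<Rightarrow> int" where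
  "sparsity_count \<Gamma> \<phi> m l H =
     2 * int (card (verts H \<inter> free_vertices \<Gamma> \<phi>)) +
     m * int (card (verts H \<inter> fixed_vertices \<Gamma> \<phi>)) - l"

text \<open>\<open>(2, m, 3, l)\<close>-gain-sparsity and -tightness of the gain graph \<open>(G, \<psi>)\<close>.\<close>
definition gain_sparse ::
    "'g monoid \<Rightarrow> ('g \<Rightarrow> 'v \<Rightarrow> 'v) \<Rightarrow> int \<Rightarrow> int \<Rightarrow> ('v set, 'b) pre_digraph \<Rightarrow> ('b \<Rightarrow> 'g) \<Rightarrow> bool"
  where
  "gain_sparse \<Gamma> \<phi> m l G \<psi> \<longleftrightarrow>
     (\<forall>H. subgraph H G \<and> arcs H \<noteq> {} \<and> balanced \<Gamma> \<phi> \<psi> H \<longrightarrow>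
        int (card (arcs H)) \<le> 2 * int (card (verts H)) - 3) \<and>
     (\<forall>H. subgraph H G \<and> arcs H \<noteq> {} \<longrightarrow>
        int (card (arcs H)) \<le> sparsity_count \<Gamma> \<phi> m l H)"

definition gain_tight ::
    "'g monoid \<Rightarrow> ('g \<Rightarrow> 'v \<Rightarrow> 'v) \<Rightarrow> int \<Rightarrow> int \<Rightarrow> ('v set, 'b) pre_digraph \<Rightarrow> ('b \<Rightarrow> 'g) \<Rightarrow> bool"
  where
  "gain_tight \<Gamma> \<phi> m l G \<psi> \<longleftrightarrow>
     gain_sparse \<Gamma> \<phi> m l G \<psi> \<and> int (card (arcs G)) = sparsity_count \<Gamma> \<phi> m l G"

end

theory Submission
  imports Defs
begin

text \<open>
  An infinitesimal motion of a reflection-symmetric framework is the sum of a symmetric and an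
  antisymmetric one.  Each kind is determined by its values at the vertex representatives (one
  coordinate at a fixed vertex, two at a free one), and an edge orbit imposes one linear condition
  on each kind.  The trivial motions contribute dimension 1 and 2, so the framework is rigid iff
  the two systems have rank \<open>2f + s - 1\<close> and \<open>2f + s - 2\<close>, with \<open>f\<close> free and \<open>s\<close> fixed orbits.

  Both ranks come from Lovasz's Dilworth truncation.  Suppose the row of an edge \<open>e\<close> is the
  point in which the plane spanned by two vectors \<open>a e\<close>, \<open>b e\<close> meets the hyperplane orthogonal to
  \<open>h\<close>.  Then for generic \<open>h\<close> the rows of a set \<open>F\<close> are independent iff every nonempty
  \<open>F' \<subseteq> F\<close> satisfies \<open>|F'| + 1 \<le> dim\<close> of the span of its \<open>a e\<close>, \<open>b e\<close>.
  The antisymmetric system has this shape with \<open>h\<close> the reflected configuration itself.  The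
  symmetric one acquires it after the projective map \<open>(x, y) \<mapsto> (1/x, y/x)\<close>, which turns the
  reflection into a half-turn and sends the fixed vertices to infinity.  In both cases the
  dimension condition amounts to the sparsity counts.
\<close>

section \<open>Independent families of vectors\<close>

text \<open>The vector \<open>h\<close> is a trivial motion. Rows are orthogonal to every trivial
  motion of their own symmetry type, and when \<open>h\<close> is the infinitesimal rotation its
  inner products with the two vectors of a plane recover, up to sign, the coordinates of the edge
  direction. Rotation is antisymmetric under the reflection, so the antisymmetric system is a
  truncation as it stands. The only symmetric trivial motions are vertical translations, which are
  orthogonal to all incidence vectors and carry no information on edge directions: this is the
  obstacle. The projective map removes it by turning the vertical translation into the rotation of
  the half-turn-symmetric image.

  The direction of a point at infinity is part of the planes and not of \<open>h\<close>. Hence the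
  heights of the fixed vertices are prescribed before truncating, and they must be distinct, which
  injectivity of the placement supplies.

  The two truncations produce unrelated realisations. Independence persists off the zero set of a
  polynomial, so a single symmetric realisation serves both systems, and maximality of the symmetric
  rank carries rigidity over to the given framework.\<close>

definition indep_family :: "'e set \<Rightarrow> ('e \<Rightarrow> 'a::real_vector) \<Rightarrow> bool" where
  "indep_family F r \<longleftrightarrow> (\<forall>c. (\<Sum>e\<in>F. c e *\<^sub>R r e) = 0 \<longrightarrow> (\<forall>e\<in>F. c e = 0))"

lemma indep_familyD:
  assumes "indep_family F r" "(\<Sum>e\<in>F. c e *\<^sub>R r e) = 0" "e \<in> F"
  shows "c e = 0"
  using assms(1)[unfolded indep_family_def, rule_format, OF assms(2,3)] .

lemma indep_family_inj_on:
  assumes "finite F" "indep_family F r" shows "inj_on r F"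
proof (rule inj_onI, rule ccontr)
  fix e e' assume e: "e \<in> F" "e' \<in> F" "r e = r e'" "e \<noteq> e'"
  let ?c = "\<lambda>i. if i = e then 1 else if i = e' then - 1 else (0::real)"
  have "(\<Sum>i\<in>F. ?c i *\<^sub>R r i) = (\<Sum>i\<in>{e,e'}. ?c i *\<^sub>R r i)"
    using assms(1) e by (intro sum.mono_neutral_right) auto
  also have "\<dots> = 0" using e by auto
  finally have "?c e = 0" using indep_familyD[OF assms(2), of ?c e] e(1) by blast
  then show False by simp
qed

text \<open>Families instead of sets of vectors: two edge orbits with the same row must count as
  dependent, which the image set alone would hide. Injectivity is exactly what separates the two
  notions.\<close>

lemma indep_family_iff:
  assumes "finite F"
  shows "indep_family F r \<longleftrightarrow> inj_on r F \<and> independent (r ` F)"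
proof
  assume r: "indep_family F r"
  have inj: "inj_on r F" using indep_family_inj_on[OF assms r] .
  moreover have "independent (r ` F)"
  proof (rule independent_if_scalars_zero)
    show "finite (r ` F)" using assms by simp
    fix f x assume *: "(\<Sum>x\<in>r ` F. f x *\<^sub>R x) = 0" "x \<in> r ` F"
    have "(\<Sum>e\<in>F. f (r e) *\<^sub>R r e) = 0" using * by (simp add: sum.reindex[OF inj])
    then show "f x = 0" using r *(2) unfolding indep_family_def by force
  qed
  ultimately show "inj_on r F \<and> independent (r ` F)" by simp
next
  assume *: "inj_on r F \<and> independent (r ` F)"
  show "indep_family F r" unfolding indep_family_def
  proof (intro allI impI ballI)
    fix c e assume c: "(\<Sum>e\<in>F. c e *\<^sub>R r e) = 0" "e \<in> F"
    define f where "f = (\<lambda>x. c (inv_into F r x))"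
    have "(\<Sum>x\<in>r ` F. f x *\<^sub>R x) = (\<Sum>e\<in>F. c e *\<^sub>R r e)"
      using * by (simp add: sum.reindex f_def)
    then have "f (r e) = 0"
      using independentD[of "r ` F" "r ` F" f "r e"] * c assms by auto
    then show "c e = 0" using * c(2) by (simp add: f_def)
  qed
qed

lemma indep_family_mono:
  assumes "finite F" "F' \<subseteq> F" "indep_family F r" shows "indep_family F' r"
proof -
  have "inj_on r F" "independent (r ` F)" using assms(1,3) by (simp_all add: indep_family_iff)
  then have "inj_on r F'" "independent (r ` F')"
    using inj_on_subset[OF _ assms(2)] independent_mono[OF _ image_mono[OF assms(2)]] by blast+
  then show ?thesis using indep_family_iff[OF finite_subset[OF assms(2,1)], of r] by blast
qed

lemma indep_family_card_le_dim:
  fixes r :: "'e \<Rightarrow> 'a::euclidean_space"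
  assumes "finite F" "indep_family F r" "r ` F \<subseteq> U"
  shows "card F \<le> dim U"
proof -
  have "inj_on r F" "independent (r ` F)" using assms(1,2) by (simp_all add: indep_family_iff)
  then show ?thesis using independent_card_le_dim[OF assms(3)] card_image[of r F] by metis
qed

lemma indep_family_if_card_le_dim:
  fixes r :: "'e \<Rightarrow> 'a::euclidean_space"
  assumes "finite F" "card F \<le> dim (r ` F)"
  shows "indep_family F r"
proof -
  have "dim (r ` F) \<le> card (r ` F)" using assms(1) by (simp add: dim_le_card')
  then have eq: "card (r ` F) = card F" using assms card_image_le[of F r] by linarith
  then have "inj_on r F" using assms(1) by (simp add: eq_card_imp_inj_on)
  moreover have "independent (r ` F)"
    using assms eq by (intro card_le_dim_spanning[of _ "span (r ` F)"]) (auto simp: span_base)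
  ultimately show ?thesis using assms(1) by (simp add: indep_family_iff)
qed

lemma indep_family_reindex:
  assumes "inj_on f F" shows "indep_family (f ` F) r \<longleftrightarrow> indep_family F (r \<circ> f)"
proof
  assume *: "indep_family (f ` F) r"
  show "indep_family F (r \<circ> f)" unfolding indep_family_def
  proof (intro allI impI ballI)
    fix c e assume c: "(\<Sum>e\<in>F. c e *\<^sub>R (r \<circ> f) e) = 0" "e \<in> F"
    have "(\<Sum>x\<in>f ` F. c (inv_into F f x) *\<^sub>R r x) = 0"
      using assms c by (simp add: sum.reindex)
    then have "c (inv_into F f (f e)) = 0"
      using indep_familyD[OF *, of "\<lambda>x. c (inv_into F f x)" "f e"] c(2) by blast
    then show "c e = 0" using assms c(2) by simp
  qed
next
  assume *: "indep_family F (r \<circ> f)"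
  show "indep_family (f ` F) r" unfolding indep_family_def
  proof (intro allI impI ballI)
    fix c e assume c: "(\<Sum>e\<in>f ` F. c e *\<^sub>R r e) = 0" "e \<in> f ` F"
    have "(\<Sum>e\<in>F. c (f e) *\<^sub>R (r \<circ> f) e) = 0" using c(1) assms by (simp add: sum.reindex)
    then show "c e = 0" using indep_familyD[OF *, of "c \<circ> f"] c(2) by auto
  qed
qed

lemma indep_family_insert:
  assumes "finite F" "x \<notin> F"
  shows "indep_family (insert x F) r \<longleftrightarrow> indep_family F r \<and> r x \<notin> span (r ` F)"
proof -
  have "inj_on r (insert x F) \<and> independent (r ` insert x F) \<longleftrightarrow>
     (inj_on r F \<and> independent (r ` F)) \<and> r x \<notin> span (r ` F)"
    using assms by (auto simp: independent_insert span_base split: if_splits)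
  then show ?thesis using assms by (simp add: indep_family_iff)
qed

text \<open>The transposed linear map need not be mentioned: it is enough to move test vectors.\<close>

lemma indep_family_transfer:
  fixes r :: "'e \<Rightarrow> 'a::real_inner" and r' :: "'e \<Rightarrow> 'b::real_inner"
  assumes "indep_family F r"
    and "\<And>m. \<exists>m'. \<forall>e\<in>F. r' e \<bullet> m' = k e * (r e \<bullet> m)" and "\<And>e. e \<in> F \<Longrightarrow> k e \<noteq> 0"
  shows "indep_family F r'"
  unfolding indep_family_def
proof (intro allI impI ballI)
  fix c e assume c: "(\<Sum>e\<in>F. c e *\<^sub>R r' e) = 0" "e \<in> F"
  have "(\<Sum>e\<in>F. (c e * k e) *\<^sub>R r e) \<bullet> m = 0" for m
  proof -
    obtain m' where m': "\<forall>e\<in>F. r' e \<bullet> m' = k e * (r e \<bullet> m)" using assms(2) by blast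
    have "(\<Sum>e\<in>F. (c e * k e) *\<^sub>R r e) \<bullet> m = (\<Sum>e\<in>F. c e *\<^sub>R r' e) \<bullet> m'"
      using m' by (simp add: inner_sum_left mult.assoc)
    then show ?thesis using c by simp
  qed
  then have "(\<Sum>e\<in>F. (c e * k e) *\<^sub>R r e) = 0"
    using inner_eq_zero_iff by blast
  then have "c e * k e = 0" using indep_familyD[OF assms(1), of "\<lambda>e. c e * k e"] c(2) by blast
  then show "c e = 0" using assms(3) c(2) by simp
qed

section \<open>Rado's theorem on independent transversals\<close>

text \<open>\<open>C\<close> is any set lying in both spans rather than their intersection, so that
  it can be the union of the members common to two subfamilies.\<close>

lemma dim_UN_submodular:
  fixes A B C :: "'a::euclidean_space set"
  assumes "C \<subseteq> span A" "C \<subseteq> span B"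
  shows "dim (A \<union> B) + dim C \<le> dim A + dim B"
proof -
  have "dim {x + y |x y. x \<in> span A \<and> y \<in> span B} + dim (span A \<inter> span B) = dim (span A) + dim (span B)"
    by (rule dim_sums_Int) auto
  moreover have "dim {x + y |x y. x \<in> span A \<and> y \<in> span B} = dim (A \<union> B)"
    unfolding span_Un[symmetric] by (rule dim_span)
  moreover have "dim C \<le> dim (span A \<inter> span B)" using assms by (intro dim_subset) auto
  ultimately show ?thesis by (simp add: dim_span)
qed

text \<open>Rado's linear version of Hall's theorem. As long as some \<open>S i\<close> has two
  distinct elements \<open>x\<close> and \<open>y\<close>, one of them can be deleted without
  violating the rank condition: two violations would contradict submodularity. Once all sets are
  singletons, the condition for \<open>I\<close> itself is independence.\<close>

lemma rado_independent_transversal: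
  fixes S :: "'i \<Rightarrow> 'a::euclidean_space set"
  assumes "finite I" "\<And>i. i \<in> I \<Longrightarrow> finite (S i)"
    and "\<And>J. J \<subseteq> I \<Longrightarrow> card J \<le> dim (\<Union>i\<in>J. S i)"
  shows "\<exists>a. (\<forall>i\<in>I. a i \<in> S i) \<and> indep_family I a"
  using assms(2,3)
proof (induction "\<Sum>i\<in>I. card (S i)" arbitrary: S rule: less_induct)
  case less
  have ne: "S i \<noteq> {}" if "i \<in> I" for i using less.prems(2)[of "{i}"] that by auto
  show ?case
  proof (cases "\<exists>i\<in>I. \<exists>x\<in>S i. \<exists>y\<in>S i. x \<noteq> y")
    case False
    then have "\<forall>i\<in>I. \<exists>x. S i = {x}" using ne by blast
    then obtain a where a: "\<And>i. i \<in> I \<Longrightarrow> S i = {a i}" by metis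
    have "(\<Union>i\<in>I. S i) = a ` I" using a by auto
    then have "indep_family I a" using less.prems(2)[of I] assms(1) by (intro indep_family_if_card_le_dim) auto
    then show ?thesis using a by auto
  next
    case True
    then obtain i x y where i: "i \<in> I" "x \<in> S i" "y \<in> S i" "x \<noteq> y" by blast
    define D where "D z = S(i := S i - {z})" for z
    have red: ?thesis if z: "z \<in> S i" and cond: "\<And>J. J \<subseteq> I \<Longrightarrow> card J \<le> dim (\<Union>j\<in>J. D z j)" for z
    proof -
      have "(\<Sum>j\<in>I. card (D z j)) < (\<Sum>j\<in>I. card (S j))"
      proof (rule sum_strict_mono_ex1[OF assms(1)])
        show "\<forall>j\<in>I. card (D z j) \<le> card (S j)"
          using less.prems(1) by (auto simp: D_def intro!: card_mono)
        show "\<exists>j\<in>I. card (D z j) < card (S j)"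
          using less.prems(1) i z by (intro bexI[of _ i]) (auto simp: D_def intro!: card_Diff1_less simp del: card_Diff_insert card_Diff_singleton)
      qed
      moreover have "finite (D z j)" if "j \<in> I" for j using less.prems(1) that by (auto simp: D_def)
      ultimately obtain a where "\<forall>j\<in>I. a j \<in> D z j" "indep_family I a"
        using less.hyps[of "D z"] cond by blast
      then show ?thesis by (intro exI[of _ a]) (auto simp: D_def split: if_splits)
    qed
    \<comment> \<open>A violating \<open>J\<close> must contain \<open>i\<close>, the only index
      whose set has changed. Passing to \<open>J - {i}\<close> lowers the cardinality by one, so the
      strict inequality becomes a weak one.\<close>
    have bad: "\<exists>B. B \<subseteq> I - {i} \<and> dim ((\<Union>j\<in>B. S j) \<union> (S i - {z})) \<le> card B"
      if J: "J \<subseteq> I" "dim (\<Union>j\<in>J. D z j) < card J" for z J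
    proof -
      have iJ: "i \<in> J"
      proof (rule ccontr)
        assume "i \<notin> J"
        then have "(\<Union>j\<in>J. D z j) = (\<Union>j\<in>J. S j)" by (auto simp: D_def split: if_splits)
        then show False using J less.prems(2)[of J] by simp
      qed
      have "(\<Union>j\<in>J. D z j) = (\<Union>j\<in>J - {i}. S j) \<union> (S i - {z})"
        using iJ by (auto simp: D_def split: if_splits)
      moreover have "card J = Suc (card (J - {i}))"
        using iJ J(1) assms(1) by (metis card_Suc_Diff1 finite_subset)
      ultimately show ?thesis using J by (intro exI[of _ "J - {i}"]) auto
    qed
    show ?thesis
    proof (rule ccontr)
      assume no: "\<not> ?thesis"
      obtain B where B: "B \<subseteq> I - {i}" "dim ((\<Union>j\<in>B. S j) \<union> (S i - {x})) \<le> card B"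
        using bad[of _ x] red[of x] no i by (meson not_le)
      obtain C where C: "C \<subseteq> I - {i}" "dim ((\<Union>j\<in>C. S j) \<union> (S i - {y})) \<le> card C"
        using bad[of _ y] red[of y] no i by (meson not_le)
      have fin: "finite B" "finite C" using B C assms(1) by (meson finite_Diff finite_subset)+
      have "dim (((\<Union>j\<in>B. S j) \<union> (S i - {x})) \<union> ((\<Union>j\<in>C. S j) \<union> (S i - {y})))
            + dim (\<Union>j\<in>B \<inter> C. S j) \<le> card B + card C"
        by (rule order_trans[OF dim_UN_submodular]) (use B C in \<open>auto intro: span_base\<close>)
      \<comment> \<open>As \<open>x\<close> and \<open>y\<close> differ, the two reduced copies of
        \<open>S i\<close> together restore all of \<open>S i\<close>. The index \<open>i\<close> is
        then gained on the left without being paid for on the right.\<close>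
      moreover have eq: "((\<Union>j\<in>B. S j) \<union> (S i - {x})) \<union> ((\<Union>j\<in>C. S j) \<union> (S i - {y}))
          = (\<Union>j\<in>insert i (B \<union> C). S j)" using i by auto
      moreover have "card (insert i (B \<union> C)) \<le> dim (\<Union>j\<in>insert i (B \<union> C). S j)"
        using B C i by (intro less.prems(2)) auto
      moreover have "card (B \<inter> C) \<le> dim (\<Union>j\<in>B \<inter> C. S j)"
        using B by (intro less.prems(2)) auto
      moreover have "card (insert i (B \<union> C)) = Suc (card (B \<union> C))"
        using B C fin by (intro card_insert_disjoint) auto
      moreover have "card (B \<union> C) + card (B \<inter> C) = card B + card C"
        using card_Un_Int[OF fin] by simp
      ultimately show False unfolding eq by linarith
    qed
  qed
qed

lemma indep_family_scaleR:
  assumes "indep_family F r" "\<And>e. e \<in> F \<Longrightarrow> k e \<noteq> 0"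
  shows "indep_family F (\<lambda>e. k e *\<^sub>R r e)"
  unfolding indep_family_def
proof (intro allI impI ballI)
  fix c e assume "(\<Sum>e\<in>F. c e *\<^sub>R k e *\<^sub>R r e) = 0" "e \<in> F"
  then show "c e = 0" using indep_familyD[OF assms(1), of "\<lambda>e. c e * k e" e] assms(2) by simp
qed

lemma indep_family_cong:
  assumes "\<And>e. e \<in> F \<Longrightarrow> r e = r' e"
  shows "indep_family F r \<longleftrightarrow> indep_family F r'"
proof -
  have "(\<Sum>e\<in>F. c e *\<^sub>R r e) = (\<Sum>e\<in>F. c e *\<^sub>R r' e)" for c
    using assms by (intro sum.cong) simp_all
  then show ?thesis by (simp add: indep_family_def)
qed

section \<open>Polynomial genericity of nonvanishing and independence\<close>

lemma real_polynomial_function_line: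
  assumes "real_polynomial_function P"
  shows "\<exists>p. \<forall>t. P (x + t *\<^sub>R y) = poly p t"
  using assms
proof induction
  case (linear f)
  then have "f (x + t *\<^sub>R y) = poly [:f x, f y:] t" for t
    by (simp add: bounded_linear.linear linear_add linear_scale)
  then show ?case by blast
next
  case (const c) have "c = poly [:c:] t" for t by simp then show ?case by blast
next
  case (add f g) then show ?case by (metis poly_add)
next
  case (mult f g) then show ?case by (metis poly_mult)
qed

text \<open>On the line from a point good for \<open>I\<close> to a point good for \<open>i\<close>,
  every function involved restricts to a nonzero univariate polynomial. These have finitely many
  roots altogether, so some parameter avoids them all.\<close>

lemma real_polynomial_function_common_nonzero:
  assumes "finite I" "\<And>i. i \<in> I \<Longrightarrow> real_polynomial_function (P i)" "\<And>i. i \<in> I \<Longrightarrow> \<exists>x. P i x \<noteq> 0"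
  shows "\<exists>x. \<forall>i\<in>I. P i x \<noteq> 0"
  using assms
proof (induction I)
  case (insert i I)
  obtain x where x: "\<forall>j\<in>I. P j x \<noteq> 0" using insert.IH insert.prems by (meson insertI2)
  obtain y where y: "P i y \<noteq> 0" using insert.prems(2)[of i] by auto
  have "\<exists>p. \<forall>t. P j (x + t *\<^sub>R (y - x)) = poly p t" if "j \<in> insert i I" for j
    using insert.prems(1)[OF that] by (rule real_polynomial_function_line)
  then obtain p where p: "\<And>j t. j \<in> insert i I \<Longrightarrow> P j (x + t *\<^sub>R (y - x)) = poly (p j) t" by metis
  have "poly (p j) 0 \<noteq> 0" if "j \<in> I" for j
  proof -
    have "poly (p j) 0 = P j x" using p[of j 0] that by simp
    then show ?thesis using x that by metis
  qed
  moreover have "poly (p i) 1 \<noteq> 0" using p[of i 1] y by simp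
  ultimately have nz: "p j \<noteq> 0" if "j \<in> insert i I" for j using that by (metis insertE poly_0)
  have "finite (\<Union>j\<in>insert i I. {t. poly (p j) t = 0})"
    using insert.hyps nz by (intro finite_UN_I) (auto simp: poly_roots_finite)
  then obtain t where "t \<notin> (\<Union>j\<in>insert i I. {t. poly (p j) t = 0})"
    using ex_new_if_finite[OF infinite_UNIV_char_0] by blast
  then have "\<forall>j\<in>insert i I. P j (x + t *\<^sub>R (y - x)) \<noteq> 0" using p by simp
  then show ?case by blast
qed simp

lemma polynomial_function_inner_const:
  fixes f :: "'x::real_normed_vector \<Rightarrow> 'a::real_inner"
  assumes "polynomial_function f" shows "real_polynomial_function (\<lambda>x. f x \<bullet> b)"
  using assms[unfolded polynomial_function_def o_def, rule_format, OF bounded_linear_inner_left] .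

text \<open>Gaussian elimination with a polynomial pivot, which avoids determinants.\<close>

lemma indep_family_generic:
  fixes r :: "'e \<Rightarrow> 'x::real_normed_vector \<Rightarrow> 'a::euclidean_space"
  assumes "finite F" "\<And>e. e \<in> F \<Longrightarrow> polynomial_function (r e)" "indep_family F (\<lambda>e. r e x\<^sub>0)"
  shows "\<exists>P. real_polynomial_function P \<and> P x\<^sub>0 \<noteq> 0 \<and> (\<forall>x. P x \<noteq> 0 \<longrightarrow> indep_family F (\<lambda>e. r e x))"
  using assms
proof (induction F arbitrary: r)
  case empty
  show ?case by (intro exI[of _ "\<lambda>_. 1"]) (auto simp: indep_family_def)
next
  case (insert e\<^sub>0 F)
  have ind: "c e\<^sub>0 = 0 \<and> (\<forall>e\<in>F. c e = 0)"
    if "c e\<^sub>0 *\<^sub>R r e\<^sub>0 x\<^sub>0 + (\<Sum>e\<in>F. c e *\<^sub>R r e x\<^sub>0) = 0" for c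
    using indep_familyD[OF insert.prems(2), of c] insert.hyps that by simp
  have "r e\<^sub>0 x\<^sub>0 \<noteq> 0"
  proof
    assume "r e\<^sub>0 x\<^sub>0 = 0"
    moreover have "(\<Sum>e\<in>F. (if e = e\<^sub>0 then 1 else 0::real) *\<^sub>R r e x\<^sub>0) = 0"
      using insert.hyps by (intro sum.neutral) auto
    ultimately show False using ind[of "\<lambda>e. if e = e\<^sub>0 then 1 else 0"] by simp
  qed
  then obtain b where b: "r e\<^sub>0 x\<^sub>0 \<bullet> b \<noteq> 0" using inner_eq_zero_iff by blast
  \<comment> \<open>Elimination of the component along the pivot direction \<open>b\<close>, with
    denominators cleared so that the result stays polynomial: \<open>w e x \<bullet> b = 0\<close>
    holds for all \<open>x\<close>.\<close>
  define w where "w e x = (r e\<^sub>0 x \<bullet> b) *\<^sub>R r e x - (r e x \<bullet> b) *\<^sub>R r e\<^sub>0 x" for e x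
  have w_sum: "(\<Sum>e\<in>F. c e *\<^sub>R w e x)
      = (r e\<^sub>0 x \<bullet> b) *\<^sub>R (\<Sum>e\<in>F. c e *\<^sub>R r e x) - ((\<Sum>e\<in>F. c e *\<^sub>R r e x) \<bullet> b) *\<^sub>R r e\<^sub>0 x" for c x
    by (simp add: w_def inner_sum_left scaleR_sum_left scaleR_sum_right sum_subtractf
        scaleR_diff_right mult.commute)
  have "polynomial_function (w e)" if "e \<in> F" for e
    using insert.prems(1)[of e\<^sub>0] insert.prems(1)[of e] that unfolding w_def
    by (intro polynomial_function_diff polynomial_function_mult)
       (simp_all add: polynomial_function_inner_const flip: real_polynomial_function_eq)
  moreover have "indep_family F (\<lambda>e. w e x\<^sub>0)"
    unfolding indep_family_def
  proof (intro allI impI ballI)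
    fix c e assume c: "(\<Sum>e\<in>F. c e *\<^sub>R w e x\<^sub>0) = 0" "e \<in> F"
    define c' where "c' = (\<lambda>e. if e = e\<^sub>0 then - ((\<Sum>e\<in>F. c e *\<^sub>R r e x\<^sub>0) \<bullet> b) else (r e\<^sub>0 x\<^sub>0 \<bullet> b) * c e)"
    have "(\<Sum>e\<in>F. c' e *\<^sub>R r e x\<^sub>0) = (r e\<^sub>0 x\<^sub>0 \<bullet> b) *\<^sub>R (\<Sum>e\<in>F. c e *\<^sub>R r e x\<^sub>0)"
      using insert.hyps unfolding scaleR_sum_right by (intro sum.cong) (auto simp: c'_def)
    then have "c' e\<^sub>0 *\<^sub>R r e\<^sub>0 x\<^sub>0 + (\<Sum>e\<in>F. c' e *\<^sub>R r e x\<^sub>0) = 0"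
      using c(1) unfolding w_sum by (simp add: c'_def)
    then have "c' e = 0" using ind[of c'] c(2) by blast
    then show "c e = 0" using b c(2) insert.hyps by (auto simp: c'_def split: if_splits)
  qed
  ultimately obtain P where P: "real_polynomial_function P" "P x\<^sub>0 \<noteq> 0"
    "\<And>x. P x \<noteq> 0 \<Longrightarrow> indep_family F (\<lambda>e. w e x)"
    using insert.IH[of w] by blast
  \<comment> \<open>The second factor is the pivot. Where it is nonzero, independence of the
    eliminated vectors gives independence of the original ones.\<close>
  show ?case
  proof (intro exI[of _ "\<lambda>x. P x * (r e\<^sub>0 x \<bullet> b)"] conjI allI impI)
    show "real_polynomial_function (\<lambda>x. P x * (r e\<^sub>0 x \<bullet> b))"
      using P(1) insert.prems(1)[of e\<^sub>0] by (intro real_polynomial_function.intros(4) polynomial_function_inner_const) auto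
    show "P x\<^sub>0 * (r e\<^sub>0 x\<^sub>0 \<bullet> b) \<noteq> 0" using P b by simp
    fix x assume x: "P x * (r e\<^sub>0 x \<bullet> b) \<noteq> 0"
    show "indep_family (insert e\<^sub>0 F) (\<lambda>e. r e x)"
      unfolding indep_family_def
    proof (intro allI impI)
      fix c assume "(\<Sum>e\<in>insert e\<^sub>0 F. c e *\<^sub>R r e x) = 0"
      then have c: "(\<Sum>e\<in>F. c e *\<^sub>R r e x) = - (c e\<^sub>0 *\<^sub>R r e\<^sub>0 x)"
        using insert.hyps by (simp add: eq_neg_iff_add_eq_0 add.commute)
      have "(\<Sum>e\<in>F. c e *\<^sub>R w e x) = 0" unfolding w_sum c by simp
      then have 0: "c e = 0" if "e \<in> F" for e
        using indep_familyD[OF P(3), of x c e] x that by simp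
      then have "c e\<^sub>0 *\<^sub>R r e\<^sub>0 x = 0" using c by simp
      then have "c e\<^sub>0 = 0" using x by auto
      then show "\<forall>e\<in>insert e\<^sub>0 F. c e = 0" using 0 by simp
    qed
  qed
qed

text \<open>Spans the intersection of the plane through \<open>a\<close> and \<open>b\<close> with the hyperplane orthogonal to \<open>h\<close>;
  it is 0 if \<open>h\<close> is orthogonal to the whole plane.\<close>

definition hyperplane_cut :: "'a \<Rightarrow> 'a \<Rightarrow> 'a \<Rightarrow> 'a::real_inner" where
  "hyperplane_cut h a b = (h \<bullet> b) *\<^sub>R a - (h \<bullet> a) *\<^sub>R b"

section \<open>Dilworth truncation by a generic hyperplane\<close>

lemma orthogonal_not_in_span:
  fixes d :: "'a::euclidean_space"
  assumes "d \<notin> span S"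
  shows "\<exists>h. (\<forall>x\<in>S. h \<bullet> x = 0) \<and> h \<bullet> d \<noteq> 0"
proof -
  obtain y z where yz: "y \<in> span S" "\<And>w. w \<in> span S \<Longrightarrow> orthogonal z w" "d = y + z"
    using orthogonal_subspace_decomp_exists[of S d] by blast
  have "z \<noteq> 0" using yz assms by auto
  moreover have "z \<bullet> y = 0" using yz(1,2) by (simp add: orthogonal_def)
  ultimately have "z \<bullet> d \<noteq> 0" unfolding yz(3) by (simp add: inner_add_right)
  then show ?thesis using yz(2) by (intro exI[of _ z]) (auto simp: orthogonal_def span_base)
qed

text \<open>The independence condition of the Dilworth truncation; the \<open>+ 1\<close> is the
  dimension lost to the hyperplane. For a single \<open>e\<close> it says that \<open>a e\<close>
  and \<open>b e\<close> really span a plane.\<close>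

definition truncation_count :: "'e set \<Rightarrow> ('e \<Rightarrow> 'a::euclidean_space) \<Rightarrow> ('e \<Rightarrow> 'a) \<Rightarrow> bool" where
  "truncation_count F a b \<longleftrightarrow>
     (\<forall>F'\<subseteq>F. F' \<noteq> {} \<longrightarrow> card F' + 1 \<le> dim (\<Union>e\<in>F'. {a e, b e}))"

text \<open>Rado's condition for the planes of \<open>F\<close> with the plane of
  \<open>e\<^sub>0\<close> used twice. The index \<open>None\<close> stands for the second copy, and
  the \<open>+ 1\<close> of the count pays for it.\<close>

lemma truncation_count_transversal:
  fixes a b :: "'e::finite \<Rightarrow> 'a::euclidean_space"
  assumes "truncation_count F a b" "e\<^sub>0 \<in> F"
  shows "\<exists>c d. (\<forall>e\<in>F. c e \<in> {a e, b e}) \<and> d \<in> {a e\<^sub>0, b e\<^sub>0} \<and>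
    indep_family (insert None (Some ` F)) (case_option d c)"
proof -
  define S where "S = case_option {a e\<^sub>0, b e\<^sub>0} (\<lambda>e. {a e, b e})"
  have "\<exists>f. (\<forall>i\<in>insert None (Some ` F). f i \<in> S i) \<and> indep_family (insert None (Some ` F)) f"
  proof (rule rado_independent_transversal)
    show "finite (S i)" for i by (auto simp: S_def split: option.split)
    fix J assume J: "J \<subseteq> insert None (Some ` F)"
    define F' where "F' = {e. Some e \<in> J}"
    have F': "F' \<subseteq> F" using J by (auto simp: F'_def)
    have "J \<subseteq> insert None (Some ` F')"
    proof
      fix i assume "i \<in> J" then show "i \<in> insert None (Some ` F')" by (cases i) (auto simp: F'_def)
    qed
    then have "card J \<le> card (insert None (Some ` F'))" by (intro card_mono) auto
    also have "\<dots> = card F' + 1" by (simp add: card_image)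
    finally have cJ: "card J \<le> card F' + 1" .
    show "card J \<le> dim (\<Union> (S ` J))"
    proof (cases "F' = {}")
      case False
      have "card F' + 1 \<le> dim (\<Union>e\<in>F'. {a e, b e})"
        using assms(1) F' False by (auto simp: truncation_count_def)
      also have "\<dots> \<le> dim (\<Union> (S ` J))" by (intro dim_subset) (force simp: S_def F'_def)
      finally show ?thesis using cJ by simp
    next
      case True
      show ?thesis
      proof (cases "None \<in> J")
        case True
        \<comment> \<open>Here \<open>J\<close> is just \<open>{None}\<close> and the count says
          nothing about the empty \<open>F'\<close>, so the count of \<open>{e\<^sub>0}\<close> is
          used instead.\<close>
        have "2 \<le> dim (\<Union>e\<in>{e\<^sub>0}. {a e, b e})"
          using assms(1)[unfolded truncation_count_def, rule_format, of "{e\<^sub>0}"] assms(2) by simp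
        also have "\<dots> \<le> dim (\<Union> (S ` J))" using True by (intro dim_subset) (force simp: S_def)
        finally show ?thesis using cJ \<open>F' = {}\<close> by simp
      next
        case False
        moreover have "Some e \<notin> J" for e using \<open>F' = {}\<close> by (simp add: F'_def)
        ultimately have "i \<notin> J" for i by (cases i) auto
        then have "J = {}" by blast
        then show ?thesis by simp
      qed
    qed
  qed simp
  then obtain f where f: "\<forall>i\<in>insert None (Some ` F). f i \<in> S i" "indep_family (insert None (Some ` F)) f" by blast
  have "f = case_option (f None) (f \<circ> Some)" by (auto split: option.split)
  then show ?thesis using f
    by (intro exI[of _ "f \<circ> Some"] exI[of _ "f None"]) (auto simp: S_def)
qed

text \<open>The planes of \<open>F\<close> have an independent transversal even if the plane of one \<open>e \<in> F\<close> is taken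
  twice.  So for a generic choice of \<open>c i\<close> in the plane of every \<open>i \<in> F\<close>, and for every \<open>e\<close>, some \<open>h\<close> orthogonal to all \<open>c i\<close> is not orthogonal to the plane of \<open>e\<close>.
  A common \<open>h\<close> for all \<open>e\<close> cuts every plane precisely in the line of \<open>c e\<close>.\<close>

lemma truncation_count_imp_indep_family:
  fixes a b :: "'e::finite \<Rightarrow> 'a::euclidean_space"
  assumes "truncation_count F a b"
  shows "\<exists>h. indep_family F (\<lambda>e. hyperplane_cut h (a e) (b e))"
proof -
  let ?cx = "\<lambda>x e. (fst (fst x) $ e) *\<^sub>R a e + (snd (fst x) $ e) *\<^sub>R b e"
  let ?dx = "\<lambda>x e. (fst (snd x) $ e) *\<^sub>R a e + (snd (snd x) $ e) *\<^sub>R b e"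
  let ?I = "insert None (Some ` F)"
  \<comment> \<open>The variable \<open>x\<close> collects the coefficients of points in the planes:
    its first pair those of the points \<open>c\<close>, its second pair those of the additional
    points \<open>d\<close>. The transversal in \<open>{a e, b e}\<close> is the special case of
    coefficients 0 and 1.\<close>
  define G :: "'e \<Rightarrow> 'e option \<Rightarrow> ((real^'e) \<times> (real^'e)) \<times> ((real^'e) \<times> (real^'e)) \<Rightarrow> 'a"
    where "G e\<^sub>0 i x = case_option (?dx x e\<^sub>0) (?cx x) i" for e\<^sub>0 i x
  have lin: "polynomial_function (\<lambda>x. fst (fst x) $ e)" "polynomial_function (\<lambda>x. snd (fst x) $ e)"
    "polynomial_function (\<lambda>x. fst (snd x) $ e)" "polynomial_function (\<lambda>x. snd (snd x) $ e)"
    for e :: 'e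
    by (auto intro!: polynomial_function_bounded_linear bounded_linear_compose[OF bounded_linear_vec_nth]
        bounded_linear_fst_comp bounded_linear_snd_comp bounded_linear_ident)
  have polyG: "polynomial_function (G e\<^sub>0 i)" for e\<^sub>0 i
    unfolding G_def by (cases i) (auto intro!: polynomial_function_add polynomial_function_mult lin)
  have "\<exists>P. real_polynomial_function P \<and> (\<exists>x. P x \<noteq> 0) \<and> (\<forall>x. P x \<noteq> 0 \<longrightarrow> indep_family ?I (\<lambda>i. G e i x))"
    if e: "e \<in> F" for e
  proof -
    obtain c d where cd: "\<forall>e\<in>F. c e \<in> {a e, b e}" "d \<in> {a e, b e}" "indep_family ?I (case_option d c)"
      using truncation_count_transversal[OF assms e] by blast
    define x :: "((real^'e) \<times> (real^'e)) \<times> ((real^'e) \<times> (real^'e))" where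
      "x = (((\<chi> e. if c e = a e then 1 else 0), (\<chi> e. if c e = a e then 0 else 1)),
        ((\<chi> i. if d = a e then 1 else 0), (\<chi> i. if d = a e then 0 else 1)))"
    have "indep_family ?I (\<lambda>i. G e i x)"
      using cd by (subst indep_family_cong[of _ _ "case_option d c"]) (auto simp: G_def x_def)
    then obtain P where "real_polynomial_function P" "P x \<noteq> 0"
      "\<forall>x. P x \<noteq> 0 \<longrightarrow> indep_family ?I (\<lambda>i. G e i x)"
      using indep_family_generic[of ?I "G e" x, OF _ polyG] by (meson finite finite_imageI finite_insert)
    then show ?thesis by (intro exI[of _ P] conjI exI[of _ x])
  qed
  then obtain P where P: "\<And>e. e \<in> F \<Longrightarrow> real_polynomial_function (P e)" "\<And>e. e \<in> F \<Longrightarrow> \<exists>x. P e x \<noteq> 0"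
    "\<And>e x. e \<in> F \<Longrightarrow> P e x \<noteq> 0 \<Longrightarrow> indep_family ?I (\<lambda>i. G e i x)" by metis
  \<comment> \<open>Besides independence (\<open>k = 0\<close>), both coefficients of every
    \<open>c e\<close> are made nonzero. A vector orthogonal to \<open>c e\<close> and
    \<open>a e\<close> is then orthogonal to \<open>b e\<close> too, so
    \<open>h \<bullet> a e \<noteq> 0\<close> is the right test for \<open>h\<close> not being
    orthogonal to the plane.\<close>
  define Q where "Q = (\<lambda>(k::nat, e) x. if k = 0 then P e x else if k = 1 then fst (fst x) $ e else snd (fst x) $ e)"
  have "\<exists>x. \<forall>i\<in>{0,1,2} \<times> F. Q i x \<noteq> 0"
  proof (rule real_polynomial_function_common_nonzero)
    fix i assume i: "i \<in> {0::nat,1,2} \<times> F"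
    then show "real_polynomial_function (Q i)"
      using P(1) lin(1,2) by (auto simp: Q_def real_polynomial_function_eq)
    obtain k e where ke: "i = (k, e)" "k \<in> {0,1,2}" "e \<in> F" using i by auto
    let ?x = "((axis e 1, axis e 1), (0, 0)) :: ((real^'e) \<times> (real^'e)) \<times> ((real^'e) \<times> (real^'e))"
    have "Q i ?x \<noteq> 0" if "k \<noteq> 0" using ke that by (auto simp: Q_def)
    moreover have "\<exists>x. Q i x \<noteq> 0" if "k = 0" using ke that P(2) by (simp add: Q_def)
    ultimately show "\<exists>x. Q i x \<noteq> 0" by blast
  qed simp
  then obtain x where x: "\<And>e. e \<in> F \<Longrightarrow> P e x \<noteq> 0" "\<And>e. e \<in> F \<Longrightarrow> fst (fst x) $ e \<noteq> 0"
    "\<And>e. e \<in> F \<Longrightarrow> snd (fst x) $ e \<noteq> 0" unfolding Q_def by force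
  define c where "c = ?cx x"
  define d where "d = ?dx x"
  have ind: "indep_family ?I (case_option (d e) c)" if "e \<in> F" for e
    using P(3)[OF that x(1)[OF that]] by (simp add: G_def c_def d_def)
  have indc: "indep_family F c" and d: "d e \<notin> span (c ` F)" if "e \<in> F" for e
  proof -
    have *: "indep_family (Some ` F) (case_option (d e) c)" "d e \<notin> span (case_option (d e) c ` Some ` F)"
      using ind[OF that] by (auto simp: indep_family_insert)
    show "indep_family F c" using *(1) by (subst (asm) indep_family_reindex) (auto simp: o_def)
    show "d e \<notin> span (c ` F)" using *(2) by (simp add: image_image)
  qed
  have "\<exists>h. (\<forall>i\<in>F. h \<bullet> c i = 0) \<and> h \<bullet> a e \<noteq> 0" if e: "e \<in> F" for e
  proof -
    obtain h where h: "\<forall>i\<in>F. h \<bullet> c i = 0" "h \<bullet> d e \<noteq> 0" using orthogonal_not_in_span[OF d[OF e]] by auto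
    have "(fst (fst x) $ e) * (h \<bullet> a e) + (snd (fst x) $ e) * (h \<bullet> b e) = 0"
      using h(1) e by (auto simp: c_def inner_add_right)
    moreover have "h \<bullet> a e \<noteq> 0 \<or> h \<bullet> b e \<noteq> 0" using h(2) by (auto simp: d_def inner_add_right)
    ultimately have "h \<bullet> a e \<noteq> 0" using x(3)[OF e] by auto
    then show ?thesis using h by blast
  qed
  then obtain g where g: "\<And>e i. e \<in> F \<Longrightarrow> i \<in> F \<Longrightarrow> g e \<bullet> c i = 0" "\<And>e. e \<in> F \<Longrightarrow> g e \<bullet> a e \<noteq> 0" by metis
  \<comment> \<open>Each \<open>g e\<close> is suitable for its own \<open>e\<close> only. All of
    them are orthogonal to every \<open>c i\<close>, hence so are their linear combinations, and a
    generic combination is suitable for every \<open>e\<close> at once.\<close>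
  have "\<exists>t::real^'e. \<forall>e\<in>F. (\<Sum>i\<in>F. t $ i *\<^sub>R g i) \<bullet> a e \<noteq> 0"
  proof (rule real_polynomial_function_common_nonzero)
    fix e assume e: "e \<in> F"
    have "bounded_linear (\<lambda>t::real^'e. (\<Sum>i\<in>F. t $ i *\<^sub>R g i) \<bullet> a e)"
      by (simp add: linear_conv_bounded_linear[symmetric] linear_iff inner_sum_left sum.distrib
          sum_distrib_left distrib_right mult.assoc)
    then show "real_polynomial_function (\<lambda>t::real^'e. (\<Sum>i\<in>F. t $ i *\<^sub>R g i) \<bullet> a e)" by blast
    have "(\<Sum>i\<in>F. axis e (1::real) $ i *\<^sub>R g i) = (\<Sum>i\<in>{e}. axis e (1::real) $ i *\<^sub>R g i)"
      using e by (intro sum.mono_neutral_right) (auto simp: axis_def)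
    then have "(\<Sum>i\<in>F. axis e (1::real) $ i *\<^sub>R g i) \<bullet> a e \<noteq> 0" using g(2)[OF e] by simp
    then show "\<exists>t::real^'e. (\<Sum>i\<in>F. t $ i *\<^sub>R g i) \<bullet> a e \<noteq> 0" by blast
  qed simp
  then obtain t :: "real^'e" where t: "\<forall>e\<in>F. (\<Sum>i\<in>F. t $ i *\<^sub>R g i) \<bullet> a e \<noteq> 0" by blast
  define h where "h = (\<Sum>i\<in>F. t $ i *\<^sub>R g i)"
  have h: "h \<bullet> a e \<noteq> 0" "h \<bullet> c e = 0" if "e \<in> F" for e
    using t that g(1) by (simp_all add: h_def inner_sum_left)
  show ?thesis
  proof (cases "F = {}")
    case True then show ?thesis by (simp add: indep_family_def)
  next
    case False
    \<comment> \<open>As \<open>h\<close> is orthogonal to \<open>c e\<close> but not to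
      \<open>a e\<close>, the plane meets the hyperplane exactly in the line of \<open>c e\<close>.
      Comparing coefficients at \<open>b e\<close> gives the factor.\<close>
    let ?k = "\<lambda>e. - (h \<bullet> a e) / (snd (fst x) $ e)"
    have "indep_family F (\<lambda>e. ?k e *\<^sub>R c e)"
      using indc False h(1) x(3) by (intro indep_family_scaleR) auto
    moreover have "?k e *\<^sub>R c e = hyperplane_cut h (a e) (b e)" if e: "e \<in> F" for e
    proof -
      have "(fst (fst x) $ e) * (h \<bullet> a e) + (snd (fst x) $ e) * (h \<bullet> b e) = 0"
        using h(2)[OF e] by (simp add: c_def inner_add_right)
      then have "h \<bullet> b e = ?k e * (fst (fst x) $ e)"
        using x(3)[OF e] by (simp add: field_simps)
      then show ?thesis using x(3)[OF e] unfolding hyperplane_cut_def c_def scaleR_add_right scaleR_scaleR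
        by simp
    qed
    ultimately show ?thesis
      using indep_family_cong[of F "\<lambda>e. ?k e *\<^sub>R c e" "\<lambda>e. hyperplane_cut h (a e) (b e)"] by blast
  qed
qed

text \<open>The cuts lie in the span of the planes and in the hyperplane. A cut in an independent
  family is nonzero, so \<open>h\<close> is not orthogonal to the whole span and the intersection
  loses a dimension. This direction holds for every \<open>h\<close>.\<close>

lemma indep_family_imp_truncation_count:
  fixes a b :: "'e::finite \<Rightarrow> 'a::euclidean_space"
  assumes "indep_family F (\<lambda>e. hyperplane_cut h (a e) (b e))"
  shows "truncation_count F a b"
  unfolding truncation_count_def
proof (intro allI impI)
  fix F' assume F': "F' \<subseteq> F" "F' \<noteq> {}"
  let ?r = "\<lambda>e. hyperplane_cut h (a e) (b e)" and ?U = "span (\<Union>e\<in>F'. {a e, b e})"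
  let ?V = "{u \<in> ?U. h \<bullet> u = 0}"
  have ind: "indep_family F' ?r" using indep_family_mono[OF _ F'(1) assms] by simp
  have sV: "subspace ?V"
    by (auto simp: subspace_def inner_add_right span_add span_scale span_zero)
  have r: "?r ` F' \<subseteq> ?V"
  proof clarify
    fix e assume "e \<in> F'"
    then have "a e \<in> ?U" "b e \<in> ?U" by (auto intro!: span_base)
    then show "?r e \<in> ?U \<and> h \<bullet> ?r e = 0"
      by (simp add: hyperplane_cut_def inner_diff_right span_diff span_scale)
  qed
  have "card F' \<le> dim ?V" by (rule indep_family_card_le_dim[OF _ ind r]) simp
  moreover have "dim ?V < dim ?U"
  proof (rule dim_psubset)
    obtain e where e: "e \<in> F'" using F'(2) by blast
    have "?r e \<noteq> 0"
    proof
      assume "?r e = 0"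
      then have "(\<Sum>i\<in>F'. (if i = e then 1 else 0::real) *\<^sub>R ?r i) = 0" by (intro sum.neutral) auto
      from indep_familyD[OF ind this e] show False by simp
    qed
    then have "h \<bullet> a e \<noteq> 0 \<or> h \<bullet> b e \<noteq> 0" by (auto simp: hyperplane_cut_def)
    moreover have "a e \<in> ?U" "b e \<in> ?U" using e by (auto intro!: span_base)
    ultimately have "?V \<subset> ?U" by blast
    then show "span ?V \<subset> span ?U" 
      unfolding span_eq_iff[THEN iffD2, OF sV] span_span .
  qed
  ultimately show "card F' + 1 \<le> dim (\<Union>e\<in>F'. {a e, b e})" by (simp add: dim_span)
qed

section \<open>Counts on signed graphs\<close>

lemma dim_annihilator:
  fixes U :: "'a::euclidean_space set"
  assumes "subspace U" "S \<subseteq> U"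
  shows "dim S + dim {m \<in> U. \<forall>x\<in>S. x \<bullet> m = 0} = dim U"
proof -
  have "{m \<in> U. \<forall>x\<in>span S. orthogonal x m} = {m \<in> U. \<forall>x\<in>S. x \<bullet> m = 0}"
    by (auto simp: orthogonal_def span_base)
       (metis orthogonal_def orthogonal_to_span orthogonal_commute)
  then show ?thesis
    using dim_subspace_orthogonal_to_vectors[of "span S" U] assms span_minimal[of S U]
    by (simp add: dim_span)
qed

lemma dim_le_of_orthogonal_vector:
  fixes u :: "'a::euclidean_space"
  assumes "subspace U" "S \<subseteq> U" "u \<in> U" "u \<noteq> 0" "\<And>x. x \<in> S \<Longrightarrow> x \<bullet> u = 0"
  shows "dim S + 1 \<le> dim U"
proof -
  have "dim {u} \<le> dim {m \<in> U. \<forall>x\<in>S. x \<bullet> m = 0}" using assms by (intro dim_subset) auto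
  then show ?thesis using dim_annihilator[OF assms(1,2)] assms(4) by simp
qed

lemma dim_le_of_two_orthogonal_vectors:
  fixes u v :: "'a::euclidean_space"
  assumes "subspace U" "S \<subseteq> U" "u \<in> U" "v \<in> U" "u \<noteq> 0" "v \<noteq> 0" "u \<bullet> v = 0"
    "\<And>x. x \<in> S \<Longrightarrow> x \<bullet> u = 0" "\<And>x. x \<in> S \<Longrightarrow> x \<bullet> v = 0"
  shows "dim S + 2 \<le> dim U"
proof -
  have ne: "u \<noteq> v" using assms by auto
  have "independent {u, v}"
    using assms by (intro pairwise_orthogonal_independent)
      (auto simp: pairwise_def orthogonal_def inner_commute)
  then have "dim {u, v} = 2" using ne by (simp add: dim_eq_card_independent)
  moreover have "dim {u, v} \<le> dim {m \<in> U. \<forall>x\<in>S. x \<bullet> m = 0}" using assms by (intro dim_subset) auto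
  ultimately show ?thesis using dim_annihilator[OF assms(1,2)] by simp
qed

lemma dim_le_DIM_of_injective:
  fixes L :: "'a::euclidean_space \<Rightarrow> 'b::euclidean_space"
  assumes "subspace K" "linear L" "\<And>m. m \<in> K \<Longrightarrow> L m = 0 \<Longrightarrow> m = 0"
  shows "dim K \<le> DIM('b)"
proof -
  have "inj_on L (span K)"
    using assms unfolding span_eq_iff[THEN iffD2, OF assms(1)]
    by (intro inj_onI) (metis eq_iff_diff_eq_0 linear_diff subspace_diff)
  then have "dim K = dim (L ` K)" using dim_image_eq[OF assms(2)] by simp
  then show ?thesis using dim_subset_UNIV[of "L ` K"] by simp
qed

section \<open>Sparsity counts and edge planes of signed graphs\<close>

text \<open>A gain in a group of order two is a sign \<open>eps\<close>. Loops and parallel edges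
  are permitted, \<open>Fr\<close> is the set of free vertices, and all other vertices are
  fixed.\<close>

locale signed_graph =
  fixes src dst :: "'e::finite \<Rightarrow> 'o::finite" and eps :: "'e \<Rightarrow> real" and Fr :: "'o set"
  assumes eps: "eps e = 1 \<or> eps e = - 1"
begin

definition ends :: "'e set \<Rightarrow> 'o set" where
  "ends F = src ` F \<union> dst ` F"

text \<open>Balance in the form of a potential: switching the vertices with
  \<open>\<theta> v = - 1\<close> makes all signs positive. Edges at fixed vertices are exempt,
  because balance is tested after deleting those vertices.\<close>

definition switchable :: "'e set \<Rightarrow> bool" where
  "switchable F \<longleftrightarrow> (\<exists>\<theta>. (\<forall>v. \<theta> v = 1 \<or> \<theta> v = (- 1 :: real)) \<and>
     (\<forall>e\<in>F. src e \<in> Fr \<and> dst e \<in> Fr \<longrightarrow> \<theta> (src e) = eps e * \<theta> (dst e)))"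

text \<open>Gain-sparsity for \<open>m = 1\<close>, stated for edge sets. Vertices of a subgraph
  beyond the ends of its edges would only enlarge the bounds.\<close>

definition count_sparse :: "int \<Rightarrow> 'e set \<Rightarrow> bool" where
  "count_sparse l F \<longleftrightarrow> (\<forall>F'\<subseteq>F. F' \<noteq> {} \<longrightarrow>
     (switchable F' \<longrightarrow> int (card F') \<le> 2 * int (card (ends F')) - 3) \<and>
     int (card F') \<le> 2 * int (card (ends F' \<inter> Fr)) + int (card (ends F' - Fr)) - l)"

text \<open>Two coordinates at a free vertex, one at a fixed vertex. The first component holds the
  velocity that vanishes on the mirror: the horizontal one for symmetric motions, the vertical one
  for antisymmetric motions.\<close>

definition coords :: "'o set \<Rightarrow> ((real^'o) \<times> (real^'o)) set" where
  "coords V = {m. (\<forall>v. v \<notin> V \<inter> Fr \<longrightarrow> fst m $ v = 0) \<and> (\<forall>v. v \<notin> V \<longrightarrow> snd m $ v = 0)}"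

definition free_axis :: "'o \<Rightarrow> real^'o" where
  "free_axis v = (if v \<in> Fr then axis v 1 else 0)"

definition signed_inc :: "'e \<Rightarrow> real^'o" where
  "signed_inc e = free_axis (src e) - eps e *\<^sub>R free_axis (dst e)"

definition plain_inc :: "'e \<Rightarrow> real^'o" where
  "plain_inc e = axis (src e) 1 - axis (dst e) 1"

text \<open>With \<open>antisym_vec2\<close> this spans the plane containing the row of
  \<open>e\<close> in every realisation; the realisation decides only on a multiple of each of the
  two vectors.\<close>

definition antisym_vec1 :: "'e \<Rightarrow> (real^'o) \<times> (real^'o)" where "antisym_vec1 e = (signed_inc e, 0)"
definition antisym_vec2 :: "'e \<Rightarrow> (real^'o) \<times> (real^'o)" where "antisym_vec2 e = (0, plain_inc e)"

text \<open>After the projective map \<open>(x, y) \<mapsto> (1/x, y/x)\<close> a fixed vertex \<open>u\<close> at \<open>(0, d u)\<close> is a point at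
  infinity, in the direction \<open>(1, d u)\<close>, which keeps one degree of freedom.\<close>

definition sym_vec1 :: "('o \<Rightarrow> real) \<Rightarrow> 'e \<Rightarrow> (real^'o) \<times> (real^'o)" where
  "sym_vec1 d e = (if src e \<in> Fr then if dst e \<in> Fr then (signed_inc e, 0)
       else (- d (dst e) *\<^sub>R axis (src e) 1, axis (src e) 1)
     else if dst e \<in> Fr then (- d (src e) *\<^sub>R axis (dst e) 1, axis (dst e) 1) else (0, axis (src e) 1))"

text \<open>A fixed end contributes its single coordinate. An edge between two fixed vertices joins
  two points at infinity, and its plane is spanned by their two coordinates; for a loop it
  degenerates.\<close>

definition sym_vec2 :: "'e \<Rightarrow> (real^'o) \<times> (real^'o)" where
  "sym_vec2 e = (if src e \<in> Fr \<and> dst e \<in> Fr then (0, signed_inc e)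
     else if dst e \<in> Fr then (0, axis (src e) 1) else (0, axis (dst e) 1))"

lemma ends_ne: "F \<noteq> {} \<Longrightarrow> ends F \<noteq> {}" by (auto simp: ends_def)

lemma card_ends: "card (ends F) = card (ends F \<inter> Fr) + card (ends F - Fr)"
  by (metis Int_Diff_disjoint Int_Diff_Un card_Un_disjoint finite)

lemma subspace_coords: "subspace (coords V)"
  by (auto simp: subspace_def coords_def)

lemma coords_mono: "V \<subseteq> W \<Longrightarrow> coords V \<subseteq> coords W"
  by (auto simp: coords_def)

lemma coords_Int: "coords V \<inter> coords W = coords (V \<inter> W)"
  by (auto simp: coords_def)

lemma dim_coords: "dim (coords V) = card (V \<inter> Fr) + card V"
proof -
  let ?d = "(\<lambda>v. (axis v (1::real), 0::real^'o)) ` (V \<inter> Fr) \<union> (\<lambda>v. (0::real^'o, axis v (1::real))) ` V"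
  have d: "?d \<subseteq> Basis" by (auto simp: Basis_prod_def)
  have i1: "(axis v 1, 0) \<in> ?d \<longleftrightarrow> v \<in> V \<inter> Fr" and i2: "(0, axis v 1) \<in> ?d \<longleftrightarrow> v \<in> V" for v
    by (auto simp: axis_eq_axis)
  have "x \<in> coords V \<longleftrightarrow> (\<forall>i\<in>Basis. i \<notin> ?d \<longrightarrow> x \<bullet> i = 0)" for x
  proof -
    have "(\<forall>i\<in>Basis. i \<notin> ?d \<longrightarrow> x \<bullet> i = 0) \<longleftrightarrow>
      (\<forall>v. (axis v 1, 0) \<notin> ?d \<longrightarrow> x \<bullet> (axis v 1, 0) = 0) \<and> (\<forall>v. (0, axis v 1) \<notin> ?d \<longrightarrow> x \<bullet> (0, axis v 1) = 0)"
      by (simp add: Basis_prod_def Basis_vec_def ball_Un)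
    then show ?thesis
      unfolding i1 i2 by (cases x) (simp add: coords_def inner_axis)
  qed
  then have "coords V = {x. \<forall>i\<in>Basis. i \<notin> ?d \<longrightarrow> x \<bullet> i = 0}" by blast
  then have "dim (coords V) = card ?d" using dim_substandard[OF d] by simp
  also have "\<dots> = card (V \<inter> Fr) + card V"
    by (subst card_Un_disjoint) (auto simp: card_image inj_on_def axis_eq_axis)
  finally show ?thesis .
qed

lemma inner_free_axis: "free_axis v \<bullet> x = (if v \<in> Fr then x $ v else 0)"
  by (simp add: free_axis_def inner_axis')

lemma inner_signed_inc:
  "signed_inc e \<bullet> x = (if src e \<in> Fr then x $ src e else 0) - eps e * (if dst e \<in> Fr then x $ dst e else 0)"
  by (simp add: signed_inc_def inner_diff_left inner_free_axis)

lemma inner_plain_inc: "plain_inc e \<bullet> x = x $ src e - x $ dst e"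
  by (simp add: plain_inc_def inner_diff_left inner_axis')

lemma coords_antisym_vec1: "antisym_vec1 e \<in> coords {src e, dst e}"
  by (auto simp: antisym_vec1_def coords_def signed_inc_def free_axis_def axis_def)

lemma coords_antisym_vec2: "antisym_vec2 e \<in> coords {src e, dst e}"
  by (auto simp: antisym_vec2_def coords_def plain_inc_def axis_def)

lemma coords_sym_vec1: "sym_vec1 d e \<in> coords {src e, dst e}"
  by (auto simp: sym_vec1_def coords_def signed_inc_def free_axis_def axis_def)

lemma coords_sym_vec2: "sym_vec2 e \<in> coords {src e, dst e}"
  by (auto simp: sym_vec2_def coords_def signed_inc_def free_axis_def axis_def)

lemma coords_ends:
  assumes "\<And>e. a e \<in> coords {src e, dst e}" "\<And>e. b e \<in> coords {src e, dst e}"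
  shows "(\<Union>e\<in>F. {a e, b e}) \<subseteq> coords (ends F)"
proof clarify
  fix x e assume "x \<in> {a e, b e}" "e \<in> F"
  moreover have "coords {src e, dst e} \<subseteq> coords (ends F)"
    using \<open>e \<in> F\<close> by (intro coords_mono) (auto simp: ends_def)
  ultimately show "x \<in> coords (ends F)" using assms[of e] by blast
qed

text \<open>The parts may share at most one fixed vertex and no free one, that is, at most one
  coordinate. Their spans then meet in dimension at most 1, and the counts add up:
  \<open>(card F1 + 1) + (card F2 + 1) - 1\<close>.\<close>

lemma truncation_count_by_splitting:
  assumes supp: "\<And>e. a e \<in> coords {src e, dst e}" "\<And>e. b e \<in> coords {src e, dst e}"
    and split: "\<And>F'. F' \<subseteq> F \<Longrightarrow> F' \<noteq> {} \<Longrightarrow> card F' + 1 \<le> dim (\<Union>e\<in>F'. {a e, b e}) \<or>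
      (\<exists>F1 F2. F1 \<noteq> {} \<and> F2 \<noteq> {} \<and> F' = F1 \<union> F2 \<and> F1 \<inter> F2 = {} \<and>
        card (ends F1 \<inter> ends F2 \<inter> Fr) + card (ends F1 \<inter> ends F2) \<le> 1)"
  shows "truncation_count F a b"
proof -
  have "card F' + 1 \<le> dim (\<Union>e\<in>F'. {a e, b e})" if "F' \<subseteq> F" "F' \<noteq> {}" for F'
    using that
  proof (induction "card F'" arbitrary: F' rule: less_induct)
    case less
    let ?S = "\<lambda>F'. \<Union>e\<in>F'. {a e, b e}"
    show ?case
    proof (cases "card F' + 1 \<le> dim (?S F')")
      case False
      then obtain F1 F2 where F: "F1 \<noteq> {}" "F2 \<noteq> {}" "F' = F1 \<union> F2" "F1 \<inter> F2 = {}"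
        "card (ends F1 \<inter> ends F2 \<inter> Fr) + card (ends F1 \<inter> ends F2) \<le> 1"
        using split[OF less.prems] by blast
      have c: "card F' = card F1 + card F2" using F by (simp add: card_Un_disjoint)
      have pos: "card F1 > 0" "card F2 > 0" using F by (simp_all add: card_gt_0_iff)
      have "card F1 + 1 \<le> dim (?S F1)" "card F2 + 1 \<le> dim (?S F2)"
        using less.hyps[of F1] less.hyps[of F2] less.prems F c pos by auto
      moreover have "dim {x + y |x y. x \<in> span (?S F1) \<and> y \<in> span (?S F2)} + dim (span (?S F1) \<inter> span (?S F2))
          = dim (span (?S F1)) + dim (span (?S F2))"
        by (rule dim_sums_Int) auto
      moreover have "dim {x + y |x y. x \<in> span (?S F1) \<and> y \<in> span (?S F2)} = dim (?S F')"
        unfolding span_Un[symmetric] dim_span F(3) by (simp only: UN_Un)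
      moreover have "dim (span (?S F1) \<inter> span (?S F2)) \<le> dim (coords (ends F1 \<inter> ends F2))"
        unfolding coords_Int[symmetric]
        using span_minimal[OF coords_ends[OF supp, of F1] subspace_coords]
          span_minimal[OF coords_ends[OF supp, of F2] subspace_coords]
        by (intro dim_subset) blast
      ultimately show ?thesis using F(5) c by (simp add: dim_coords dim_span)
    qed
  qed
  then show ?thesis by (simp add: truncation_count_def)
qed

text \<open>The dual side of the count: the larger the span of the planes, the smaller this space of
  vectors, which satisfy the edge conditions whatever \<open>h\<close> is.\<close>

definition annih :: "('e \<Rightarrow> (real^'o) \<times> (real^'o)) \<Rightarrow> ('e \<Rightarrow> (real^'o) \<times> (real^'o)) \<Rightarrow> 'e set \<Rightarrow> ((real^'o) \<times> (real^'o)) set"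
  where "annih a b F = {m \<in> coords (ends F). \<forall>e\<in>F. a e \<bullet> m = 0 \<and> b e \<bullet> m = 0}"

lemma subspace_annih: "subspace (annih a b F)"
  using subspace_coords[of "ends F"] by (auto simp: annih_def subspace_def inner_add_right)

lemma dim_annih:
  assumes "\<And>e. a e \<in> coords {src e, dst e}" "\<And>e. b e \<in> coords {src e, dst e}"
  shows "dim (\<Union>e\<in>F. {a e, b e}) + dim (annih a b F) = 2 * card (ends F \<inter> Fr) + card (ends F - Fr)"
proof -
  have "{m \<in> coords (ends F). \<forall>x\<in>(\<Union>e\<in>F. {a e, b e}). x \<bullet> m = 0} = annih a b F"
    by (auto simp: annih_def)
  then show ?thesis
    using dim_annihilator[OF subspace_coords coords_ends[OF assms], of F] card_ends[of F]
    by (simp add: dim_coords)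
qed

end

section \<open>Truncation counts versus sparsity counts\<close>

context signed_graph begin

lemma annih2:
  assumes "m \<in> annih antisym_vec1 antisym_vec2 F"
  shows "m \<in> coords (ends F)" "e \<in> F \<Longrightarrow> fst m $ src e = eps e * fst m $ dst e"
    "e \<in> F \<Longrightarrow> snd m $ src e = snd m $ dst e"
proof -
  show m: "m \<in> coords (ends F)" using assms by (simp add: annih_def)
  assume "e \<in> F"
  then have "antisym_vec1 e \<bullet> m = 0" "antisym_vec2 e \<bullet> m = 0" using assms by (simp_all add: annih_def)
  then have "signed_inc e \<bullet> fst m = 0" "plain_inc e \<bullet> snd m = 0"
    by (simp_all add: antisym_vec1_def antisym_vec2_def inner_prod_def)
  moreover have "v \<notin> Fr \<Longrightarrow> fst m $ v = 0" for v using m by (simp add: coords_def)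
  ultimately show "fst m $ src e = eps e * fst m $ dst e" "snd m $ src e = snd m $ dst e"
    by (simp_all add: inner_signed_inc inner_plain_inc split: if_splits)
qed

lemma annih1:
  assumes "m \<in> annih (sym_vec1 d) sym_vec2 F"
  shows "m \<in> coords (ends F)"
    "\<lbrakk>e \<in> F; src e \<in> Fr; dst e \<in> Fr\<rbrakk> \<Longrightarrow> fst m $ src e = eps e * fst m $ dst e \<and> snd m $ src e = eps e * snd m $ dst e"
    "\<lbrakk>e \<in> F; src e \<in> Fr; dst e \<notin> Fr\<rbrakk> \<Longrightarrow> snd m $ src e = d (dst e) * fst m $ src e"
    "\<lbrakk>e \<in> F; src e \<notin> Fr; dst e \<in> Fr\<rbrakk> \<Longrightarrow> snd m $ dst e = d (src e) * fst m $ dst e"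
    "u \<in> ends F \<Longrightarrow> u \<notin> Fr \<Longrightarrow> snd m $ u = 0"
proof -
  show m: "m \<in> coords (ends F)" using assms by (simp add: annih_def)
  have 0: "sym_vec1 d e \<bullet> m = 0" "sym_vec2 e \<bullet> m = 0" if "e \<in> F" for e using assms that by (auto simp: annih_def)
  show "\<lbrakk>e \<in> F; src e \<in> Fr; dst e \<in> Fr\<rbrakk> \<Longrightarrow> fst m $ src e = eps e * fst m $ dst e \<and> snd m $ src e = eps e * snd m $ dst e"
    "\<lbrakk>e \<in> F; src e \<in> Fr; dst e \<notin> Fr\<rbrakk> \<Longrightarrow> snd m $ src e = d (dst e) * fst m $ src e"
    "\<lbrakk>e \<in> F; src e \<notin> Fr; dst e \<in> Fr\<rbrakk> \<Longrightarrow> snd m $ dst e = d (src e) * fst m $ dst e"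
    using 0[of e] by (simp_all add: sym_vec1_def sym_vec2_def inner_prod_def inner_signed_inc inner_axis')
  assume u: "u \<in> ends F" "u \<notin> Fr"
  then obtain e where e: "e \<in> F" "src e = u \<or> dst e = u" by (auto simp: ends_def)
  show "snd m $ u = 0" using 0[OF e(1)] e(2) u(2)
    by (auto simp: sym_vec1_def sym_vec2_def inner_prod_def inner_axis' split: if_splits)
qed

text \<open>Vectors orthogonal to all planes reduce the available dimension. The horizontal
  translation \<open>t\<close> always does, which with the 1 of the truncation makes
  \<open>l = 2\<close>. If \<open>F'\<close> is switchable without fixed vertices, the switching
  itself, placed in the first component, is a second such vector, whence the 3.\<close>

lemma truncation_count_imp_sparse2:
  assumes "truncation_count F antisym_vec1 antisym_vec2"
  shows "count_sparse 2 F"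
  unfolding count_sparse_def
proof (intro allI impI conjI)
  fix F' assume F': "F' \<subseteq> F" "F' \<noteq> {}"
  let ?S = "\<Union>e\<in>F'. {antisym_vec1 e, antisym_vec2 e}" and ?V = "ends F'"
  note sub = coords_ends[OF coords_antisym_vec1 coords_antisym_vec2, of F']
  have cnt: "card F' + 1 \<le> dim ?S" using assms F' by (simp add: truncation_count_def)
  define t :: "(real^'o) \<times> (real^'o)" where "t = (0, \<chi> v. if v \<in> ?V then 1 else 0)"
  obtain w where w: "w \<in> ?V" using ends_ne[OF F'(2)] by blast
  have t: "t \<in> coords ?V" by (simp add: t_def coords_def)
  have "t \<noteq> 0" using w by (auto simp: t_def zero_prod_def vec_eq_iff)
  have tS: "x \<bullet> t = 0" if "x \<in> ?S" for x
    using that by (auto simp: antisym_vec1_def antisym_vec2_def t_def inner_plain_inc ends_def)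
  have "dim ?S + 1 \<le> dim (coords ?V)"
    by (rule dim_le_of_orthogonal_vector[OF subspace_coords sub t \<open>t \<noteq> 0\<close> tS])
  then show gen: "int (card F') \<le> 2 * int (card (?V \<inter> Fr)) + int (card (?V - Fr)) - 2"
    using cnt card_ends[of F'] by (simp add: dim_coords)
  assume "switchable F'"
  then obtain \<theta> where \<theta>: "\<And>v. \<theta> v = 1 \<or> \<theta> v = (- 1 :: real)"
    "\<And>e. \<lbrakk>e \<in> F'; src e \<in> Fr; dst e \<in> Fr\<rbrakk> \<Longrightarrow> \<theta> (src e) = eps e * \<theta> (dst e)"
    unfolding switchable_def by blast
  show "int (card F') \<le> 2 * int (card ?V) - 3"
  proof (cases "?V \<subseteq> Fr")
    case False
    \<comment> \<open>A fixed vertex counts 1 in the general bound and 2 in the balanced one, so a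
      single fixed vertex already turns the 2 into a 3.\<close>
    then have "card (?V - Fr) > 0" by (simp add: card_gt_0_iff)
    then show ?thesis using gen card_ends[of F'] by linarith
  next
    case True
    define g :: "(real^'o) \<times> (real^'o)" where "g = (\<chi> v. if v \<in> ?V then \<theta> v else 0, 0)"
    have g: "g \<in> coords ?V" using True by (auto simp: g_def coords_def)
    have "\<theta> w \<noteq> 0" using \<theta>(1)[of w] by auto
    then have "g \<noteq> 0" using w by (auto simp: g_def zero_prod_def vec_eq_iff)
    have gS: "x \<bullet> g = 0" if x: "x \<in> ?S" for x
    proof -
      obtain e where e: "e \<in> F'" "x = antisym_vec1 e \<or> x = antisym_vec2 e" using x by blast
      then have "src e \<in> ?V" "dst e \<in> ?V" by (auto simp: ends_def)
      then show ?thesis using e \<theta>(2)[of e] True by (auto simp: antisym_vec1_def antisym_vec2_def g_def inner_signed_inc)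
    qed
    have "g \<bullet> t = 0" by (simp add: g_def t_def)
    have "dim ?S + 2 \<le> dim (coords ?V)"
      by (rule dim_le_of_two_orthogonal_vectors[OF subspace_coords sub g t \<open>g \<noteq> 0\<close> \<open>t \<noteq> 0\<close> \<open>g \<bullet> t = 0\<close> gS tS])
    moreover have "?V \<inter> Fr = ?V" using True by blast
    ultimately show ?thesis using cnt by (simp add: dim_coords)
  qed
qed

text \<open>Here \<open>l = 1\<close> comes from the truncation alone. The balanced bound needs two
  orthogonal vectors if there is no fixed vertex (the switching in either component), one if there
  is a single fixed vertex, and none otherwise, because each fixed vertex gains 1 in comparing
  \<open>2 * card\<close> with the general bound.\<close>

lemma truncation_count_imp_sparse1:
  assumes "truncation_count F (sym_vec1 d) sym_vec2"
  shows "count_sparse 1 F"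
  unfolding count_sparse_def
proof (intro allI impI conjI)
  fix F' assume F': "F' \<subseteq> F" "F' \<noteq> {}"
  let ?S = "\<Union>e\<in>F'. {sym_vec1 d e, sym_vec2 e}" and ?V = "ends F'"
  note sub = coords_ends[where a = "sym_vec1 d" and b = sym_vec2 and F = F', OF coords_sym_vec1 coords_sym_vec2]
  have cnt: "card F' + 1 \<le> dim ?S" using assms F' by (simp add: truncation_count_def)
  have le: "dim ?S \<le> dim (coords ?V)" using sub by (rule dim_subset)
  show gen: "int (card F') \<le> 2 * int (card (?V \<inter> Fr)) + int (card (?V - Fr)) - 1"
    using cnt le card_ends[of F'] by (simp add: dim_coords)
  assume "switchable F'"
  then obtain \<theta> where \<theta>: "\<And>v. \<theta> v = 1 \<or> \<theta> v = (- 1 :: real)"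
    "\<And>e. \<lbrakk>e \<in> F'; src e \<in> Fr; dst e \<in> Fr\<rbrakk> \<Longrightarrow> \<theta> (src e) = eps e * \<theta> (dst e)"
    unfolding switchable_def by blast
  have nz: "\<theta> v \<noteq> 0" for v using \<theta>(1)[of v] by auto
  obtain w where w: "w \<in> ?V" using ends_ne[OF F'(2)] by blast
  show "int (card F') \<le> 2 * int (card ?V) - 3"
  proof (cases "card (?V - Fr) \<ge> 2")
    case True
    then show ?thesis using gen card_ends[of F'] by linarith
  next
    case False
    then consider "card (?V - Fr) = 0" | "card (?V - Fr) = 1" by linarith
    then show ?thesis
    proof cases
      case 1
      then have V: "?V \<subseteq> Fr" by simp
      define g :: "(real^'o) \<times> (real^'o)" where "g = (\<chi> v. if v \<in> ?V then \<theta> v else 0, 0)"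
      define t :: "(real^'o) \<times> (real^'o)" where "t = (0, \<chi> v. if v \<in> ?V then \<theta> v else 0)"
      have g: "g \<in> coords ?V" and t: "t \<in> coords ?V" using V by (auto simp: g_def t_def coords_def)
      have "g \<noteq> 0" "t \<noteq> 0" using w nz[of w] by (auto simp: g_def t_def zero_prod_def vec_eq_iff)
      have S: "x \<bullet> g = 0 \<and> x \<bullet> t = 0" if x: "x \<in> ?S" for x
      proof -
        obtain e where e: "e \<in> F'" "x = sym_vec1 d e \<or> x = sym_vec2 e" using x by blast
        then have "src e \<in> ?V" "dst e \<in> ?V" by (auto simp: ends_def)
        then show ?thesis using e \<theta>(2)[of e] V
          by (auto simp: sym_vec1_def sym_vec2_def g_def t_def inner_signed_inc)
      qed
      have "g \<bullet> t = 0" by (simp add: g_def t_def)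
      have "dim ?S + 2 \<le> dim (coords ?V)"
        by (rule dim_le_of_two_orthogonal_vectors[OF subspace_coords sub g t \<open>g \<noteq> 0\<close> \<open>t \<noteq> 0\<close> \<open>g \<bullet> t = 0\<close>])
          (use S in blast)+
      moreover have "?V \<inter> Fr = ?V" using V by blast
      ultimately show ?thesis using cnt by (simp add: dim_coords)
    next
      case 2
      then obtain u where u: "?V - Fr = {u}" by (auto simp: card_1_singleton_iff)
      show ?thesis
      proof (cases "?V \<inter> Fr = {}")
        case True
        \<comment> \<open>All edges would be loops at \<open>u\<close>, but one coordinate leaves no
          room for a plane, so this case is contradictory.\<close>
        then have "dim (coords ?V) = 1" using 2 card_ends[of F'] by (simp add: dim_coords)
        moreover have "card F' > 0" using F'(2) by (simp add: card_gt_0_iff)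
        ultimately show ?thesis using cnt le by simp
      next
        case False
        then obtain z where z: "z \<in> ?V" "z \<in> Fr" by blast
        \<comment> \<open>At a free vertex, the first plane vector of an edge to \<open>u\<close>
          annihilates exactly the multiples of \<open>(1, d u)\<close>; the switching distributes
          such a multiple over all free vertices.\<close>
        define g :: "(real^'o) \<times> (real^'o)" where
          "g = (\<chi> v. if v \<in> ?V \<inter> Fr then \<theta> v else 0, \<chi> v. if v \<in> ?V \<inter> Fr then d u * \<theta> v else 0)"
        have g: "g \<in> coords ?V" by (auto simp: g_def coords_def)
        have "g \<noteq> 0" using z nz[of z] by (auto simp: g_def zero_prod_def vec_eq_iff)
        have S: "x \<bullet> g = 0" if x: "x \<in> ?S" for x
        proof -
          obtain e where e: "e \<in> F'" "x = sym_vec1 d e \<or> x = sym_vec2 e" using x by blast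
          then have "src e \<in> ?V" "dst e \<in> ?V" by (auto simp: ends_def)
          moreover have "src e = u" if "src e \<notin> Fr" using that u \<open>src e \<in> ?V\<close> by blast
          moreover have "dst e = u" if "dst e \<notin> Fr" using that u \<open>dst e \<in> ?V\<close> by blast
          ultimately show ?thesis using e \<theta>(2)[of e]
            by (auto simp: sym_vec1_def sym_vec2_def g_def inner_signed_inc inner_axis')
        qed
        have "dim ?S + 1 \<le> dim (coords ?V)"
          by (rule dim_le_of_orthogonal_vector[OF subspace_coords sub g \<open>g \<noteq> 0\<close> S])
        then show ?thesis using cnt 2 card_ends[of F'] by (simp add: dim_coords)
      qed
    qed
  qed
qed

text \<open>For \<open>m\<close> annihilating \<open>F'\<close>, both \<open>snd m\<close> and the
  absolute value of \<open>fst m\<close> are constant along edges. If one of them takes two values,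
  \<open>F'\<close> splits into vertex-disjoint parts. Otherwise \<open>m\<close> is determined by
  its values at one vertex \<open>w\<close>; a nonzero \<open>fst m\<close> excludes fixed vertices
  and its signs switch \<open>F'\<close>, so the balanced bound is available just when the
  annihilator may have dimension 2.\<close>

lemma sparse2_imp_truncation_count:
  assumes "count_sparse 2 F"
  shows "truncation_count F antisym_vec1 antisym_vec2"
proof (rule truncation_count_by_splitting[OF coords_antisym_vec1 coords_antisym_vec2])
  fix F' assume F': "F' \<subseteq> F" "F' \<noteq> {}"
  let ?S = "\<Union>e\<in>F'. {antisym_vec1 e, antisym_vec2 e}" and ?V = "ends F'" and ?K = "annih antisym_vec1 antisym_vec2 F'"
  let ?split = "\<exists>F1 F2. F1 \<noteq> {} \<and> F2 \<noteq> {} \<and> F' = F1 \<union> F2 \<and> F1 \<inter> F2 = {} \<and>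
        card (ends F1 \<inter> ends F2 \<inter> Fr) + card (ends F1 \<inter> ends F2) \<le> 1"
  have dimS: "dim ?S + dim ?K = 2 * card (?V \<inter> Fr) + card (?V - Fr)"
    by (rule dim_annih[OF coords_antisym_vec1 coords_antisym_vec2])
  obtain w where w: "w \<in> ?V" using ends_ne[OF F'(2)] by blast
  have splitI: ?split if g: "\<And>e. e \<in> F' \<Longrightarrow> g (src e) = g (dst e)" "v \<in> ?V" "v' \<in> ?V" "g v \<noteq> g v'"
    for g :: "'o \<Rightarrow> real" and v v'
  proof -
    let ?F1 = "{e \<in> F'. g (src e) = g v}" and ?F2 = "{e \<in> F'. g (src e) \<noteq> g v}"
    have edge: "\<exists>e\<in>F'. g (src e) = g u" if "u \<in> ?V" for u
      using that g(1) unfolding ends_def by auto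
    obtain e1 e2 where "e1 \<in> F'" "g (src e1) = g v" "e2 \<in> F'" "g (src e2) = g v'"
      using edge[OF g(2)] edge[OF g(3)] by auto
    then have "e1 \<in> ?F1" "e2 \<in> ?F2" using g(4) by simp_all
    then have "?F1 \<noteq> {}" "?F2 \<noteq> {}" by auto
    moreover have "g u = g v" if "u \<in> ends ?F1" for u using that g(1) unfolding ends_def by auto
    moreover have "g u \<noteq> g v" if "u \<in> ends ?F2" for u using that g(1) unfolding ends_def by auto
    ultimately have "ends ?F1 \<inter> ends ?F2 = {}" by blast
    then have "card (ends ?F1 \<inter> ends ?F2 \<inter> Fr) + card (ends ?F1 \<inter> ends ?F2) \<le> 1" by simp
    moreover have "F' = ?F1 \<union> ?F2" "?F1 \<inter> ?F2 = {}" by auto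
    ultimately show ?split using \<open>?F1 \<noteq> {}\<close> \<open>?F2 \<noteq> {}\<close> by (intro exI[of _ ?F1] exI[of _ ?F2]) simp
  qed
  show "card F' + 1 \<le> dim ?S \<or> ?split"
  proof (cases ?split)
    case False
    have constB: "snd m $ v = snd m $ w" if "m \<in> ?K" "v \<in> ?V" for m v
      using splitI[of "\<lambda>v. snd m $ v" v w] annih2(3)[OF that(1)] that(2) w False by blast
    have constA: "\<bar>fst m $ v\<bar> = \<bar>fst m $ w\<bar>" if "m \<in> ?K" "v \<in> ?V" for m v
    proof -
      have "\<bar>fst m $ src e\<bar> = \<bar>fst m $ dst e\<bar>" if "e \<in> F'" for e
        using annih2(2)[OF \<open>m \<in> ?K\<close> that] eps[of e] by (auto simp: abs_mult)
      then show ?thesis using splitI[of "\<lambda>v. \<bar>fst m $ v\<bar>" v w] that(2) w False by blast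
    qed
    have zero: "m = 0" if "m \<in> ?K" "fst m $ w = 0" "snd m $ w = 0" for m
    proof -
      have "fst m $ v = 0 \<and> snd m $ v = 0" for v
        using constA[OF that(1), of v] constB[OF that(1), of v] that(2,3) annih2(1)[OF that(1)]
        by (cases "v \<in> ?V") (auto simp: coords_def)
      then show ?thesis by (simp add: prod_eq_iff vec_eq_iff)
    qed
    show ?thesis
    proof (cases "\<exists>m\<in>?K. fst m $ w \<noteq> 0")
      case True
      then obtain m where m: "m \<in> ?K" "fst m $ w \<noteq> 0" by blast
      have V: "?V \<subseteq> Fr"
      proof
        fix v assume "v \<in> ?V"
        then have "fst m $ v \<noteq> 0" using constA[OF m(1), of v] m(2) by auto
        then show "v \<in> Fr" using annih2(1)[OF m(1)] by (auto simp: coords_def)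
      qed
      have "switchable F'" unfolding switchable_def
      proof (intro exI[of _ "\<lambda>v. if fst m $ v > 0 then 1 else - 1"] conjI allI ballI impI)
        fix e assume e: "e \<in> F'"
        then have "src e \<in> ?V" "dst e \<in> ?V" by (auto simp: ends_def)
        then have "fst m $ src e \<noteq> 0" "fst m $ dst e \<noteq> 0"
          using constA[OF m(1), of "src e"] constA[OF m(1), of "dst e"] m(2) by auto
        then show "(if fst m $ src e > 0 then 1 else - 1) = eps e * (if fst m $ dst e > 0 then 1 else - 1)"
          using annih2(2)[OF m(1) e] eps[of e] by auto
      qed auto
      then have "int (card F') \<le> 2 * int (card ?V) - 3"
        using assms F' by (simp add: count_sparse_def)
      moreover have "dim ?K \<le> DIM(real \<times> real)"
      proof (rule dim_le_DIM_of_injective[OF subspace_annih])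
        show "linear (\<lambda>m::(real^'o) \<times> (real^'o). (fst m $ w, snd m $ w))" by (simp add: linear_iff)
        show "m = 0" if "m \<in> ?K" "(fst m $ w, snd m $ w) = 0" for m
          using zero[OF that(1)] that(2) unfolding zero_prod_def[where 'a=real and 'b=real] by simp
      qed
      moreover have "?V \<inter> Fr = ?V" "?V - Fr = {}" using V by auto
      ultimately show ?thesis using dimS by simp
    next
      case False
      have "dim ?K \<le> DIM(real)"
      proof (rule dim_le_DIM_of_injective[OF subspace_annih])
        show "linear (\<lambda>m::(real^'o) \<times> (real^'o). snd m $ w)" by (simp add: linear_iff)
        show "m = 0" if "m \<in> ?K" "snd m $ w = 0" for m using zero[OF that(1)] that False by blast
      qed
      moreover have "int (card F') \<le> 2 * int (card (?V \<inter> Fr)) + int (card (?V - Fr)) - 2"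
        using assms F' by (simp add: count_sparse_def)
      ultimately show ?thesis using dimS by simp
    qed
  qed simp
qed

text \<open>A vector \<open>m\<close> annihilating \<open>F'\<close> takes the same value up to sign on the free vertices of a set
  \<open>C\<close> closed under adjacency.  As \<open>d\<close> is injective, \<open>C\<close> is adjacent to at most one fixed vertex, so
  either \<open>F'\<close> splits along \<open>C\<close>, or \<open>C\<close> contains all free vertices and the signs switch \<open>F'\<close>.\<close>

lemma sparse1_imp_truncation_count:
  assumes "count_sparse 1 F" and d: "inj_on d (- Fr)"
  shows "truncation_count F (sym_vec1 d) sym_vec2"
proof (rule truncation_count_by_splitting[OF coords_sym_vec1 coords_sym_vec2])
  fix F' assume F': "F' \<subseteq> F" "F' \<noteq> {}"
  let ?S = "\<Union>e\<in>F'. {sym_vec1 d e, sym_vec2 e}" and ?V = "ends F'" and ?K = "annih (sym_vec1 d) sym_vec2 F'"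
  let ?split = "\<exists>F1 F2. F1 \<noteq> {} \<and> F2 \<noteq> {} \<and> F' = F1 \<union> F2 \<and> F1 \<inter> F2 = {} \<and>
        card (ends F1 \<inter> ends F2 \<inter> Fr) + card (ends F1 \<inter> ends F2) \<le> 1"
  have dimS: "dim ?S + dim ?K = 2 * card (?V \<inter> Fr) + card (?V - Fr)"
    by (rule dim_annih[OF coords_sym_vec1 coords_sym_vec2])
  define nz where "nz m v \<longleftrightarrow> (fst m $ v, snd m $ v) \<noteq> (0, 0)" for m :: "(real^'o) \<times> (real^'o)" and v
  define C where "C m w = {v \<in> Fr \<inter> ?V. (fst m $ v = fst m $ w \<and> snd m $ v = snd m $ w) \<or>
      (fst m $ v = - fst m $ w \<and> snd m $ v = - snd m $ w)}" for m :: "(real^'o) \<times> (real^'o)" and w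
  \<comment> \<open>A free vertex whose value is that of \<open>w\<close> up to sign satisfies the
    equation of an edge to a fixed \<open>u\<close> only if this value is a multiple of
    \<open>(1, d u)\<close>. So \<open>U\<close> contains every possible fixed neighbour of
    \<open>C\<close>.\<close>
  define U where "U m w = {u \<in> ?V - Fr. snd m $ w = d u * fst m $ w}" for m :: "(real^'o) \<times> (real^'o)" and w
  have exw: "\<exists>w\<in>?V \<inter> Fr. nz m w" if m: "m \<in> ?K" "m \<noteq> 0" for m
  proof (rule ccontr)
    assume *: "\<not> ?thesis"
    have "fst m $ v = 0 \<and> snd m $ v = 0" for v
      using * annih1(1)[OF m(1)] annih1(5)[OF m(1), of v]
      by (cases "v \<in> ?V"; cases "v \<in> Fr") (auto simp: coords_def nz_def)
    then show False using m(2) by (simp add: prod_eq_iff vec_eq_iff)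
  qed
  have closed: "(src e \<in> C m w \<or> dst e \<in> C m w) \<Longrightarrow> {src e, dst e} \<subseteq> C m w \<union> U m w"
    if m: "m \<in> ?K" and e: "e \<in> F'" for m w e
  proof -
    assume *: "src e \<in> C m w \<or> dst e \<in> C m w"
    have V: "src e \<in> ?V" "dst e \<in> ?V" using e by (auto simp: ends_def)
    show ?thesis
    proof (cases "src e \<in> Fr"; cases "dst e \<in> Fr")
      assume "src e \<in> Fr" "dst e \<in> Fr"
      then show ?thesis using * V annih1(2)[OF m e] eps[of e] by (auto simp: C_def)
    next
      assume "src e \<in> Fr" "dst e \<notin> Fr"
      then show ?thesis using * V annih1(3)[OF m e] by (auto simp: C_def U_def)
    next
      assume "src e \<notin> Fr" "dst e \<in> Fr"
      then show ?thesis using * V annih1(4)[OF m e] by (auto simp: C_def U_def)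
    next
      assume "src e \<notin> Fr" "dst e \<notin> Fr"
      then show ?thesis using * by (auto simp: C_def)
    qed
  qed
  have cardU: "card (U m w) \<le> 1" if "nz m w" for m w
  proof (rule card_le_Suc0_iff_eq[THEN iffD2, folded One_nat_def])
    show "\<forall>u\<in>U m w. \<forall>u'\<in>U m w. u = u'"
    proof (intro ballI)
      fix u u' assume u: "u \<in> U m w" "u' \<in> U m w"
      then have "d u * fst m $ w = d u' * fst m $ w" "fst m $ w \<noteq> 0"
        using that by (auto simp: U_def nz_def)
      then have "d u = d u'" by simp
      then show "u = u'" using d u by (auto simp: U_def inj_on_def)
    qed
  qed simp
  show "card F' + 1 \<le> dim ?S \<or> ?split"
  proof (cases ?split)
    case False
    have all: "src e \<in> C m w \<or> dst e \<in> C m w" if mw: "m \<in> ?K" "w \<in> ?V \<inter> Fr" "nz m w" and e: "e \<in> F'" for m w e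
    proof (rule ccontr)
      assume *: "\<not> ?thesis"
      let ?F1 = "{e \<in> F'. src e \<in> C m w \<or> dst e \<in> C m w}"
      let ?F2 = "{e \<in> F'. \<not> (src e \<in> C m w \<or> dst e \<in> C m w)}"
      have "w \<in> C m w" using mw by (simp add: C_def)
      then have "?F1 \<noteq> {}" using mw(2) unfolding ends_def by auto
      moreover have "?F2 \<noteq> {}" using e * by blast
      moreover have sub: "ends ?F1 \<inter> ends ?F2 \<subseteq> U m w"
      proof
        fix v assume v: "v \<in> ends ?F1 \<inter> ends ?F2"
        then have "v \<in> C m w \<union> U m w" using closed[OF mw(1)] unfolding ends_def by blast
        moreover have "v \<notin> C m w" using v unfolding ends_def by auto
        ultimately show "v \<in> U m w" by blast
      qed
      then have "ends ?F1 \<inter> ends ?F2 \<inter> Fr = {}" by (auto simp: U_def)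
      then have "card (ends ?F1 \<inter> ends ?F2 \<inter> Fr) + card (ends ?F1 \<inter> ends ?F2) \<le> 1"
        using card_mono[OF _ sub] cardU[OF mw(3)] by simp
      moreover have "F' = ?F1 \<union> ?F2" "?F1 \<inter> ?F2 = {}" by auto
      ultimately have ?split
        using \<open>?F1 \<noteq> {}\<close> \<open>?F2 \<noteq> {}\<close> by (intro exI[of _ ?F1] exI[of _ ?F2]) simp
      then show False using False by contradiction
    qed
    show ?thesis
    proof (cases "?K \<subseteq> {0}")
      case True
      then have "dim ?K = 0" by simp
      moreover have "int (card F') \<le> 2 * int (card (?V \<inter> Fr)) + int (card (?V - Fr)) - 1"
        using assms(1) F' by (simp add: count_sparse_def)
      ultimately have "card F' + 1 \<le> dim ?S" using dimS by linarith
      then show ?thesis by simp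
    next
      case False
      then obtain m where m: "m \<in> ?K" "m \<noteq> 0" by blast
      obtain w where w: "w \<in> ?V \<inter> Fr" "nz m w" using exw[OF m] by blast
      have VCU: "?V \<subseteq> C m' w' \<union> U m' w'" if "m' \<in> ?K" "w' \<in> ?V \<inter> Fr" "nz m' w'" for m' w'
        using closed[OF that(1)] all[OF that] unfolding ends_def by blast
      have nzall: "nz m' v" if m': "m' \<in> ?K" "m' \<noteq> 0" and v: "v \<in> ?V \<inter> Fr" for m' v
      proof -
        obtain w' where w': "w' \<in> ?V \<inter> Fr" "nz m' w'" using exw[OF m'] by blast
        have "v \<in> C m' w'" using VCU[OF m'(1) w'] v by (auto simp: U_def)
        then show ?thesis using w'(2) by (auto simp: C_def nz_def)
      qed
      have "switchable F'" unfolding switchable_def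
      proof (intro exI[of _ "\<lambda>v. if fst m $ v = fst m $ w \<and> snd m $ v = snd m $ w then 1 else - 1"]
          conjI allI ballI impI)
        fix e assume e: "e \<in> F'" "src e \<in> Fr \<and> dst e \<in> Fr"
        then have "src e \<in> C m w" "dst e \<in> C m w"
          using VCU[OF m(1) w] by (auto simp: U_def ends_def)
        then show "(if fst m $ src e = fst m $ w \<and> snd m $ src e = snd m $ w then 1 else - 1) =
          eps e * (if fst m $ dst e = fst m $ w \<and> snd m $ dst e = snd m $ w then 1 else - 1)"
          using annih1(2)[OF m(1) e(1)] e(2) eps[of e] w(2) by (auto simp: C_def nz_def)
      qed auto
      then have cnt: "int (card F') \<le> 2 * int (card ?V) - 3"
        using assms(1) F' by (simp add: count_sparse_def)
      have VU: "?V - Fr \<subseteq> U m w" using VCU[OF m(1) w] by (auto simp: C_def)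
      then have "card (?V - Fr) \<le> 1" using card_mono[OF _ VU] cardU[OF w(2)] by simp
      then consider "card (?V - Fr) = 0" | "card (?V - Fr) = 1" by linarith
      \<comment> \<open>The balanced bound counts 2 at every vertex while the coordinates give 1 at
        a fixed one. So the number of fixed vertices and the dimension of the annihilator share an
        allowance of 2.\<close>
      then have "dim ?K + card (?V - Fr) \<le> 2"
      proof cases
        case 1
        have "dim ?K \<le> DIM(real \<times> real)"
        proof (rule dim_le_DIM_of_injective[OF subspace_annih])
          show "linear (\<lambda>m::(real^'o) \<times> (real^'o). (fst m $ w, snd m $ w))" by (simp add: linear_iff)
          show "m' = 0" if "m' \<in> ?K" "(fst m' $ w, snd m' $ w) = 0" for m'
            using nzall[OF that(1) _ w(1)] that(2)
            unfolding nz_def zero_prod_def[where 'a=real and 'b=real] by blast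
        qed
        then show ?thesis unfolding 1 by simp
      next
        case 2
        then obtain u where u: "?V - Fr = {u}" by (auto simp: card_1_singleton_iff)
        then have uV: "u \<in> ?V" "u \<notin> Fr" by blast+
        then obtain e where e: "e \<in> F'" "src e = u \<or> dst e = u" by (auto simp: ends_def)
        \<comment> \<open>Some edge ends at \<open>u\<close>, and its other end is free since every
          edge meets \<open>C\<close>. This edge ties the value at \<open>v\<close> to a multiple of
          \<open>(1, d u)\<close>, which leaves one parameter.\<close>
        obtain v where v: "v \<in> ?V \<inter> Fr" "\<And>m'. m' \<in> ?K \<Longrightarrow> snd m' $ v = d u * fst m' $ v"
        proof (cases "src e = u")
          case True
          then have "dst e \<in> Fr" using all[OF m(1) w e(1)] uV by (auto simp: C_def)
          then show ?thesis using that[of "dst e"] annih1(4)[OF _ e(1)] True uV e(1) by (auto simp: ends_def)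
        next
          case False
          then have "src e \<in> Fr" "dst e = u" using all[OF m(1) w e(1)] uV e(2) by (auto simp: C_def)
          then show ?thesis using that[of "src e"] annih1(3)[OF _ e(1)] uV e(1) by (auto simp: ends_def)
        qed
        have "dim ?K \<le> DIM(real)"
        proof (rule dim_le_DIM_of_injective[OF subspace_annih])
          show "linear (\<lambda>m::(real^'o) \<times> (real^'o). fst m $ v)" by (simp add: linear_iff)
          show "m' = 0" if "m' \<in> ?K" "fst m' $ v = 0" for m'
            using nzall[OF that(1) _ v(1)] v(2)[OF that(1)] that(2) unfolding nz_def by auto
        qed
        then show ?thesis unfolding 2 by simp
      qed
      then show ?thesis using dimS cnt card_ends[of F'] by linarith
    qed
  qed simp
qed

end

section \<open>Rows of the two systems as hyperplane cuts\<close>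

context signed_graph begin

definition sym_row :: "real^'o \<Rightarrow> real^'o \<Rightarrow> 'e \<Rightarrow> (real^'o) \<times> (real^'o)" where
  "sym_row x y e = ((signed_inc e \<bullet> x) *\<^sub>R signed_inc e, (plain_inc e \<bullet> y) *\<^sub>R plain_inc e)"

text \<open>Relative to \<open>sym_row\<close> the two coordinate differences change places: vectors
  paired with this row carry vertical velocities first and horizontal ones second.\<close>

definition antisym_row :: "real^'o \<Rightarrow> real^'o \<Rightarrow> 'e \<Rightarrow> (real^'o) \<times> (real^'o)" where
  "antisym_row x y e = ((plain_inc e \<bullet> y) *\<^sub>R signed_inc e, (signed_inc e \<bullet> x) *\<^sub>R plain_inc e)"

text \<open>In the order vertical, horizontal, the vector \<open>(x, - y)\<close> is the
  infinitesimal rotation \<open>(- y, x)\<close>.\<close>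

lemma antisym_row_eq_cut: "antisym_row x y e = (- 1) *\<^sub>R hyperplane_cut (x, - y) (antisym_vec1 e) (antisym_vec2 e)"
  by (simp add: antisym_row_def hyperplane_cut_def antisym_vec1_def antisym_vec2_def inner_commute)

lemma indep_antisym_row_iff:
  "indep_family F (antisym_row x y) \<longleftrightarrow> indep_family F (\<lambda>e. hyperplane_cut (x, - y) (antisym_vec1 e) (antisym_vec2 e))"
proof -
  have "indep_family F (antisym_row x y) \<longleftrightarrow> indep_family F (\<lambda>e. (- 1) *\<^sub>R hyperplane_cut (x, - y) (antisym_vec1 e) (antisym_vec2 e))"
    by (rule indep_family_cong) (rule antisym_row_eq_cut)
  also have "\<dots> \<longleftrightarrow> indep_family F (\<lambda>e. hyperplane_cut (x, - y) (antisym_vec1 e) (antisym_vec2 e))"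
    using indep_family_scaleR[of F "\<lambda>e. hyperplane_cut (x, - y) (antisym_vec1 e) (antisym_vec2 e)" "\<lambda>_. - 1"]
      indep_family_scaleR[of F "\<lambda>e. (- 1) *\<^sub>R hyperplane_cut (x, - y) (antisym_vec1 e) (antisym_vec2 e)" "\<lambda>_. - 1"]
    by auto
  finally show ?thesis .
qed

lemma count_sparse2_imp_indep:
  assumes "count_sparse 2 F" shows "\<exists>x y. indep_family F (antisym_row x y)"
proof -
  obtain h where "indep_family F (\<lambda>e. hyperplane_cut h (antisym_vec1 e) (antisym_vec2 e))"
    using truncation_count_imp_indep_family[OF sparse2_imp_truncation_count[OF assms]] by blast
  then have "indep_family F (antisym_row (fst h) (- snd h))" by (simp add: indep_antisym_row_iff)
  then show ?thesis by blast
qed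

lemma indep_imp_count_sparse2:
  assumes "indep_family F (antisym_row x y)" shows "count_sparse 2 F"
  using truncation_count_imp_sparse2[OF indep_family_imp_truncation_count] assms
  unfolding indep_antisym_row_iff by blast

text \<open>Projective invariance of infinitesimal motions, edge by edge. With
  \<open>X = 1 / x\<close> and \<open>Y = y / x\<close>, the velocity \<open>(a, b)\<close> is
  transported to \<open>(A, B) = (X * b, a + Y * b)\<close>, up to a quarter turn; the vertical
  translation \<open>a = 0\<close>, \<open>b = 1\<close> becomes \<open>h = (X, Y)\<close>. At a
  fixed vertex \<open>Y\<close> is a mere scale and only has to be nonzero. For a loop at a fixed
  vertex both sides vanish and \<open>k = 1\<close> is a filler.\<close>

lemma cut_eq_sym_row:
  fixes x y a b A B :: "real^'o" and h :: "(real^'o) \<times> (real^'o)"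
  assumes inj: "inj_on (($) y) (- Fr)"
    and free: "\<And>v. v \<in> Fr \<Longrightarrow> x $ v * fst h $ v = 1" "\<And>v. v \<in> Fr \<Longrightarrow> snd h $ v = y $ v * fst h $ v"
    and fixed: "\<And>v. v \<notin> Fr \<Longrightarrow> snd h $ v \<noteq> 0"
    and AB: "\<And>v. v \<in> Fr \<Longrightarrow> A $ v = fst h $ v * b $ v" "\<And>v. v \<in> Fr \<Longrightarrow> B $ v = a $ v + snd h $ v * b $ v"
      "\<And>v. v \<notin> Fr \<Longrightarrow> B $ v = snd h $ v * b $ v"
    and k: "k = (if src e \<in> Fr then if dst e \<in> Fr then eps e * fst h $ src e * fst h $ dst e
        else snd h $ dst e * fst h $ src e
      else if dst e \<in> Fr then snd h $ src e * fst h $ dst e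
      else if src e = dst e then 1 else snd h $ src e * snd h $ dst e / (y $ src e - y $ dst e))"
  shows "hyperplane_cut h (sym_vec1 (($) y) e) (sym_vec2 e) \<bullet> (A, B) = k * (sym_row x y e \<bullet> (a, b))" "k \<noteq> 0"
proof -
  obtain X Y where h: "h = (X, Y)" by (cases h)
  have X: "x $ v = 1 / X $ v" "X $ v \<noteq> 0" if "v \<in> Fr" for v
  proof -
    have *: "x $ v * X $ v = 1" using free(1)[OF that] h by simp
    then show "X $ v \<noteq> 0" by auto
    then show "x $ v = 1 / X $ v" using * by (simp add: field_simps)
  qed
  have Y: "Y $ v = y $ v * X $ v" if "v \<in> Fr" for v using free(2)[OF that] h by simp
  have Yn: "Y $ v \<noteq> 0" if "v \<notin> Fr" for v using fixed[OF that] h by simp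
  have A: "A $ v = X $ v * b $ v" "B $ v = a $ v + y $ v * X $ v * b $ v" if "v \<in> Fr" for v
    using AB(1,2)[OF that] Y[OF that] h by simp_all
  have B: "B $ v = Y $ v * b $ v" if "v \<notin> Fr" for v using AB(3)[OF that] h by simp
  have yne: "y $ src e \<noteq> y $ dst e" if "src e \<notin> Fr" "dst e \<notin> Fr" "src e \<noteq> dst e"
    using inj that by (auto simp: inj_on_def)
  show "k \<noteq> 0" using X(2) Yn yne eps[of e] unfolding k h by auto
  have cut: "hyperplane_cut h p q \<bullet> (A, B) = (q \<bullet> h) * (p \<bullet> (A, B)) - (p \<bullet> h) * (q \<bullet> (A, B))" for p q
    by (simp add: hyperplane_cut_def inner_diff_left inner_commute[of h])
  have orow: "sym_row x y e \<bullet> (a, b) = (signed_inc e \<bullet> x) * (signed_inc e \<bullet> a) + (plain_inc e \<bullet> y) * (plain_inc e \<bullet> b)"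
    by (simp add: sym_row_def)
  show "hyperplane_cut h (sym_vec1 (($) y) e) (sym_vec2 e) \<bullet> (A, B) = k * (sym_row x y e \<bullet> (a, b))"
  proof (cases "src e \<in> Fr"; cases "dst e \<in> Fr")
    assume f: "src e \<in> Fr" "dst e \<in> Fr"
    then show ?thesis using X(2)[OF f(1)] X(2)[OF f(2)] eps[of e] unfolding cut orow
      by (simp add: k h sym_vec1_def sym_vec2_def inner_signed_inc inner_plain_inc X(1) Y A; auto simp: field_simps)
  next
    assume f: "src e \<in> Fr" "dst e \<notin> Fr"
    then show ?thesis using X(2)[OF f(1)] unfolding cut orow
      by (simp add: k h sym_vec1_def sym_vec2_def inner_signed_inc inner_plain_inc inner_axis' X(1) Y A B;
          simp add: field_simps)
  next
    assume f: "src e \<notin> Fr" "dst e \<in> Fr"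
    then show ?thesis using X(2)[OF f(2)] eps[of e] unfolding cut orow
      by (simp add: k h sym_vec1_def sym_vec2_def inner_signed_inc inner_plain_inc inner_axis' X(1) Y A B;
          auto simp: field_simps)
  next
    assume f: "src e \<notin> Fr" "dst e \<notin> Fr"
    then show ?thesis using yne[OF f] unfolding cut orow
      by (simp add: k h sym_vec1_def sym_vec2_def inner_signed_inc inner_plain_inc inner_axis' B;
          auto simp: field_simps)
  qed
qed

lemma indep_sym_row_iff_cut:
  fixes x y :: "real^'o" and h :: "(real^'o) \<times> (real^'o)"
  assumes "inj_on (($) y) (- Fr)"
    and "\<And>v. v \<in> Fr \<Longrightarrow> x $ v * fst h $ v = 1" "\<And>v. v \<in> Fr \<Longrightarrow> snd h $ v = y $ v * fst h $ v"
    and "\<And>v. v \<notin> Fr \<Longrightarrow> snd h $ v \<noteq> 0"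
  shows "indep_family F (sym_row x y) \<longleftrightarrow> indep_family F (\<lambda>e. hyperplane_cut h (sym_vec1 (($) y) e) (sym_vec2 e))"
proof -
  define k where "k e = (if src e \<in> Fr then if dst e \<in> Fr then eps e * fst h $ src e * fst h $ dst e
        else snd h $ dst e * fst h $ src e
      else if dst e \<in> Fr then snd h $ src e * fst h $ dst e
      else if src e = dst e then 1 else snd h $ src e * snd h $ dst e / (y $ src e - y $ dst e))" for e
  let ?c = "\<lambda>e. hyperplane_cut h (sym_vec1 (($) y) e) (sym_vec2 e)"
  have X0: "fst h $ v \<noteq> 0" if "v \<in> Fr" for v using assms(2)[OF that] by auto
  note cut = cut_eq_sym_row[OF assms _ _ _ k_def]
  have knz: "k e \<noteq> 0" for e
    \<comment> \<open>The factor does not depend on the motion, so the zero motion serves as test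
      vector.\<close>
    by (rule cut(2)[of "\<chi> v. fst h $ v * 0" 0 "\<chi> v. (if v \<in> Fr then 0 + snd h $ v * 0 else snd h $ v * 0)" 0]) auto
  show ?thesis
  proof
    assume *: "indep_family F (sym_row x y)"
    show "indep_family F ?c"
    proof (rule indep_family_transfer[OF *, of _ k])
      fix m :: "(real^'o) \<times> (real^'o)"
      let ?A = "\<chi> v. fst h $ v * snd m $ v"
      let ?B = "\<chi> v. if v \<in> Fr then fst m $ v + snd h $ v * snd m $ v else snd h $ v * snd m $ v"
      have "?c e \<bullet> (?A, ?B) = k e * (sym_row x y e \<bullet> (fst m, snd m))" for e
        by (rule cut(1)) auto
      then show "\<exists>m'. \<forall>e\<in>F. ?c e \<bullet> m' = k e * (sym_row x y e \<bullet> m)"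
        by (intro exI[of _ "(?A, ?B)"]) simp
    qed (rule knz)
  next
    assume *: "indep_family F ?c"
    show "indep_family F (sym_row x y)"
    proof (rule indep_family_transfer[OF *, of _ "\<lambda>e. 1 / k e"])
      fix m :: "(real^'o) \<times> (real^'o)"
      \<comment> \<open>The inverse substitution: \<open>b = A / X\<close> and
        \<open>a = B - Y * b\<close> at a free vertex, \<open>b = B / Y\<close> at a fixed one. The
        value of \<open>?a\<close> at a fixed vertex does not enter the row.\<close>
      let ?b = "\<chi> v. if v \<in> Fr then fst m $ v / fst h $ v else snd m $ v / snd h $ v"
      let ?a = "\<chi> v. snd m $ v - snd h $ v * (fst m $ v / fst h $ v)"
      have "?c e \<bullet> (fst m, snd m) = k e * (sym_row x y e \<bullet> (?a, ?b))" for e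
        by (rule cut(1)) (auto simp: X0 assms(4))
      then show "\<exists>m'. \<forall>e\<in>F. sym_row x y e \<bullet> m' = 1 / k e * (?c e \<bullet> m)"
        using knz by (intro exI[of _ "(?a, ?b)"]) simp
    qed (simp add: knz)
  qed
qed

lemma polynomial_function_hyperplane_cut:
  "polynomial_function (\<lambda>h::'x::euclidean_space. hyperplane_cut h a b)"
proof -
  have "linear (\<lambda>h. hyperplane_cut h a b)"
    by (simp add: linear_iff hyperplane_cut_def inner_add_left scaleR_add_left scaleR_diff_right)
  then show ?thesis by (simp add: linear_conv_bounded_linear polynomial_function_bounded_linear)
qed

text \<open>The truncation supplies some \<open>h\<close>, but reading off a realisation requires
  its first component to be nonzero at free vertices and its second at fixed ones. These are further
  polynomial conditions, so a generic \<open>h\<close> meets them too.\<close>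

lemma count_sparse1_imp_indep:
  fixes d :: "'o \<Rightarrow> real"
  assumes "count_sparse 1 F" "inj_on d (- Fr)"
  shows "\<exists>x y. indep_family F (sym_row x y)"
proof -
  let ?c = "\<lambda>e h. hyperplane_cut h (sym_vec1 d e) (sym_vec2 e)"
  obtain h0 where h0: "indep_family F (\<lambda>e. ?c e h0)"
    using truncation_count_imp_indep_family[OF sparse1_imp_truncation_count[OF assms]] by blast
  obtain P where P: "real_polynomial_function P" "P h0 \<noteq> 0" "\<And>h. P h \<noteq> 0 \<Longrightarrow> indep_family F (\<lambda>e. ?c e h)"
    using indep_family_generic[of F ?c h0, OF finite polynomial_function_hyperplane_cut h0] by auto
  define Q :: "'o option \<Rightarrow> (real^'o) \<times> (real^'o) \<Rightarrow> real" where
    "Q = case_option P (\<lambda>v h. if v \<in> Fr then fst h $ v else snd h $ v)"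
  have "\<exists>h. \<forall>i\<in>UNIV. Q i h \<noteq> 0"
  proof (rule real_polynomial_function_common_nonzero)
    fix i :: "'o option"
    have lin: "bounded_linear (\<lambda>h::(real^'o) \<times> (real^'o). fst h $ v)"
      "bounded_linear (\<lambda>h::(real^'o) \<times> (real^'o). snd h $ v)" for v
      by (simp_all add: linear_conv_bounded_linear[symmetric] linear_iff)
    show "real_polynomial_function (Q i)"
    proof (cases i)
      case None then show ?thesis using P(1) by (simp add: Q_def)
    next
      case (Some v)
      then show ?thesis using lin[of v]
        by (cases "v \<in> Fr") (simp_all add: Q_def real_polynomial_function.intros(1))
    qed
    show "\<exists>h. Q i h \<noteq> 0"
    proof (cases i)
      case None then show ?thesis using P(2) by (intro exI[of _ h0]) (simp add: Q_def)
    next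
      case (Some v) then show ?thesis by (intro exI[of _ "(axis v 1, axis v 1)"]) (simp add: Q_def)
    qed
  qed simp
  then obtain h where h: "\<And>i. Q i h \<noteq> 0" by blast
  have ind: "indep_family F (\<lambda>e. ?c e h)" using P(3) h[of None] by (simp add: Q_def)
  have nz: "v \<in> Fr \<Longrightarrow> fst h $ v \<noteq> 0" "v \<notin> Fr \<Longrightarrow> snd h $ v \<noteq> 0" for v
    using h[of "Some v"] by (simp_all add: Q_def)
  \<comment> \<open>The map \<open>(x, y) \<mapsto> (1 / x, y / x)\<close> is inverted at free
    vertices. Fixed vertices keep the prescribed heights \<open>d\<close>, so that the planes do not
    change.\<close>
  define x y where "x = (\<chi> v. 1 / fst h $ v)" and "y = (\<chi> v. if v \<in> Fr then snd h $ v / fst h $ v else d v)"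
  have "sym_vec1 (($) y) e = sym_vec1 d e" for e by (simp add: sym_vec1_def y_def)
  moreover have "inj_on (($) y) (- Fr)" using assms(2) by (simp add: y_def inj_on_def)
  ultimately have "indep_family F (sym_row x y)"
    using ind indep_sym_row_iff_cut[of y x h F] nz by (simp add: x_def y_def)
  then show ?thesis by blast
qed

lemma indep_imp_count_sparse1:
  assumes "indep_family F (sym_row x y)" "inj_on (($) y) (- Fr)" "\<And>v. v \<in> Fr \<Longrightarrow> x $ v \<noteq> 0"
  shows "count_sparse 1 F"
proof -
  let ?h = "(\<chi> v. 1 / x $ v, \<chi> v. if v \<in> Fr then y $ v / x $ v else 1)"
  have "indep_family F (\<lambda>e. hyperplane_cut ?h (sym_vec1 (($) y) e) (sym_vec2 e))"
    using indep_sym_row_iff_cut[of y x ?h F] assms by simp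
  then show ?thesis using truncation_count_imp_sparse1[OF indep_family_imp_truncation_count] by blast
qed

lemma polynomial_function_rows:
  "polynomial_function (\<lambda>z. sym_row (fst z) (snd z) e)" "polynomial_function (\<lambda>z. antisym_row (fst z) (snd z) e)"
  by (intro polynomial_function_bounded_linear;
      simp add: linear_conv_bounded_linear[symmetric] linear_iff sym_row_def antisym_row_def
        inner_add_right scaleR_add_left)+

end

section \<open>Balanced gain graphs\<close>

definition walk_sign :: "('b \<Rightarrow> real) \<Rightarrow> ('b \<times> bool) list \<Rightarrow> real" where
  "walk_sign s c = prod_list (map (s \<circ> fst) c)"

lemma walk_sign_Cons: "walk_sign s ((e, b) # c) = s e * walk_sign s c"
  by (simp add: walk_sign_def)

lemma two_way_simps [simp]:
  "verts (two_way K) = verts K" "arcs (two_way K) = arcs K \<times> UNIV"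
  "tail (two_way K) (e, b) = (if b then tail K e else head K e)"
  "head (two_way K) (e, b) = (if b then head K e else tail K e)"
  by (simp_all add: two_way_def)

lemma wf_two_way: "wf_digraph K \<Longrightarrow> wf_digraph (two_way K)"
  unfolding wf_digraph_def by (auto split: if_splits)

lemma walk_sign_potential:
  assumes "wf_digraph K" and \<theta>: "\<And>e. e \<in> arcs K \<Longrightarrow> \<theta> (tail K e) = s e * \<theta> (head K e)"
    and s: "\<And>e. s e = 1 \<or> s e = - (1 :: real)"
    and "pre_digraph.awalk (two_way K) u c v"
  shows "\<theta> u = walk_sign s c * (\<theta> v :: real)"
proof -
  interpret D: wf_digraph "two_way K" using wf_two_way[OF assms(1)] .
  show ?thesis using assms(4)
  proof (induction c arbitrary: u)
    case Nil then show ?case by (simp add: D.awalk_Nil_iff walk_sign_def)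
  next
    case (Cons a c)
    obtain e b where a: "a = (e, b)" by (cases a)
    have e: "e \<in> arcs K" "u = tail (two_way K) (e, b)" "D.awalk (head (two_way K) (e, b)) c v"
      using Cons.prems by (auto simp: D.awalk_Cons_iff a)
    have "\<theta> u = s e * \<theta> (head (two_way K) (e, b))"
      using \<theta>[OF e(1)] s[of e] e(2) by (cases b) auto
    then show ?case using Cons.IH[OF e(3)] by (simp add: walk_sign_def a)
  qed
qed

text \<open>Traversing an edge again, in either direction, would revisit the vertex from which it
  was first left. Hence closing a path with a new edge gives a genuine undirected cycle.\<close>

lemma distinct_edges_apath:
  assumes "wf_digraph K" "pre_digraph.apath (two_way K) u p v"
  shows "distinct (map fst p)"
proof -
  interpret D: wf_digraph "two_way K" using wf_two_way[OF assms(1)] .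
  show ?thesis using assms(2)
  proof (induction p arbitrary: u)
    case (Cons a p)
    obtain e b where a: "a = (e, b)" by (cases a)
    have p: "D.apath (head (two_way K) a) p v" "tail (two_way K) a \<notin> set (D.awalk_verts (head (two_way K) a) p)"
      using Cons.prems by (auto simp: D.apath_Cons_iff)
    have "e \<notin> fst ` set p"
    proof
      assume "e \<in> fst ` set p"
      then obtain b' where b': "(e, b') \<in> set p" by auto
      have "D.awalk (head (two_way K) a) p v" using p(1) by (simp add: D.apath_def)
      then have "tail (two_way K) (e, b') \<in> set (D.awalk_verts (head (two_way K) a) p)"
        "head (two_way K) (e, b') \<in> set (D.awalk_verts (head (two_way K) a) p)"
        using b' D.set_awalk_verts by (simp_all del: two_way_simps)
      then show False using p(2) a by (cases b; cases b') auto
    qed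
    then show ?case using Cons.IH[OF p(1)] a by simp
  qed simp
qed

text \<open>Edges are added one at a time. If the ends of the new edge are already joined by a path,
  the cycle it closes forces the condition at that edge. If not, the potential may be negated on one
  component.\<close>

lemma exists_potential_if_cycles_trivial:
  fixes s :: "'b \<Rightarrow> real"
  assumes "finite A" and s: "\<And>e. s e = 1 \<or> s e = - 1"
    and "\<And>e. e \<in> A \<Longrightarrow> t e \<in> V \<and> h e \<in> V"
    and "\<And>c. undirected_cycle \<lparr>verts = V, arcs = A, tail = t, head = h\<rparr> c \<Longrightarrow> walk_sign s c = 1"
  shows "\<exists>\<theta>. (\<forall>v. \<theta> v = 1 \<or> \<theta> v = (- 1 :: real)) \<and> (\<forall>e\<in>A. \<theta> (t e) = s e * \<theta> (h e))"
  using assms(1,3,4)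
proof (induction A)
  case empty
  show ?case by (intro exI[of _ "\<lambda>_. 1"]) simp
next
  case (insert e A)
  let ?K = "\<lparr>verts = V, arcs = A, tail = t, head = h\<rparr>"
  let ?K' = "\<lparr>verts = V, arcs = insert e A, tail = t, head = h\<rparr>"
  have wf: "wf_digraph ?K" "wf_digraph ?K'" using insert.prems(1) by (auto simp: wf_digraph_def)
  interpret D: wf_digraph "two_way ?K" using wf_two_way[OF wf(1)] .
  interpret D': wf_digraph "two_way ?K'" using wf_two_way[OF wf(2)] .
  have comp: "compatible (two_way ?K) (two_way ?K')" by (simp add: compatible_def two_way_def fun_eq_iff split_beta)
  then have sub: "subgraph (two_way ?K) (two_way ?K')"
    using D.wf_digraph_axioms D'.wf_digraph_axioms by (auto simp: subgraph_def compatible_def)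
  have verts_eq: "D.awalk_verts = D'.awalk_verts" by (rule compatible_awalk_verts[OF comp])
  have "walk_sign s c = 1" if "undirected_cycle ?K c" for c
  proof (rule insert.prems(2))
    show "undirected_cycle ?K' c"
      using that D'.subgraph_awalk_imp_awalk[OF _ sub] verts_eq
      unfolding undirected_cycle_def D.cycle_def D'.cycle_def by auto
  qed
  then have "\<exists>\<theta>. (\<forall>v. \<theta> v = 1 \<or> \<theta> v = (- 1 :: real)) \<and> (\<forall>e\<in>A. \<theta> (t e) = s e * \<theta> (h e))"
    using insert.prems(1) by (intro insert.IH) simp_all
  then obtain \<theta> where \<theta>: "\<And>v. \<theta> v = 1 \<or> \<theta> v = (- 1 :: real)" "\<And>e. e \<in> A \<Longrightarrow> \<theta> (t e) = s e * \<theta> (h e)"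
    by blast
  show ?case
  proof (cases "\<exists>p. D.apath (h e) p (t e)")
    case True
    then obtain p where p: "D.apath (h e) p (t e)" by blast
    then have w: "D.awalk (h e) p (t e)" "distinct (D.awalk_verts (h e) p)" by (simp_all add: D.apath_def)
    have "D'.awalk (t e) ((e, True) # p) (t e)"
      using D'.subgraph_awalk_imp_awalk[OF w(1) sub] by (simp add: D'.awalk_Cons_iff)
    moreover have "distinct (List.tl (D'.awalk_verts (t e) ((e, True) # p)))"
      using w(2) verts_eq by simp
    moreover have "distinct (map fst ((e, True) # p))"
    proof -
      have "set p \<subseteq> A \<times> UNIV" using w(1) by (auto simp: D.awalk_def)
      then have "e \<notin> set (map fst p)" using insert.hyps(2) by auto
      then show ?thesis using distinct_edges_apath[OF wf(1) p] by simp
    qed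
    ultimately have "undirected_cycle ?K' ((e, True) # p)"
      unfolding undirected_cycle_def D'.cycle_def by blast
    then have "s e * walk_sign s p = 1" using insert.prems(2)[of "(e, True) # p"] walk_sign_Cons[of s e True p] by simp
    moreover have "\<theta> (h e) = walk_sign s p * \<theta> (t e)"
      by (rule walk_sign_potential[OF wf(1) _ s w(1)]) (simp add: \<theta>(2))
    ultimately have "\<theta> (t e) = s e * \<theta> (h e)" using s[of e] by auto
    then show ?thesis using \<theta> by auto
  next
    case False
    \<comment> \<open>The component of the head of the new edge. By \<open>step\<close> no old edge
      leaves it, so negating \<open>\<theta>\<close> on it preserves all old conditions.\<close>
    define C where "C = {w. \<exists>p. D.awalk (h e) p w}"
    have te: "t e \<notin> C" using False D.apath_awalk_to_apath unfolding C_def by blast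
    have he: "h e \<in> C" using insert.prems(1) unfolding C_def
      by (intro CollectI exI[of _ "[]"]) (simp add: D.awalk_Nil_iff)
    have step: "t i \<in> C \<longleftrightarrow> h i \<in> C" if "i \<in> A" for i
    proof
      assume "t i \<in> C"
      then obtain p where "D.awalk (h e) p (t i)" by (auto simp: C_def)
      moreover have "D.awalk (t i) [(i, True)] (h i)"
        using that insert.prems(1) by (simp add: D.awalk_Cons_iff D.awalk_Nil_iff)
      ultimately show "h i \<in> C" unfolding C_def using D.awalk_appendI by blast
    next
      assume "h i \<in> C"
      then obtain p where "D.awalk (h e) p (h i)" by (auto simp: C_def)
      moreover have "D.awalk (h i) [(i, False)] (t i)"
        using that insert.prems(1) by (simp add: D.awalk_Cons_iff D.awalk_Nil_iff)
      ultimately show "t i \<in> C" unfolding C_def using D.awalk_appendI by blast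
    qed
    show ?thesis
    proof (cases "\<theta> (t e) = s e * \<theta> (h e)")
      case True then show ?thesis using \<theta> by auto
    next
      case False
      then have "\<theta> (t e) = s e * (- \<theta> (h e))"
        using \<theta>(1)[of "t e"] \<theta>(1)[of "h e"] s[of e] by auto
      then show ?thesis using \<theta> te he step
        by (intro exI[of _ "\<lambda>v. if v \<in> C then - \<theta> v else \<theta> v"]) auto
    qed
  qed
qed

lemma cycles_trivial_iff_potential:
  fixes s :: "'b \<Rightarrow> real"
  assumes "wf_digraph K" "finite (arcs K)" "\<And>e. s e = 1 \<or> s e = - 1"
  shows "(\<forall>c. undirected_cycle K c \<longrightarrow> walk_sign s c = 1) \<longleftrightarrow>
    (\<exists>\<theta>. (\<forall>v. \<theta> v = 1 \<or> \<theta> v = (- 1 :: real)) \<and> (\<forall>e\<in>arcs K. \<theta> (tail K e) = s e * \<theta> (head K e)))"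
proof
  assume *: "\<forall>c. undirected_cycle K c \<longrightarrow> walk_sign s c = 1"
  have K: "\<lparr>verts = verts K, arcs = arcs K, tail = tail K, head = head K\<rparr> = K" by simp
  show "\<exists>\<theta>. (\<forall>v. \<theta> v = 1 \<or> \<theta> v = (- 1 :: real)) \<and> (\<forall>e\<in>arcs K. \<theta> (tail K e) = s e * \<theta> (head K e))"
    by (rule exists_potential_if_cycles_trivial[OF assms(2,3), where V = "verts K"])
      (use * K assms(1) in \<open>auto simp: wf_digraph_def\<close>)
next
  assume "\<exists>\<theta>. (\<forall>v. \<theta> v = 1 \<or> \<theta> v = (- 1 :: real)) \<and> (\<forall>e\<in>arcs K. \<theta> (tail K e) = s e * \<theta> (head K e))"
  then obtain \<theta> where \<theta>: "\<And>v. \<theta> v = 1 \<or> \<theta> v = (- 1 :: real)"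
    "\<And>e. e \<in> arcs K \<Longrightarrow> \<theta> (tail K e) = s e * \<theta> (head K e)" by blast
  interpret D: wf_digraph "two_way K" using wf_two_way[OF assms(1)] .
  show "\<forall>c. undirected_cycle K c \<longrightarrow> walk_sign s c = 1"
  proof (intro allI impI)
    fix c assume "undirected_cycle K c"
    then obtain u where "D.awalk u c u" by (auto simp: undirected_cycle_def D.cycle_def)
    from walk_sign_potential[OF assms(1) \<theta>(2) assms(3) this] have "\<theta> u = walk_sign s c * \<theta> u" by simp
    then show "walk_sign s c = 1" using \<theta>(1)[of u] by auto
  qed
qed

definition gain_sign :: "'g monoid \<Rightarrow> 'g \<Rightarrow> real" where
  "gain_sign \<Gamma> g = (if g = \<one>\<^bsub>\<Gamma>\<^esub> then 1 else - 1)"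

lemma order_two_square:
  assumes "group \<Gamma>" "order \<Gamma> = 2" "g \<in> carrier \<Gamma>"
  shows "g \<otimes>\<^bsub>\<Gamma>\<^esub> g = \<one>\<^bsub>\<Gamma>\<^esub>"
proof (cases "g = \<one>\<^bsub>\<Gamma>\<^esub>")
  case False
  interpret group \<Gamma> by fact
  have "card (carrier \<Gamma>) = 2" using assms(2) by (simp add: order_def)
  then obtain a b where ab: "carrier \<Gamma> = {a, b}" by (meson card_2_iff)
  have "g \<otimes>\<^bsub>\<Gamma>\<^esub> g \<in> carrier \<Gamma>" "\<one>\<^bsub>\<Gamma>\<^esub> \<in> carrier \<Gamma>" using assms(3) by simp_all
  moreover have "g \<otimes>\<^bsub>\<Gamma>\<^esub> g \<noteq> g"
    using False assms(3) r_cancel_one by blast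
  ultimately show ?thesis using False assms(3) unfolding ab by auto
qed (use assms in \<open>simp add: group.is_monoid\<close>)

lemma gain_sign_mult:
  assumes "group \<Gamma>" "order \<Gamma> = 2" "g \<in> carrier \<Gamma>" "h \<in> carrier \<Gamma>"
  shows "gain_sign \<Gamma> (g \<otimes>\<^bsub>\<Gamma>\<^esub> h) = gain_sign \<Gamma> g * gain_sign \<Gamma> h"
proof -
  interpret group \<Gamma> by fact
  have c: "card (carrier \<Gamma>) = 2" using assms(2) by (simp add: order_def)
  obtain a b where ab: "carrier \<Gamma> = {a, b}" using c by (meson card_2_iff)
  have "\<one>\<^bsub>\<Gamma>\<^esub> \<in> carrier \<Gamma>" by simp
  moreover have "g \<otimes>\<^bsub>\<Gamma>\<^esub> h = \<one>\<^bsub>\<Gamma>\<^esub>" if "g = h" using that order_two_square[OF assms(1,2,3)] by simp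
  ultimately show ?thesis using assms(3,4) unfolding gain_sign_def
    by (cases "g = h") (auto simp: ab)
qed

lemma gain_sign_inv:
  assumes "group \<Gamma>" "g \<in> carrier \<Gamma>"
  shows "gain_sign \<Gamma> (inv\<^bsub>\<Gamma>\<^esub> g) = gain_sign \<Gamma> g"
  using group.inv_eq_1_iff[OF assms] by (simp add: gain_sign_def)

lemma gain_sign_walk_gain:
  assumes "group \<Gamma>" "order \<Gamma> = 2" "\<And>e. e \<in> fst ` set c \<Longrightarrow> \<psi> e \<in> carrier \<Gamma>"
  shows "walk_gain \<Gamma> \<psi> c \<in> carrier \<Gamma> \<and> gain_sign \<Gamma> (walk_gain \<Gamma> \<psi> c) = walk_sign (gain_sign \<Gamma> \<circ> \<psi>) c"
proof -
  interpret group \<Gamma> by fact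
  show ?thesis using assms(3)
  proof (induction c)
    case Nil then show ?case by (simp add: walk_gain_def walk_sign_def gain_sign_def)
  next
    case (Cons a c)
    obtain e b where a: "a = (e, b)" by (cases a)
    let ?g = "if b then \<psi> e else inv\<^bsub>\<Gamma>\<^esub> (\<psi> e)"
    have "walk_gain \<Gamma> \<psi> (a # c) = ?g \<otimes>\<^bsub>\<Gamma>\<^esub> walk_gain \<Gamma> \<psi> c" by (simp add: walk_gain_def a)
    moreover have "\<psi> e \<in> carrier \<Gamma>" using Cons.prems a by force
    then have "?g \<in> carrier \<Gamma>" "gain_sign \<Gamma> ?g = gain_sign \<Gamma> (\<psi> e)"
      using gain_sign_inv[OF assms(1)] by auto
    moreover have "walk_gain \<Gamma> \<psi> c \<in> carrier \<Gamma> \<and> gain_sign \<Gamma> (walk_gain \<Gamma> \<psi> c) = walk_sign (gain_sign \<Gamma> \<circ> \<psi>) c"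
      by (rule Cons.IH) (use Cons.prems in auto)
    ultimately show ?case using gain_sign_mult[OF assms(1,2)] unfolding a walk_sign_Cons by simp
  qed
qed

lemma balanced_iff_potential:
  fixes H :: "('v set, 'b) pre_digraph"
  assumes "group \<Gamma>" "order \<Gamma> = 2" "wf_digraph H" "finite (arcs H)" "\<And>e. e \<in> arcs H \<Longrightarrow> \<psi> e \<in> carrier \<Gamma>"
  shows "balanced \<Gamma> \<phi> \<psi> H \<longleftrightarrow> (\<exists>\<theta>. (\<forall>v. \<theta> v = 1 \<or> \<theta> v = (- 1 :: real)) \<and>
     (\<forall>e\<in>arcs H. tail H e \<notin> fixed_vertices \<Gamma> \<phi> \<and> head H e \<notin> fixed_vertices \<Gamma> \<phi> \<longrightarrow>
        \<theta> (tail H e) = gain_sign \<Gamma> (\<psi> e) * \<theta> (head H e)))"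
proof -
  let ?K = "H \<restriction> (verts H - fixed_vertices \<Gamma> \<phi>)"
  interpret H: wf_digraph H by fact
  have wf: "wf_digraph ?K" by (auto simp: wf_digraph_def)
  interpret D: wf_digraph "two_way ?K" using wf_two_way[OF wf] .
  have arcs: "arcs ?K = {e \<in> arcs H. tail H e \<notin> fixed_vertices \<Gamma> \<phi> \<and> head H e \<notin> fixed_vertices \<Gamma> \<phi>}"
    by auto
  have "walk_gain \<Gamma> \<psi> c = \<one>\<^bsub>\<Gamma>\<^esub> \<longleftrightarrow> walk_sign (gain_sign \<Gamma> \<circ> \<psi>) c = 1" if "undirected_cycle ?K c" for c
  proof -
    have "set c \<subseteq> arcs ?K \<times> UNIV"
      using that by (auto simp: undirected_cycle_def D.cycle_def D.awalk_def)
    then have "\<psi> e \<in> carrier \<Gamma>" if "e \<in> fst ` set c" for e using that assms(5) by auto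
    then show ?thesis using gain_sign_walk_gain[OF assms(1,2), of c \<psi>]
      by (auto simp: gain_sign_def split: if_splits)
  qed
  then have "balanced \<Gamma> \<phi> \<psi> H \<longleftrightarrow> (\<forall>c. undirected_cycle ?K c \<longrightarrow> walk_sign (gain_sign \<Gamma> \<circ> \<psi>) c = 1)"
    unfolding balanced_def by blast
  also have "\<dots> \<longleftrightarrow> (\<exists>\<theta>. (\<forall>v. \<theta> v = 1 \<or> \<theta> v = (- 1 :: real)) \<and>
      (\<forall>e\<in>arcs ?K. \<theta> (tail ?K e) = (gain_sign \<Gamma> \<circ> \<psi>) e * \<theta> (head ?K e)))"
    by (rule cycles_trivial_iff_potential[OF wf]) (use assms(4) in \<open>auto simp: gain_sign_def\<close>)
  finally show ?thesis unfolding arcs by (simp add: Ball_def imp_conjL)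
qed

section \<open>Symmetric and antisymmetric motions\<close>

definition fixed_orbits :: "('v \<Rightarrow> 'v) \<Rightarrow> 'v set set" where
  "fixed_orbits \<sigma> = {{v} | v. \<sigma> v = v}"

definition motion_space :: "'v::finite set set \<Rightarrow> ('v \<Rightarrow> real^2) \<Rightarrow> (real^2^'v) set" where
  "motion_space E q = {m. \<forall>u v. {u, v} \<in> E \<longrightarrow> (q u - q v) \<bullet> (m $ u - m $ v) = 0}"

lemma rigidity_row_inner:
  fixes m :: "real^2^'v::finite"
  assumes "u \<noteq> v"
  shows "rigidity_row q {u, v} \<bullet> m = (q u - q v) \<bullet> (m $ u - m $ v)"
proof -
  have "rigidity_row q {u, v} \<bullet> m = (\<Sum>w\<in>UNIV. rigidity_row q {u, v} $ w \<bullet> m $ w)"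
    by (simp add: inner_vec_def[of "rigidity_row q {u, v}"])
  also have "\<dots> = (\<Sum>w\<in>{u, v}. rigidity_row q {u, v} $ w \<bullet> m $ w)"
    by (rule sum.mono_neutral_right) (auto simp: rigidity_row_def)
  also have "\<dots> = (q u - q v) \<bullet> m $ u + (q v - q u) \<bullet> m $ v"
    using assms by (simp add: rigidity_row_def insert_Diff_if)
  finally show ?thesis by (simp add: inner_diff_left inner_diff_right)
qed

lemma dim_motion_space:
  fixes E :: "'v::finite set set"
  assumes "simple_graph E"
  shows "rigidity_rank E q + dim (motion_space E q) = DIM(real^2^'v)"
proof -
  have "motion_space E q = {m \<in> UNIV. \<forall>x\<in>rigidity_row q ` E. x \<bullet> m = 0}"
  proof -
    have "(\<forall>u v. {u, v} \<in> E \<longrightarrow> (q u - q v) \<bullet> (m $ u - m $ v) = 0) \<longleftrightarrow>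
        (\<forall>x\<in>rigidity_row q ` E. x \<bullet> m = 0)" for m
    proof
      assume *: "\<forall>u v. {u, v} \<in> E \<longrightarrow> (q u - q v) \<bullet> (m $ u - m $ v) = 0"
      show "\<forall>x\<in>rigidity_row q ` E. x \<bullet> m = 0"
      proof clarify
        fix e assume e: "e \<in> E"
        then have "card e = 2" using assms by (simp add: simple_graph_def)
        then obtain u v where "e = {u, v}" "u \<noteq> v" by (auto simp: card_2_iff)
        then show "rigidity_row q e \<bullet> m = 0" using * e by (simp add: rigidity_row_inner)
      qed
    next
      assume *: "\<forall>x\<in>rigidity_row q ` E. x \<bullet> m = 0"
      show "\<forall>u v. {u, v} \<in> E \<longrightarrow> (q u - q v) \<bullet> (m $ u - m $ v) = 0"
      proof (intro allI impI)
        fix u v assume "{u, v} \<in> E"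
        then show "(q u - q v) \<bullet> (m $ u - m $ v) = 0"
          using * rigidity_row_inner[of u v q m] by (cases "u = v") force+
      qed
    qed
    then show ?thesis by (simp add: motion_space_def)
  qed
  then show ?thesis
    using dim_annihilator[OF subspace_UNIV, of "rigidity_row q ` E"] by (simp add: rigidity_rank_def)
qed

lemma exists_indep_subfamily:
  fixes r :: "'e \<Rightarrow> 'a::euclidean_space"
  assumes "k \<le> dim (r ` A)" "finite A"
  shows "\<exists>F\<subseteq>A. card F = k \<and> indep_family F r"
proof -
  obtain B where B: "B \<subseteq> r ` A" "independent B" "r ` A \<subseteq> span B" "card B = dim (r ` A)"
    by (rule basis_exists)
  then have "k \<le> card B" using assms(1) by simp
  then obtain C where C: "C \<subseteq> B" "card C = k" by (metis obtain_subset_with_card_n)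
  then have "C \<subseteq> r ` A" using B by blast
  then obtain F where F: "F \<subseteq> A" "inj_on r F" "C = r ` F"
    using subset_image_inj[of C r A] by blast
  have "independent C" using independent_mono[OF B(2) C(1)] .
  then have "indep_family F r" using F assms(2) by (simp add: indep_family_iff finite_subset)
  moreover have "card F = k" using C F by (simp add: card_image)
  ultimately show ?thesis using F(1) by blast
qed

section \<open>Orbit coordinates of symmetric and antisymmetric motions\<close>

locale reflection_graph =
  fixes E :: "'v::finite set set" and \<sigma> :: "'v \<Rightarrow> 'v" and rep :: "'v set \<Rightarrow> 'v"
    and src dst :: "'v set set \<Rightarrow> 'v set" and eps :: "'v set set \<Rightarrow> real"
  assumes invol: "\<sigma> (\<sigma> v) = v"
    and simple: "simple_graph E"
    and invariant: "{u, v} \<in> E \<Longrightarrow> {\<sigma> u, \<sigma> v} \<in> E"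
    and eps: "eps e = 1 \<or> eps e = - 1"
    and ends_edge: "{u, v} \<in> E \<Longrightarrow>
      {src {{u, v}, {\<sigma> u, \<sigma> v}}, dst {{u, v}, {\<sigma> u, \<sigma> v}}} = {{u, \<sigma> u}, {v, \<sigma> v}}"
    and rep: "rep {v, \<sigma> v} \<in> {v, \<sigma> v}"
    and gain: "{u, v} \<in> E \<Longrightarrow> e = {{u, v}, {\<sigma> u, \<sigma> v}} \<Longrightarrow> src e \<notin> fixed_orbits \<sigma> \<Longrightarrow>
      dst e \<notin> fixed_orbits \<sigma> \<Longrightarrow>
      {rep (src e), if eps e = 1 then rep (dst e) else \<sigma> (rep (dst e))} \<in> e"

sublocale reflection_graph \<subseteq> signed_graph src dst eps "- fixed_orbits \<sigma>"
  by unfold_locales (rule eps)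

context reflection_graph begin

abbreviation orb :: "'v \<Rightarrow> 'v set" where "orb v \<equiv> {v, \<sigma> v}"
abbreviation orbs :: "'v set set" where "orbs \<equiv> range orb"

definition edge_orbs :: "'v set set set" where
  "edge_orbs = {{{u, v}, {\<sigma> u, \<sigma> v}} | u v. {u, v} \<in> E}"

text \<open>Tells the representative of a free orbit from its mirror image. The value 0 on the
  mirror makes horizontal coordinates vanish there, so that fixed and free vertices share the
  formulas below.\<close>

definition sg :: "'v \<Rightarrow> real" where
  "sg v = (if \<sigma> v = v then 0 else if v = rep (orb v) then 1 else - 1)"

text \<open>The symmetric realisation, and likewise the symmetric motion, with given coordinates at the
  representatives; \<open>coplace\<close> is its antisymmetric counterpart.\<close>

definition place :: "real^'v set \<Rightarrow> real^'v set \<Rightarrow> 'v \<Rightarrow> real^2" where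
  "place x y v = vector [sg v * x $ orb v, y $ orb v]"

definition coplace :: "real^'v set \<Rightarrow> real^'v set \<Rightarrow> 'v \<Rightarrow> real^2" where
  "coplace x y v = vector [x $ orb v, sg v * y $ orb v]"

lemma orb_\<sigma>: "orb (\<sigma> v) = orb v" by (auto simp: invol)

lemma orb_fixed_iff: "orb v \<in> fixed_orbits \<sigma> \<longleftrightarrow> \<sigma> v = v"
  by (auto simp: fixed_orbits_def)

lemma orb_eq_iff: "orb u = orb v \<longleftrightarrow> u = v \<or> u = \<sigma> v"
  using invol[of u] invol[of v] unfolding doubleton_eq_iff by auto

lemma sg_\<sigma>: "sg (\<sigma> v) = - sg v"
  unfolding sg_def orb_\<sigma> using rep[of v] by (auto simp: invol)

lemma sg_free: "\<sigma> v \<noteq> v \<Longrightarrow> sg v = 1 \<or> sg v = - 1" by (simp add: sg_def)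

lemma sg_fixed: "\<sigma> v = v \<Longrightarrow> sg v = 0" by (simp add: sg_def)

lemma rep_cases: "rep (orb v) = v \<or> rep (orb v) = \<sigma> v"
  using rep[of v] by blast

lemma orb_rep: "orb (rep (orb v)) = orb v"
  using rep_cases[of v]
proof
  assume r: "rep (orb v) = v" show ?thesis unfolding r ..
next
  assume r: "rep (orb v) = \<sigma> v" show ?thesis unfolding r by (rule orb_\<sigma>)
qed

lemma sg_rep:
  assumes "\<sigma> v \<noteq> v" shows "sg (rep (orb v)) = 1"
proof -
  have "\<sigma> (rep (orb v)) \<noteq> rep (orb v)" using rep_cases[of v] assms invol[of v] by metis
  then show ?thesis unfolding sg_def orb_rep by simp
qed

lemma ends_cases:
  assumes "{u, v} \<in> E" "e = {{u, v}, {\<sigma> u, \<sigma> v}}"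
  shows "src e = orb u \<and> dst e = orb v \<or> src e = orb v \<and> dst e = orb u"
  using ends_edge[OF assms(1), folded assms(2)] unfolding doubleton_eq_iff[of "src e"] .

text \<open>The gain names one edge of the orbit, from a representative to a representative or to a
  mirror image. On the other edge of the orbit both signs are reversed and their product is
  unchanged.\<close>

lemma edge_sign:
  assumes "{u, v} \<in> E" "e = {{u, v}, {\<sigma> u, \<sigma> v}}" "\<sigma> u \<noteq> u" "\<sigma> v \<noteq> v"
  shows "sg u * sg v = eps e"
proof -
  obtain a b where ab: "src e = orb a" "dst e = orb b" "\<sigma> a \<noteq> a" "\<sigma> b \<noteq> b"
    using ends_cases[OF assms(1,2)] assms(3,4) by blast
  let ?r = "rep (orb a)" and ?s = "if eps e = 1 then rep (orb b) else \<sigma> (rep (orb b))"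
  have "src e \<notin> fixed_orbits \<sigma>" "dst e \<notin> fixed_orbits \<sigma>"
    unfolding ab(1,2) orb_fixed_iff by (rule ab(3,4))+
  from gain[OF assms(1,2) this] have "{?r, ?s} \<in> e" unfolding ab(1,2) .
  then have "{?r, ?s} = {u, v} \<or> {?r, ?s} = {\<sigma> u, \<sigma> v}" using assms(2) by simp
  moreover have "sg ?r = 1" "sg ?s = eps e"
    using sg_rep ab eps[of e] by (auto simp: sg_\<sigma>)
  ultimately show ?thesis unfolding doubleton_eq_iff by (auto simp: sg_\<sigma>)
qed

lemma inner_2: "(a :: real^2) \<bullet> b = a $ 1 * b $ 1 + a $ 2 * b $ 2"
  by (simp add: inner_vec_def sum_2)

lemma edge_data:
  assumes "{u, v} \<in> E" "e = {{u, v}, {\<sigma> u, \<sigma> v}}"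
  shows "src e = orb u \<and> dst e = orb v \<or> src e = orb v \<and> dst e = orb u"
    "sg u = 0 \<or> sg u = 1 \<or> sg u = - 1" "sg v = 0 \<or> sg v = 1 \<or> sg v = - 1"
    "orb u \<in> - fixed_orbits \<sigma> \<longleftrightarrow> sg u \<noteq> 0" "orb v \<in> - fixed_orbits \<sigma> \<longleftrightarrow> sg v \<noteq> 0"
    "sg u \<noteq> 0 \<Longrightarrow> sg v \<noteq> 0 \<Longrightarrow> eps e = sg u * sg v"
proof -
  show "src e = orb u \<and> dst e = orb v \<or> src e = orb v \<and> dst e = orb u" by (rule ends_cases[OF assms])
  show "sg u = 0 \<or> sg u = 1 \<or> sg u = - 1" "sg v = 0 \<or> sg v = 1 \<or> sg v = - 1"
    unfolding sg_def by simp_all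
  have *: "orb w \<in> - fixed_orbits \<sigma> \<longleftrightarrow> sg w \<noteq> 0" for w
    unfolding Compl_iff orb_fixed_iff unfolding sg_def by simp
  show "orb u \<in> - fixed_orbits \<sigma> \<longleftrightarrow> sg u \<noteq> 0" "orb v \<in> - fixed_orbits \<sigma> \<longleftrightarrow> sg v \<noteq> 0"
    by (rule *)+
  show "eps e = sg u * sg v" if "sg u \<noteq> 0" "sg v \<noteq> 0"
  proof -
    have "\<sigma> u \<noteq> u" "\<sigma> v \<noteq> v" using that sg_fixed by metis+
    then show ?thesis using edge_sign[OF assms] by metis
  qed
qed

lemma place_row:
  assumes "{u, v} \<in> E" "e = {{u, v}, {\<sigma> u, \<sigma> v}}"
  shows "(place x y u - place x y v) \<bullet> (place a b u - place a b v) = sym_row x y e \<bullet> (a, b)"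
proof -
  define U V where "U = orb u" and "V = orb v"
  have "sym_row x y e \<bullet> (a, b) = (signed_inc e \<bullet> x) * (signed_inc e \<bullet> a) + (plain_inc e \<bullet> y) * (plain_inc e \<bullet> b)"
    by (simp add: sym_row_def)
  with edge_data[OF assms, folded U_def V_def] eps[of e] show ?thesis
    unfolding inner_2 place_def inner_signed_inc inner_plain_inc U_def[symmetric] V_def[symmetric]
    by (elim disjE conjE) (simp_all add: algebra_simps)
qed

text \<open>Only the vanishing is compared: each term contains the signed difference once, so its
  sign depends on which edge of the orbit is taken. In \<open>place_row\<close> that difference
  occurs twice within a term and the sign cancels.\<close>

lemma coplace_row:
  assumes "{u, v} \<in> E" "e = {{u, v}, {\<sigma> u, \<sigma> v}}"
  shows "(place x y u - place x y v) \<bullet> (coplace a b u - coplace a b v) = 0 \<longleftrightarrow> antisym_row x y e \<bullet> (b, a) = 0"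
proof -
  define U V where "U = orb u" and "V = orb v"
  let ?k = "(place x y u - place x y v) \<bullet> (coplace a b u - coplace a b v)"
  have "antisym_row x y e \<bullet> (b, a) = (plain_inc e \<bullet> y) * (signed_inc e \<bullet> b) + (signed_inc e \<bullet> x) * (plain_inc e \<bullet> a)"
    by (simp add: antisym_row_def)
  with edge_data[OF assms, folded U_def V_def] eps[of e]
  have "?k = antisym_row x y e \<bullet> (b, a) \<or> ?k = - (antisym_row x y e \<bullet> (b, a))"
    unfolding inner_2 place_def coplace_def inner_signed_inc inner_plain_inc U_def[symmetric] V_def[symmetric]
    by (elim disjE conjE) (simp_all add: algebra_simps)
  then show ?thesis by auto
qed

lemma place_\<sigma>: "place x y (\<sigma> v) $ 1 = - place x y v $ 1" "place x y (\<sigma> v) $ 2 = place x y v $ 2"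
  by (simp_all add: place_def sg_\<sigma> orb_\<sigma>)

lemma coplace_\<sigma>: "coplace x y (\<sigma> v) $ 1 = coplace x y v $ 1" "coplace x y (\<sigma> v) $ 2 = - coplace x y v $ 2"
  by (simp_all add: coplace_def sg_\<sigma> orb_\<sigma>)

definition sym_motions :: "real^'v set \<Rightarrow> real^'v set \<Rightarrow> ((real^'v set) \<times> (real^'v set)) set" where
  "sym_motions x y = {m \<in> coords orbs. \<forall>e\<in>edge_orbs. sym_row x y e \<bullet> m = 0}"

definition antisym_motions :: "real^'v set \<Rightarrow> real^'v set \<Rightarrow> ((real^'v set) \<times> (real^'v set)) set" where
  "antisym_motions x y = {m \<in> coords orbs. \<forall>e\<in>edge_orbs. antisym_row x y e \<bullet> m = 0}"

definition sym_lift :: "(real^'v set) \<times> (real^'v set) \<Rightarrow> real^2^'v" where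
  "sym_lift m = (\<chi> v. place (fst m) (snd m) v)"

text \<open>The components are interchanged because \<open>coords\<close> restricts the first one at
  fixed vertices, and an antisymmetric motion has no vertical velocity there.\<close>

definition antisym_lift :: "(real^'v set) \<times> (real^'v set) \<Rightarrow> real^2^'v" where
  "antisym_lift m = (\<chi> v. coplace (snd m) (fst m) v)"

lemma linear_lift: "linear sym_lift" "linear antisym_lift"
  by (auto simp: linear_iff sym_lift_def antisym_lift_def place_def coplace_def vec_eq_iff forall_2
      algebra_simps)

lemma sym_lift_in_motion_space:
  assumes "m \<in> sym_motions x y" shows "sym_lift m \<in> motion_space E (place x y)"
proof -
  have "(place x y u - place x y v) \<bullet> (place (fst m) (snd m) u - place (fst m) (snd m) v) = 0" if uv: "{u, v} \<in> E" for u v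
  proof -
    have "{{u, v}, {\<sigma> u, \<sigma> v}} \<in> edge_orbs" using uv by (auto simp: edge_orbs_def)
    then show ?thesis using assms place_row[OF uv refl, of x y "fst m" "snd m"] by (simp add: sym_motions_def)
  qed
  then show ?thesis by (simp add: motion_space_def sym_lift_def)
qed

lemma antisym_lift_in_motion_space:
  assumes "m \<in> antisym_motions x y" shows "antisym_lift m \<in> motion_space E (place x y)"
proof -
  have "(place x y u - place x y v) \<bullet> (coplace (snd m) (fst m) u - coplace (snd m) (fst m) v) = 0" if uv: "{u, v} \<in> E" for u v
  proof -
    have "{{u, v}, {\<sigma> u, \<sigma> v}} \<in> edge_orbs" using uv by (auto simp: edge_orbs_def)
    then show ?thesis using assms coplace_row[OF uv refl, of x y "snd m" "fst m"] by (simp add: antisym_motions_def)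
  qed
  then show ?thesis by (simp add: motion_space_def antisym_lift_def)
qed

lemma motion_space_decomp:
  assumes m: "m \<in> motion_space E (place x y)"
  shows "\<exists>a\<in>sym_motions x y. \<exists>b\<in>antisym_motions x y. m = sym_lift a + antisym_lift b"
proof -
  \<comment> \<open>Half the sum and half the difference of the motion and its mirror image, read
    off at the representatives.\<close>
  define a where "a = ((\<chi> o'. if o' \<in> orbs then (m $ rep o' $ 1 - m $ \<sigma> (rep o') $ 1) / 2 else 0),
    (\<chi> o'. if o' \<in> orbs then (m $ rep o' $ 2 + m $ \<sigma> (rep o') $ 2) / 2 else 0))"
  define b where "b = ((\<chi> o'. if o' \<in> orbs then (m $ rep o' $ 2 - m $ \<sigma> (rep o') $ 2) / 2 else 0),
    (\<chi> o'. if o' \<in> orbs then (m $ rep o' $ 1 + m $ \<sigma> (rep o') $ 1) / 2 else 0))"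
  have repf: "\<sigma> (rep o') = rep o'" if o: "o' \<in> orbs" "o' \<in> fixed_orbits \<sigma>" for o'
  proof -
    obtain v where v: "o' = orb v" using o(1) by blast
    then have "\<sigma> v = v" using o(2) orb_fixed_iff by blast
    then show ?thesis using rep[of v] v by auto
  qed
  have dec: "m $ v = place (fst a) (snd a) v + coplace (snd b) (fst b) v" for v
  proof -
    have "rep (orb v) = v \<or> rep (orb v) = \<sigma> v" using rep[of v] by blast
    then show ?thesis
    proof
      assume r: "rep (orb v) = v"
      then have "\<sigma> v = v \<Longrightarrow> rep {v} = v" by simp
      then show ?thesis using r
        by (cases "\<sigma> v = v") (auto simp: vec_eq_iff forall_2 place_def coplace_def sg_def a_def b_def field_simps)
    next
      assume r: "rep (orb v) = \<sigma> v"
      then have "\<sigma> v = v \<Longrightarrow> rep {v} = v" by simp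
      then show ?thesis using r
        by (cases "\<sigma> v = v") (auto simp: vec_eq_iff forall_2 place_def coplace_def sg_def a_def b_def invol field_simps)
    qed
  qed
  \<comment> \<open>The equations of an edge and of its image contain the symmetric part with equal
    signs and the antisymmetric part with opposite signs. Adding and subtracting separates
    them.\<close>
  have key: "(place x y u - place x y v) \<bullet> (place (fst a) (snd a) u - place (fst a) (snd a) v) = 0 \<and>
    (place x y u - place x y v) \<bullet> (coplace (snd b) (fst b) u - coplace (snd b) (fst b) v) = 0"
    if uv: "{u, v} \<in> E" for u v
  proof -
    have "(place x y u - place x y v) \<bullet> (m $ u - m $ v) = 0"
      "(place x y (\<sigma> u) - place x y (\<sigma> v)) \<bullet> (m $ \<sigma> u - m $ \<sigma> v) = 0"
      using m uv invariant[OF uv] by (simp_all add: motion_space_def)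
    then show ?thesis
      unfolding dec inner_2 by (simp add: place_\<sigma> coplace_\<sigma> algebra_simps)
  qed
  have "a \<in> sym_motions x y"
    unfolding sym_motions_def
  proof (intro CollectI conjI ballI)
    show "a \<in> coords orbs" using repf by (auto simp: coords_def a_def)
    fix e assume "e \<in> edge_orbs"
    then obtain u v where uv: "{u, v} \<in> E" "e = {{u, v}, {\<sigma> u, \<sigma> v}}" by (auto simp: edge_orbs_def)
    show "sym_row x y e \<bullet> a = 0" using place_row[OF uv, of x y "fst a" "snd a"] key[OF uv(1)] by simp
  qed
  moreover have "b \<in> antisym_motions x y"
    unfolding antisym_motions_def
  proof (intro CollectI conjI ballI)
    show "b \<in> coords orbs" using repf by (auto simp: coords_def b_def)
    fix e assume "e \<in> edge_orbs"
    then obtain u v where uv: "{u, v} \<in> E" "e = {{u, v}, {\<sigma> u, \<sigma> v}}" by (auto simp: edge_orbs_def)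
    show "antisym_row x y e \<bullet> b = 0" using coplace_row[OF uv, of x y "snd b" "fst b"] key[OF uv(1)] by simp
  qed
  moreover have "m = sym_lift a + antisym_lift b"
    by (simp add: vec_eq_iff[of m] sym_lift_def antisym_lift_def dec)
  ultimately show ?thesis by blast
qed

lemma dim_motion_space_le:
  "dim (motion_space E (place x y)) \<le> dim (sym_motions x y) + dim (antisym_motions x y)"
proof -
  let ?A = "sym_lift ` sym_motions x y" and ?B = "antisym_lift ` antisym_motions x y"
  have "motion_space E (place x y) \<subseteq> span (?A \<union> ?B)"
  proof
    fix m assume "m \<in> motion_space E (place x y)"
    then obtain a b where ab: "a \<in> sym_motions x y" "b \<in> antisym_motions x y" "m = sym_lift a + antisym_lift b"
      using motion_space_decomp by blast
    show "m \<in> span (?A \<union> ?B)"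
      unfolding ab(3) by (intro span_add span_base) (use ab(1,2) in auto)
  qed
  then have "dim (motion_space E (place x y)) \<le> dim (?A \<union> ?B)"
    using dim_subset dim_span by metis
  also have "\<dots> \<le> dim ?A + dim ?B" using dim_UN_submodular[of "{}" ?A ?B] by simp
  also have "\<dots> \<le> dim (sym_motions x y) + dim (antisym_motions x y)"
    by (intro add_mono dim_image_le linear_lift)
  finally show ?thesis .
qed

lemma ends_edge_orbs: "ends edge_orbs \<subseteq> orbs"
proof -
  have "src e \<in> orbs \<and> dst e \<in> orbs" if e: "e \<in> edge_orbs" for e
  proof -
    obtain u v where uv: "{u, v} \<in> E" "e = {{u, v}, {\<sigma> u, \<sigma> v}}"
      using e unfolding edge_orbs_def by blast
    have "orb u \<in> orbs" "orb v \<in> orbs" by (rule rangeI)+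
    then show ?thesis using ends_cases[OF uv] by metis
  qed
  then show ?thesis unfolding ends_def by blast
qed

lemma rows_in_coords:
  assumes "e \<in> edge_orbs"
  shows "sym_row x y e \<in> coords orbs" "antisym_row x y e \<in> coords orbs"
proof -
  have "src e \<in> orbs" "dst e \<in> orbs" using ends_edge_orbs assms by (auto simp: ends_def)
  then show "sym_row x y e \<in> coords orbs" "antisym_row x y e \<in> coords orbs"
    by (auto simp: sym_row_def antisym_row_def coords_def signed_inc_def free_axis_def plain_inc_def axis_def)
qed

lemma dim_sym_motions: "dim (sym_row x y ` edge_orbs) + dim (sym_motions x y) = dim (coords orbs)"
  using dim_annihilator[OF subspace_coords, of "sym_row x y ` edge_orbs" orbs] rows_in_coords
  unfolding sym_motions_def by (simp add: image_subset_iff)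

lemma dim_antisym_motions: "dim (antisym_row x y ` edge_orbs) + dim (antisym_motions x y) = dim (coords orbs)"
  using dim_annihilator[OF subspace_coords, of "antisym_row x y ` edge_orbs" orbs] rows_in_coords
  unfolding antisym_motions_def by (simp add: image_subset_iff)

end

section \<open>Trivial motions of the plane\<close>

lemma trivial_motionD:
  assumes "trivial_motion p m"
  shows "\<exists>c t1 t2. \<forall>v. m v $ 1 = - c * p v $ 2 + t1 \<and> m v $ 2 = c * p v $ 1 + t2"
proof -
  obtain M :: "real^2^2" and t where M: "transpose M = - M" "\<And>u. m u = M *v p u + t"
    using assms unfolding trivial_motion_def by blast
  have sk: "M $ j $ i = - M $ i $ j" for i j
    using arg_cong[OF M(1), of "\<lambda>N. N $ i $ j"] by (simp add: transpose_def)
  have "M $ 1 $ 1 = 0" "M $ 2 $ 2 = 0" "M $ 1 $ 2 = - M $ 2 $ 1"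
    using sk[of 1 1] sk[of 2 2] sk[of 2 1] by simp_all
  then show ?thesis
    by (intro exI[of _ "M $ 2 $ 1"] exI[of _ "t $ 1"] exI[of _ "t $ 2"])
      (simp add: M(2) matrix_vector_mult_def sum_2)
qed

lemma trivial_motionI:
  fixes t :: "real^2"
  assumes "\<And>v. m v $ 1 = - c * p v $ 2 + t $ 1" "\<And>v. m v $ 2 = c * p v $ 1 + t $ 2"
  shows "trivial_motion p m"
proof -
  let ?M = "vector [vector [0, - c], vector [c, 0]] :: real^2^2"
  have "transpose ?M = - ?M" by (simp add: transpose_def vec_eq_iff forall_2)
  moreover have "m u = ?M *v p u + t" for u
    using assms[of u] by (simp add: vec_eq_iff forall_2 matrix_vector_mult_def sum_2)
  ultimately show ?thesis unfolding trivial_motion_def by blast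
qed

lemma infinitesimal_motion_iff:
  "infinitesimal_motion E p (($) m) \<longleftrightarrow> m \<in> motion_space E p"
  by (simp add: infinitesimal_motion_def motion_space_def)

lemma affine_hull_UNIV_imp_nonconstant:
  fixes p :: "'v \<Rightarrow> real^2"
  assumes "affine hull (range p) = UNIV"
  shows "\<exists>v. p v $ i \<noteq> c"
proof (rule ccontr)
  assume *: "\<not> ?thesis"
  have "affine {w :: real^2. w $ i = c}"
  proof (unfold affine_def, intro ballI allI impI)
    fix x y :: "real^2" and u v :: real
    assume "x \<in> {w. w $ i = c}" "y \<in> {w. w $ i = c}" "u + v = 1"
    moreover from this have "u * c + v * c = c" by (simp flip: distrib_right)
    ultimately show "u *\<^sub>R x + v *\<^sub>R y \<in> {w. w $ i = c}" by simp
  qed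
  moreover have "range p \<subseteq> {w :: real^2. w $ i = c}" using * by auto
  ultimately have "affine hull (range p) \<subseteq> {w :: real^2. w $ i = c}" by (intro hull_minimal)
  then have "(\<chi> j. c + 1) \<in> {w :: real^2. w $ i = c}" using assms by blast
  then show False by simp
qed

text \<open>Parametrises the trivial motions: \<open>fst z\<close> is the angular velocity and
  \<open>snd z\<close> the translation.\<close>

definition trivial_lift :: "('v \<Rightarrow> real^2) \<Rightarrow> real \<times> (real^2) \<Rightarrow> real^2^'v" where
  "trivial_lift p z = (\<chi> v. vector [- fst z * p v $ 2 + snd z $ 1, fst z * p v $ 1 + snd z $ 2])"

lemma linear_trivial_lift: "linear (trivial_lift p)"
  by (auto simp: linear_iff trivial_lift_def vec_eq_iff forall_2 algebra_simps)

lemma trivial_lift_in_motion_space: "trivial_lift p z \<in> motion_space E p"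
  by (auto simp: motion_space_def trivial_lift_def inner_vec_def sum_2 algebra_simps)

lemma dim_range_trivial_lift:
  fixes p :: "'v::finite \<Rightarrow> real^2"
  assumes "affine hull (range p) = UNIV"
  shows "dim (range (trivial_lift p)) = 3"
proof -
  have "inj (trivial_lift p)"
  proof (rule linear_injective_0[OF linear_trivial_lift, THEN iffD2], intro allI impI)
    fix z assume "trivial_lift p z = 0"
    then have 0: "fst z * p v $ 2 = snd z $ 1" "fst z * p v $ 1 + snd z $ 2 = 0" for v
      by (auto simp: trivial_lift_def vec_eq_iff forall_2 dest: spec[of _ v])
    have "fst z = 0"
    proof (rule ccontr)
      assume "fst z \<noteq> 0"
      then have "p v $ 2 = snd z $ 1 / fst z" for v using 0(1)[of v] by (simp add: field_simps)
      then show False using affine_hull_UNIV_imp_nonconstant[OF assms, of 2] by blast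
    qed
    moreover from this have "snd z = 0" using 0 by (simp add: vec_eq_iff forall_2)
    ultimately show "z = 0" by (simp add: prod_eq_iff)
  qed
  then have "dim (range (trivial_lift p)) = dim (UNIV :: (real \<times> (real^2)) set)"
    by (intro dim_image_eq[OF linear_trivial_lift]) simp
  then show ?thesis by simp
qed

text \<open>As the points span the plane, the trivial motions form a subspace of dimension exactly
  3, which then exhausts the motion space.\<close>

lemma infinitesimally_rigid_if_dim_le:
  fixes p :: "'v::finite \<Rightarrow> real^2"
  assumes "affine hull (range p) = UNIV" "dim (motion_space E p) \<le> 3"
  shows "infinitesimally_rigid E p"
  unfolding infinitesimally_rigid_def
proof (intro allI impI)
  fix m assume m: "infinitesimal_motion E p m"
  have sub: "range (trivial_lift p) \<subseteq> motion_space E p"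
    using trivial_lift_in_motion_space by blast
  have "subspace (motion_space E p)"
    by (simp add: subspace_def motion_space_def add_diff_add inner_add_right scaleR_diff_right[symmetric])
  moreover have "subspace (range (trivial_lift p))"
    by (rule linear_subspace_image[OF linear_trivial_lift subspace_UNIV])
  ultimately have "range (trivial_lift p) = motion_space E p"
    using subspace_dim_equal[OF _ _ sub] dim_range_trivial_lift[OF assms(1)] assms(2) by simp
  moreover have "(\<chi> v. m v) \<in> motion_space E p"
    using m by (simp add: motion_space_def infinitesimal_motion_def)
  ultimately obtain z where z: "(\<chi> v. m v) = trivial_lift p z" by blast
  have "m v = vector [- fst z * p v $ 2 + snd z $ 1, fst z * p v $ 1 + snd z $ 2]" for v
    using z by (simp add: trivial_lift_def vec_eq_iff)
  then show "trivial_motion p m" by (intro trivial_motionI[of m "fst z" p "snd z"]) simp_all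
qed

section \<open>Sparse edge sets from a rigid placement\<close>

context reflection_graph begin

definition symmetric_placement :: "('v \<Rightarrow> real^2) \<Rightarrow> bool" where
  "symmetric_placement p \<longleftrightarrow> inj p \<and> affine hull (range p) = UNIV \<and>
     (\<forall>v. p (\<sigma> v) $ 1 = - p v $ 1 \<and> p (\<sigma> v) $ 2 = p v $ 2)"

text \<open>The signed graph lives on the whole type of vertex sets. Sets that are not orbits may
  count as free there and also need a nonzero first coordinate, hence the default 1.\<close>

definition rep_x :: "('v \<Rightarrow> real^2) \<Rightarrow> real^'v set" where
  "rep_x p = (\<chi> o'. if o' \<in> orbs then p (rep o') $ 1 else 1)"

definition rep_y :: "('v \<Rightarrow> real^2) \<Rightarrow> real^'v set" where
  "rep_y p = (\<chi> o'. p (rep o') $ 2)"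

context
  fixes p :: "'v \<Rightarrow> real^2" assumes p: "symmetric_placement p"
begin

lemma sym1: "p (\<sigma> v) $ 1 = - p v $ 1" and sym2: "p (\<sigma> v) $ 2 = p v $ 2"
  using p by (simp_all add: symmetric_placement_def)

lemma first_zero_iff: "p v $ 1 = 0 \<longleftrightarrow> \<sigma> v = v"
proof
  assume "p v $ 1 = 0"
  then have "p (\<sigma> v) = p v" using sym1[of v] sym2[of v] by (simp add: vec_eq_iff forall_2)
  then show "\<sigma> v = v" using p by (simp add: symmetric_placement_def inj_def)
next
  assume "\<sigma> v = v" then show "p v $ 1 = 0" using sym1[of v] by simp
qed

lemma place_rep_x_rep_y: "place (rep_x p) (rep_y p) v = p v"
proof -
  have x: "place (rep_x p) (rep_y p) v $ 1 = sg v * p (rep (orb v)) $ 1"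
    and y: "place (rep_x p) (rep_y p) v $ 2 = p (rep (orb v)) $ 2"
    by (simp_all add: place_def rep_x_def rep_y_def)
  have "sg v * p (rep (orb v)) $ 1 = p v $ 1"
  proof (cases "\<sigma> v = v")
    case True then show ?thesis using first_zero_iff[of v] sg_fixed by simp
  next
    case False
    show ?thesis using rep_cases[of v]
    proof
      assume r: "rep (orb v) = v"
      then have "sg v = 1" using False unfolding sg_def by simp
      then show ?thesis unfolding r by simp
    next
      assume r: "rep (orb v) = \<sigma> v"
      then have "sg v = - 1" using False unfolding sg_def r by simp
      then show ?thesis unfolding r by (simp add: sym1)
    qed
  qed
  moreover have "p (rep (orb v)) $ 2 = p v $ 2"
    using rep_cases[of v] sym2[of v] by (elim disjE) metis+
  ultimately show ?thesis unfolding vec_eq_iff forall_2 x y by simp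
qed

lemma rep_x_nonzero: "o' \<in> - fixed_orbits \<sigma> \<Longrightarrow> rep_x p $ o' \<noteq> 0"
proof (cases "o' \<in> orbs")
  case True
  assume o': "o' \<in> - fixed_orbits \<sigma>"
  obtain v where v: "o' = orb v" using True by blast
  then have "\<sigma> v \<noteq> v" using o' orb_fixed_iff by blast
  then have "\<sigma> (rep (orb v)) \<noteq> rep (orb v)" using rep_cases[of v] invol[of v] by metis
  then show ?thesis unfolding rep_x_def v by (simp add: first_zero_iff)
qed (simp add: rep_x_def)

lemma rep_y_inj_on: "inj_on (($) (rep_y p)) (- (- fixed_orbits \<sigma>))"
proof (rule inj_onI)
  fix a b assume ab: "a \<in> - (- fixed_orbits \<sigma>)" "b \<in> - (- fixed_orbits \<sigma>)" "rep_y p $ a = rep_y p $ b"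
  then obtain u v where uv: "a = {u}" "\<sigma> u = u" "b = {v}" "\<sigma> v = v" by (auto simp: fixed_orbits_def)
  then have r: "rep {u} = u" "rep {v} = v" using rep[of u] rep[of v] by simp_all
  have "p u $ 2 = p v $ 2" using ab(3) unfolding rep_y_def uv by (simp add: r)
  moreover have "p u $ 1 = 0" "p v $ 1 = 0" using uv first_zero_iff by blast+
  ultimately have "p u = p v" by (simp add: vec_eq_iff forall_2)
  then show "a = b" using p uv by (simp add: symmetric_placement_def inj_def)
qed

lemma exists_free: "\<exists>v. \<sigma> v \<noteq> v"
  using affine_hull_UNIV_imp_nonconstant[of p 1 0] p first_zero_iff
  unfolding symmetric_placement_def by blast

lemma motion_space_place: "motion_space E (place (rep_x p) (rep_y p)) = motion_space E p"
  by (simp add: motion_space_def place_rep_x_rep_y)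

text \<open>Comparing a free vertex with its mirror image eliminates rotation and horizontal
  translation, so only the vertical translation \<open>?w\<close> is left.\<close>

lemma dim_sym_motions_le_if_rigid:
  assumes rigid: "infinitesimally_rigid E p"
  shows "dim (sym_motions (rep_x p) (rep_y p)) \<le> 1"
proof -
  let ?w = "(0, \<chi> o'. if o' \<in> orbs then 1 else 0) :: (real^'v set) \<times> (real^'v set)"
  have "sym_motions (rep_x p) (rep_y p) \<subseteq> span {?w}"
  proof
    fix m assume m: "m \<in> sym_motions (rep_x p) (rep_y p)"
    then have "trivial_motion p (($) (sym_lift m))"
      using rigid sym_lift_in_motion_space[OF m] unfolding motion_space_place
      by (simp add: infinitesimally_rigid_def infinitesimal_motion_iff)
    then obtain c t1 t2 where c: "\<And>v. sg v * fst m $ orb v = - c * p v $ 2 + t1"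
      "\<And>v. snd m $ orb v = c * p v $ 1 + t2"
      using trivial_motionD[of p "($) (sym_lift m)"] by (auto simp: sym_lift_def place_def)
    have a: "fst m $ orb v = 0" if "\<sigma> v \<noteq> v" for v
      using c(1)[of v] c(1)[of "\<sigma> v"] sg_free[OF that] unfolding sg_\<sigma> orb_\<sigma> sym2 by auto
    have cm: "m \<in> coords orbs" using m by (simp add: sym_motions_def)
    obtain v where v: "\<sigma> v \<noteq> v" using exists_free by blast
    have "c * p v $ 1 = 0" using c(2)[of v] c(2)[of "\<sigma> v"] unfolding orb_\<sigma> sym1 by simp
    then have c0: "c = 0" using v first_zero_iff by simp
    have "fst m $ o' = 0" for o'
    proof (cases "o' \<in> orbs \<inter> - fixed_orbits \<sigma>")
      case True
      then obtain v where "o' = orb v" by blast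
      then show ?thesis using a[of v] True orb_fixed_iff[of v] by blast
    qed (use cm in \<open>simp add: coords_def\<close>)
    moreover have "snd m $ o' = (if o' \<in> orbs then t2 else 0)" for o'
    proof (cases "o' \<in> orbs")
      case True
      then obtain v where "o' = orb v" by blast
      then show ?thesis using c(2)[of v] c0 True by simp
    qed (use cm in \<open>simp add: coords_def\<close>)
    ultimately have m: "m = t2 *\<^sub>R ?w" by (simp add: prod_eq_iff vec_eq_iff)
    show "m \<in> span {?w}" unfolding m by (rule span_scale, rule span_base) simp
  qed
  then have "dim (sym_motions (rep_x p) (rep_y p)) \<le> dim (span {?w})" by (rule dim_subset)
  also have "\<dots> \<le> card {?w}" unfolding dim_span by (rule dim_le_card') simp
  finally show ?thesis by simp
qed

text \<open>The same comparison eliminates the vertical translation. There remain the horizontal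
  translation \<open>?w\<close> and the rotation \<open>?r\<close>, which is the vector defining the
  hyperplane of the antisymmetric rows.\<close>

lemma dim_antisym_motions_le_if_rigid:
  assumes rigid: "infinitesimally_rigid E p"
  shows "dim (antisym_motions (rep_x p) (rep_y p)) \<le> 2"
proof -
  let ?w = "(0, \<chi> o'. if o' \<in> orbs then 1 else 0) :: (real^'v set) \<times> (real^'v set)"
  let ?r = "(\<chi> o'. if o' \<in> orbs \<inter> - fixed_orbits \<sigma> then rep_x p $ o' else 0,
    \<chi> o'. if o' \<in> orbs then - rep_y p $ o' else 0) :: (real^'v set) \<times> (real^'v set)"
  have "antisym_motions (rep_x p) (rep_y p) \<subseteq> span {?w, ?r}"
  proof
    fix m assume m: "m \<in> antisym_motions (rep_x p) (rep_y p)"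
    then have "trivial_motion p (($) (antisym_lift m))"
      using rigid antisym_lift_in_motion_space[OF m] unfolding motion_space_place
      by (simp add: infinitesimally_rigid_def infinitesimal_motion_iff)
    then obtain c t1 t2 where c: "\<And>v. snd m $ orb v = - c * p v $ 2 + t1"
      "\<And>v. sg v * fst m $ orb v = c * p v $ 1 + t2"
      using trivial_motionD[of p "($) (antisym_lift m)"] by (auto simp: antisym_lift_def coplace_def)
    have cm: "m \<in> coords orbs" using m by (simp add: antisym_motions_def)
    obtain v where v: "\<sigma> v \<noteq> v" using exists_free by blast
    have t2: "t2 = 0" using c(2)[of v] c(2)[of "\<sigma> v"] unfolding orb_\<sigma> sym1 sg_\<sigma> by simp
    have pl: "p v $ 1 = sg v * rep_x p $ orb v" "p v $ 2 = rep_y p $ orb v" for v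
      using place_rep_x_rep_y[of v] unfolding place_def by (metis vector_2)+
    have "fst m $ o' = (if o' \<in> orbs \<inter> - fixed_orbits \<sigma> then c * rep_x p $ o' else 0)" for o'
    proof (cases "o' \<in> orbs \<inter> - fixed_orbits \<sigma>")
      case True
      then obtain v where o': "o' = orb v" by blast
      then have "\<sigma> v \<noteq> v" using True orb_fixed_iff[of v] by blast
      then have "sg v \<noteq> 0" using sg_free by fastforce
      then have "fst m $ orb v = c * rep_x p $ orb v" using c(2)[of v] t2 unfolding pl by simp
      then show ?thesis using True o' by simp
    next
      case False
      then have "fst m $ o' = 0" using cm by (simp add: coords_def)
      then show ?thesis using False by (simp only: if_False)
    qed
    moreover have "snd m $ o' = (if o' \<in> orbs then - c * rep_y p $ o' + t1 else 0)" for o'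
    proof (cases "o' \<in> orbs")
      case True
      then obtain v where o': "o' = orb v" by blast
      then show ?thesis using c(1)[of v] True unfolding pl by simp
    qed (use cm in \<open>simp add: coords_def\<close>)
    ultimately have m: "m = t1 *\<^sub>R ?w + c *\<^sub>R ?r" by (simp add: prod_eq_iff vec_eq_iff)
    have "?w \<in> span {?w, ?r}" "?r \<in> span {?w, ?r}" by (rule span_base, simp)+
    then show "m \<in> span {?w, ?r}" unfolding m by (intro span_add span_scale)
  qed
  then have "dim (antisym_motions (rep_x p) (rep_y p)) \<le> dim (span {?w, ?r})" by (rule dim_subset)
  also have "\<dots> \<le> card {?w, ?r}" unfolding dim_span by (rule dim_le_card') simp
  also have "\<dots> \<le> 2" by (simp add: card_insert_if)
  finally show ?thesis .
qed

text \<open>Keeps the subtractions of 1 and 2 from this dimension exact on natural numbers.\<close>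

lemma two_le_dim_coords: "2 \<le> dim (coords orbs)"
proof -
  obtain v where "\<sigma> v \<noteq> v" using exists_free by blast
  then have "orb v \<in> orbs \<inter> - fixed_orbits \<sigma>" using orb_fixed_iff by blast
  then have "card (orbs \<inter> - fixed_orbits \<sigma>) > 0" "card orbs > 0"
    by (auto simp: card_gt_0_iff)
  then show ?thesis unfolding dim_coords by linarith
qed

lemma sparse_sets_if_rigid:
  assumes rigid: "infinitesimally_rigid E p"
  shows "\<exists>F\<subseteq>edge_orbs. count_sparse 1 F \<and> card F + 1 = dim (coords orbs)"
    "\<exists>F\<subseteq>edge_orbs. count_sparse 2 F \<and> card F + 2 = dim (coords orbs)"
proof -
  let ?x = "rep_x p" and ?y = "rep_y p"
  have "dim (coords orbs) - 1 \<le> dim (sym_row ?x ?y ` edge_orbs)"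
    using dim_sym_motions[of ?x ?y] dim_sym_motions_le_if_rigid[OF rigid] by linarith
  from exists_indep_subfamily[OF this finite] obtain F where
    F: "F \<subseteq> edge_orbs" "card F = dim (coords orbs) - 1" "indep_family F (sym_row ?x ?y)" by blast
  then show "\<exists>F\<subseteq>edge_orbs. count_sparse 1 F \<and> card F + 1 = dim (coords orbs)"
    using indep_imp_count_sparse1[OF F(3) rep_y_inj_on rep_x_nonzero] two_le_dim_coords F(1,2)
    by (intro exI[of _ F]) simp
  have "dim (coords orbs) - 2 \<le> dim (antisym_row ?x ?y ` edge_orbs)"
    using dim_antisym_motions[of ?x ?y] dim_antisym_motions_le_if_rigid[OF rigid] by linarith
  from exists_indep_subfamily[OF this finite] obtain F where
    F: "F \<subseteq> edge_orbs" "card F = dim (coords orbs) - 2" "indep_family F (antisym_row ?x ?y)" by blast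
  then show "\<exists>F\<subseteq>edge_orbs. count_sparse 2 F \<and> card F + 2 = dim (coords orbs)"
    using indep_imp_count_sparse2[OF F(3)] two_le_dim_coords F(1,2)
    by (intro exI[of _ F]) simp
qed

end

section \<open>Rigid placements from sparse edge sets\<close>

text \<open>A free vertex, its mirror image and a vertex of another orbit form a proper triangle:
  the first two differ horizontally and the third lies at a different height. The given placement
  \<open>p\<close> guarantees that such vertices exist.\<close>

lemma symmetric_placement_place:
  assumes "symmetric_placement p" and x: "\<And>o'. x $ o' \<noteq> 0" and y: "\<And>a b. a \<noteq> b \<Longrightarrow> y $ a \<noteq> y $ b"
  shows "symmetric_placement (place x y)"
proof -
  have inj: "inj (place x y)"
  proof (rule injI)
    fix u v assume uv: "place x y u = place x y v"
    then have "place x y u $ 2 = place x y v $ 2" by simp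
    then have o': "orb u = orb v" using y[of "orb u" "orb v"] unfolding place_def by auto
    show "u = v"
    proof (rule ccontr)
      assume "u \<noteq> v"
      then have u: "u = \<sigma> v" "\<sigma> v \<noteq> v" using o' orb_eq_iff by blast+
      have "place x y u $ 1 = - place x y v $ 1" unfolding u(1) by (rule place_\<sigma>)
      then have "sg v * x $ orb v = 0" using uv unfolding place_def by simp
      then show False using x sg_free[OF u(2)] by auto
    qed
  qed
  obtain v where v: "\<sigma> v \<noteq> v" using exists_free[OF assms(1)] by blast
  obtain u where u: "p u $ 2 \<noteq> p v $ 2"
    using affine_hull_UNIV_imp_nonconstant[of p 2 "p v $ 2"] assms(1)
    unfolding symmetric_placement_def by blast
  have "orb u \<noteq> orb v"
  proof
    assume "orb u = orb v"
    then have "u = v \<or> u = \<sigma> v" by (simp only: orb_eq_iff)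
    then show False using u sym2[OF assms(1), of v] by auto
  qed
  then have yuv: "y $ orb u \<noteq> y $ orb v" by (rule y)
  have "w \<in> affine hull (range (place x y))" for w
  proof -
    let ?A = "place x y v" and ?B = "place x y (\<sigma> v)" and ?C = "place x y u"
    define k where "k = ?A $ 1"
    have k: "k \<noteq> 0" using x sg_free[OF v] by (auto simp: k_def place_def)
    \<comment> \<open>Barycentric coordinates of \<open>w\<close> in that triangle: the height fixes
      \<open>g\<close>, and the horizontal coordinate then fixes the difference \<open>d\<close> of
      the other two.\<close>
    define g where "g = (w $ 2 - ?A $ 2) / (?C $ 2 - ?A $ 2)"
    have den: "?C $ 2 - ?A $ 2 \<noteq> 0" using yuv by (simp add: place_def)
    define d where "d = (w $ 1 - g * ?C $ 1) / k"
    define \<alpha> \<beta> where "\<alpha> = (1 - g + d) / 2" and "\<beta> = (1 - g - d) / 2"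
    have B: "?B $ 1 = - k" "?B $ 2 = ?A $ 2" by (simp_all add: place_\<sigma> k_def)
    have "w = \<alpha> *\<^sub>R ?A + \<beta> *\<^sub>R ?B + g *\<^sub>R ?C"
    proof -
      have "w $ 1 = (\<alpha> - \<beta>) * k + g * ?C $ 1" using k by (simp add: \<alpha>_def \<beta>_def d_def field_simps)
      moreover have "w $ 2 = (\<alpha> + \<beta>) * ?A $ 2 + g * ?C $ 2"
      proof -
        have "(\<alpha> + \<beta>) * ?A $ 2 + g * ?C $ 2 = ?A $ 2 + g * (?C $ 2 - ?A $ 2)"
          by (simp add: \<alpha>_def \<beta>_def field_simps)
        also have "\<dots> = w $ 2" using den by (simp add: g_def)
        finally show ?thesis by simp
      qed
      ultimately show ?thesis unfolding vec_eq_iff forall_2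
        by (simp add: B k_def[symmetric] algebra_simps)
    qed
    moreover have "\<alpha> *\<^sub>R ?A + \<beta> *\<^sub>R ?B + g *\<^sub>R ?C \<in> affine hull (range (place x y))"
      by (rule mem_affine_3[OF affine_affine_hull]) (auto intro: hull_inc simp: \<alpha>_def \<beta>_def field_simps)
    ultimately show ?thesis by simp
  qed
  then show ?thesis using inj by (auto simp: symmetric_placement_def place_\<sigma>)
qed

text \<open>Both independences, nonzero first coordinates and distinct heights are finitely many
  polynomial conditions on \<open>(x, y)\<close>. Each is satisfiable on its own, hence all are
  jointly.\<close>

lemma exists_generic_placement:
  assumes "symmetric_placement p" "indep_family F1 (sym_row x1 y1)" "indep_family F2 (antisym_row x2 y2)"
  shows "\<exists>x y. symmetric_placement (place x y) \<and> indep_family F1 (sym_row x y) \<and> indep_family F2 (antisym_row x y)"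
proof -
  obtain P1 where P1: "real_polynomial_function P1" "P1 (x1, y1) \<noteq> 0"
    "\<And>z. P1 z \<noteq> 0 \<Longrightarrow> indep_family F1 (sym_row (fst z) (snd z))"
    using indep_family_generic[of F1 "\<lambda>e z. sym_row (fst z) (snd z) e" "(x1, y1)", OF finite polynomial_function_rows(1)]
      assms(2) by auto
  obtain P2 where P2: "real_polynomial_function P2" "P2 (x2, y2) \<noteq> 0"
    "\<And>z. P2 z \<noteq> 0 \<Longrightarrow> indep_family F2 (antisym_row (fst z) (snd z))"
    using indep_family_generic[of F2 "\<lambda>e z. antisym_row (fst z) (snd z) e" "(x2, y2)", OF finite polynomial_function_rows(2)]
      assms(3) by auto
  let ?X = "\<lambda>a (z :: (real^'v set) \<times> (real^'v set)). fst z $ a"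
  let ?Y = "\<lambda>(a, b) (z :: (real^'v set) \<times> (real^'v set)). snd z $ a - snd z $ b"
  let ?I = "{P1, P2} \<union> range ?X \<union> ?Y ` {(a, b). a \<noteq> b}"
  have lin: "bounded_linear (?X a)" "bounded_linear (?Y (a, b))" for a b
    by (simp_all add: linear_conv_bounded_linear[symmetric] linear_iff algebra_simps)
  have X0: "?X a (axis a 1, 0) \<noteq> 0" for a by simp
  have Y0: "?Y (a, b) (0, axis a 1) \<noteq> 0" if "a \<noteq> b" for a b using that by (simp add: axis_def)
  have "\<exists>z. \<forall>f\<in>?I. f z \<noteq> 0"
  proof (rule real_polynomial_function_common_nonzero)
    fix f assume f: "f \<in> ?I"
    then consider "f = P1" | "f = P2" | a where "f = ?X a" | a b where "f = ?Y (a, b)" "a \<noteq> b" by blast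
    note cases = this
    show "real_polynomial_function f"
    proof (cases rule: cases)
      case 1 then show ?thesis using P1(1) by simp
    next
      case 2 then show ?thesis using P2(1) by simp
    next
      case 3 show ?thesis unfolding 3 by (rule real_polynomial_function.intros(1)[OF lin(1)])
    next
      case 4 show ?thesis unfolding 4 by (rule real_polynomial_function.intros(1)[OF lin(2)])
    qed
    show "\<exists>z. f z \<noteq> 0"
    proof (cases rule: cases)
      case 1 then show ?thesis using P1(2) by blast
    next
      case 2 then show ?thesis using P2(2) by blast
    next
      case 3 then show ?thesis using X0 by blast
    next
      case 4 then show ?thesis using Y0 by blast
    qed
  qed simp
  then obtain z where z: "\<forall>f\<in>?I. f z \<noteq> 0" by (elim exE)
  have "symmetric_placement (place (fst z) (snd z))"
  proof (rule symmetric_placement_place[OF assms(1)])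
    show "fst z $ a \<noteq> 0" for a using bspec[OF z, of "?X a"] by simp
    show "snd z $ a \<noteq> snd z $ b" if "a \<noteq> b" for a b
    proof -
      have "?Y (a, b) \<in> ?I" using that by (intro UnI2 imageI) simp
      from bspec[OF z this] show ?thesis by simp
    qed
  qed
  moreover have "P1 z \<noteq> 0" "P2 z \<noteq> 0" using z by simp_all
  ultimately show ?thesis using P1(3)[of z] P2(3)[of z] by blast
qed

theorem generic_rigid_iff_sparse_sets:
  assumes p: "symmetric_placement p"
    and generic: "\<And>q. symmetric_placement q \<Longrightarrow> rigidity_rank E q \<le> rigidity_rank E p"
  shows "infinitesimally_rigid E p \<longleftrightarrow>
    (\<exists>F\<subseteq>edge_orbs. count_sparse 1 F \<and> card F + 1 = dim (coords orbs)) \<and>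
    (\<exists>F\<subseteq>edge_orbs. count_sparse 2 F \<and> card F + 2 = dim (coords orbs))"
proof
  assume "infinitesimally_rigid E p"
  then show "(\<exists>F\<subseteq>edge_orbs. count_sparse 1 F \<and> card F + 1 = dim (coords orbs)) \<and>
    (\<exists>F\<subseteq>edge_orbs. count_sparse 2 F \<and> card F + 2 = dim (coords orbs))"
    using sparse_sets_if_rigid[OF p] by blast
next
  assume "(\<exists>F\<subseteq>edge_orbs. count_sparse 1 F \<and> card F + 1 = dim (coords orbs)) \<and>
    (\<exists>F\<subseteq>edge_orbs. count_sparse 2 F \<and> card F + 2 = dim (coords orbs))"
  then obtain F1 F2 where F1: "F1 \<subseteq> edge_orbs" "count_sparse 1 F1" "card F1 + 1 = dim (coords orbs)"
    and F2: "F2 \<subseteq> edge_orbs" "count_sparse 2 F2" "card F2 + 2 = dim (coords orbs)" by blast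
  obtain x1 y1 where 1: "indep_family F1 (sym_row x1 y1)"
    using count_sparse1_imp_indep[OF F1(2) rep_y_inj_on[OF p]] by blast
  obtain x2 y2 where 2: "indep_family F2 (antisym_row x2 y2)"
    using count_sparse2_imp_indep[OF F2(2)] by blast
  obtain x y where xy: "symmetric_placement (place x y)" "indep_family F1 (sym_row x y)" "indep_family F2 (antisym_row x y)"
    using exists_generic_placement[OF p 1 2] by blast
  have "card F1 \<le> dim (sym_row x y ` edge_orbs)" "card F2 \<le> dim (antisym_row x y ` edge_orbs)"
    using F1(1) F2(1) by (auto intro!: indep_family_card_le_dim xy)
  \<comment> \<open>The ranks leave at most one symmetric and two antisymmetric dimensions, just
    what the trivial motions use.\<close>
  then have "dim (motion_space E (place x y)) \<le> 3"
    using dim_motion_space_le[of x y] dim_sym_motions[of x y] dim_antisym_motions[of x y] F1(3) F2(3)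
    by linarith
  moreover have "dim (motion_space E p) \<le> dim (motion_space E (place x y))"
    using dim_motion_space[OF simple, of p] dim_motion_space[OF simple, of "place x y"] generic[OF xy(1)]
    by linarith
  ultimately show "infinitesimally_rigid E p"
    using p by (intro infinitesimally_rigid_if_dim_le) (auto simp: symmetric_placement_def)
qed

end

section \<open>Quotient gain graphs of reflection-symmetric frameworks\<close>

lemma reflection_mult_vec: "reflection *v w = vector [- w $ 1, w $ 2]"
  by (simp add: reflection_def matrix_vector_mult_def sum_2 vec_eq_iff forall_2)

lemma reflection_involutory: "reflection ** reflection = mat 1"
  by (simp add: reflection_def matrix_matrix_mult_def sum_2 vec_eq_iff forall_2 mat_def)

lemma reflection_neq_mat_1: "reflection \<noteq> mat 1"
  by (simp add: reflection_def vec_eq_iff forall_2 mat_def)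

text \<open>The identity goes to an idempotent, and the reflection is not one because its square is
  the identity matrix. Injectivity settles the other element.\<close>

lemma Cs_representation_values:
  assumes "group \<Gamma>" "Cs_representation \<Gamma> \<tau>" "g \<in> carrier \<Gamma>"
  shows "\<tau> g = (if g = \<one>\<^bsub>\<Gamma>\<^esub> then mat 1 else reflection)"
proof -
  interpret group \<Gamma> by fact
  have hom: "\<tau> (x \<otimes>\<^bsub>\<Gamma>\<^esub> y) = \<tau> x ** \<tau> y" if "x \<in> carrier \<Gamma>" "y \<in> carrier \<Gamma>" for x y
    using assms(2) that by (simp add: Cs_representation_def hom_def orthogonal_group_def)
  have img: "\<tau> x \<in> {mat 1, reflection}" if "x \<in> carrier \<Gamma>" for x
    using assms(2) that unfolding Cs_representation_def by blast
  have "\<tau> \<one>\<^bsub>\<Gamma>\<^esub> = \<tau> \<one>\<^bsub>\<Gamma>\<^esub> ** \<tau> \<one>\<^bsub>\<Gamma>\<^esub>" using hom[of "\<one>\<^bsub>\<Gamma>\<^esub>" "\<one>\<^bsub>\<Gamma>\<^esub>"] by simp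
  then have one: "\<tau> \<one>\<^bsub>\<Gamma>\<^esub> = mat 1"
    using img[of "\<one>\<^bsub>\<Gamma>\<^esub>"] reflection_involutory reflection_neq_mat_1 by auto
  show ?thesis
  proof (cases "g = \<one>\<^bsub>\<Gamma>\<^esub>")
    case False
    have "inj_on \<tau> (carrier \<Gamma>)" using assms(2) by (simp add: Cs_representation_def)
    then have "\<tau> g \<noteq> \<tau> \<one>\<^bsub>\<Gamma>\<^esub>" using False assms(3) by (simp add: inj_on_eq_iff)
    then show ?thesis using False img[OF assms(3)] one by auto
  qed (use one in simp)
qed

section \<open>The group action seen as an involution with signs\<close>

locale reflection_action =
  fixes \<Gamma> :: "'g monoid" and \<phi> :: "'g \<Rightarrow> 'v::finite \<Rightarrow> 'v" and \<gamma> :: 'g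
    and E :: "'v set set" and rep :: "'v set \<Rightarrow> 'v"
    and G :: "('v set, 'v set set) pre_digraph" and \<psi> :: "'v set set \<Rightarrow> 'g"
  assumes grp: "group \<Gamma>" and ord: "order \<Gamma> = 2"
    and carrier: "carrier \<Gamma> = {\<one>\<^bsub>\<Gamma>\<^esub>, \<gamma>}" and ne: "\<gamma> \<noteq> \<one>\<^bsub>\<Gamma>\<^esub>"
    and acts: "acts_on_graph \<Gamma> \<phi> E"
    and simple: "simple_graph E"
    and quot: "quotient_gain_graph \<Gamma> \<phi> E rep G \<psi>"
begin

abbreviation "\<sigma> \<equiv> \<phi> \<gamma>"

lemma act_one: "\<phi> \<one>\<^bsub>\<Gamma>\<^esub> v = v"
proof -
  have "group_action \<Gamma> UNIV \<phi>" using acts by (simp add: acts_on_graph_def)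
  from fun_cong[OF group_action.id_eq_one[OF this], of v] show ?thesis by simp
qed

lemma \<sigma>_\<sigma>: "\<sigma> (\<sigma> v) = v"
proof -
  have act: "group_action \<Gamma> UNIV \<phi>" using acts by (simp add: acts_on_graph_def)
  have \<gamma>: "\<gamma> \<in> carrier \<Gamma>" using carrier by blast
  have "\<phi> (\<gamma> \<otimes>\<^bsub>\<Gamma>\<^esub> \<gamma>) v = \<sigma> (\<sigma> v)"
    by (rule group_action.composition_rule[OF act UNIV_I \<gamma> \<gamma>])
  then show ?thesis by (simp add: order_two_square[OF grp ord \<gamma>] act_one)
qed

lemma vertex_orbit_eq: "vertex_orbit \<Gamma> \<phi> v = {v, \<sigma> v}"
proof -
  have "vertex_orbit \<Gamma> \<phi> v = (\<lambda>g. \<phi> g v) ` {\<one>\<^bsub>\<Gamma>\<^esub>, \<gamma>}"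
    unfolding Group_Action.orbit_def carrier by blast
  then show ?thesis by (simp add: act_one)
qed

lemma edge_orbit_eq: "Group_Action.orbit \<Gamma> (\<lambda>g e. \<phi> g ` e) d = {d, \<sigma> ` d}"
proof -
  have "\<phi> \<one>\<^bsub>\<Gamma>\<^esub> ` d = d" using act_one by (simp add: image_def)
  moreover have "Group_Action.orbit \<Gamma> (\<lambda>g e. \<phi> g ` e) d = (\<lambda>g. \<phi> g ` d) ` {\<one>\<^bsub>\<Gamma>\<^esub>, \<gamma>}"
    unfolding Group_Action.orbit_def carrier by blast
  ultimately show ?thesis by simp
qed

lemma verts_eq: "verts G = range (\<lambda>v. {v, \<sigma> v})"
proof -
  have "verts G = Group_Action.orbits \<Gamma> UNIV \<phi>" using quot by (simp add: quotient_gain_graph_def)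
  then show ?thesis unfolding Group_Action.orbits_def vertex_orbit_eq by auto
qed

lemma arcs_eq: "arcs G = {{{u, v}, {\<sigma> u, \<sigma> v}} | u v. {u, v} \<in> E}"
proof -
  have "arcs G = {{d, \<sigma> ` d} | d. d \<in> E}"
    using quot unfolding quotient_gain_graph_def edge_orbits_def Group_Action.orbits_def edge_orbit_eq by blast
  also have "\<dots> = {{{u, v}, {\<sigma> u, \<sigma> v}} | u v. {u, v} \<in> E}"
  proof (intro equalityI subsetI)
    fix e assume "e \<in> {{d, \<sigma> ` d} | d. d \<in> E}"
    then obtain d where d: "e = {d, \<sigma> ` d}" "d \<in> E" by blast
    then have "card d = 2" using simple by (simp add: simple_graph_def)
    then obtain u v where "d = {u, v}" by (auto simp: card_2_iff)
    then show "e \<in> {{{u, v}, {\<sigma> u, \<sigma> v}} | u v. {u, v} \<in> E}" using d by auto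
  next
    fix e assume "e \<in> {{{u, v}, {\<sigma> u, \<sigma> v}} | u v. {u, v} \<in> E}"
    then obtain u v where uv: "e = {{u, v}, {\<sigma> u, \<sigma> v}}" "{u, v} \<in> E" by blast
    then have "e = {{u, v}, \<sigma> ` {u, v}}" by simp
    then show "e \<in> {{d, \<sigma> ` d} | d. d \<in> E}" using uv(2) by blast
  qed
  finally show ?thesis .
qed

lemma stabilizer_eq: "stabilizer \<Gamma> \<phi> v = (if \<sigma> v = v then carrier \<Gamma> else {\<one>\<^bsub>\<Gamma>\<^esub>})"
  unfolding stabilizer_def carrier using act_one by auto

lemma fixed_vertices_eq: "fixed_vertices \<Gamma> \<phi> = fixed_orbits \<sigma>"
proof -
  have "stabilizer \<Gamma> \<phi> v = carrier \<Gamma> \<longleftrightarrow> \<sigma> v = v" for v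
    unfolding stabilizer_eq carrier using ne by auto
  then show ?thesis unfolding fixed_vertices_def fixed_orbits_def vertex_orbit_eq by auto
qed

lemma free_vertices_eq: "free_vertices \<Gamma> \<phi> = verts G - fixed_orbits \<sigma>"
proof -
  have "stabilizer \<Gamma> \<phi> v = {\<one>\<^bsub>\<Gamma>\<^esub>} \<longleftrightarrow> \<sigma> v \<noteq> v" for v
    unfolding stabilizer_eq carrier using ne by auto
  then have "free_vertices \<Gamma> \<phi> = {{v, \<sigma> v} | v. \<sigma> v \<noteq> v}"
    unfolding free_vertices_def vertex_orbit_eq by simp
  also have "\<dots> = verts G - fixed_orbits \<sigma>"
    unfolding verts_eq fixed_orbits_def by auto
  finally show ?thesis .
qed

lemma gain_carrier: "e \<in> arcs G \<Longrightarrow> \<psi> e \<in> carrier \<Gamma>"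
  using quot unfolding quotient_gain_graph_def by (elim conjE) (drule bspec, assumption, elim conjE)

lemma arc_ends:
  assumes "e \<in> arcs G" "{u, v} \<in> e"
  shows "{tail G e, head G e} = {{u, \<sigma> u}, {v, \<sigma> v}}"
proof -
  have *: "\<forall>e\<in>arcs G. \<forall>d\<in>e. {tail G e, head G e} = vertex_orbit \<Gamma> \<phi> ` d"
    using quot unfolding quotient_gain_graph_def by (elim conjE)
  have "{tail G e, head G e} = vertex_orbit \<Gamma> \<phi> ` {u, v}" by (rule *[rule_format, OF assms])
  then show ?thesis unfolding vertex_orbit_eq by simp
qed

lemma arc_ends_in_verts:
  assumes "e \<in> arcs G" shows "tail G e \<in> verts G" "head G e \<in> verts G"
proof -
  obtain u v where uv: "e = {{u, v}, {\<sigma> u, \<sigma> v}}" using assms unfolding arcs_eq by blast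
  have "{tail G e, head G e} = {{u, \<sigma> u}, {v, \<sigma> v}}" by (rule arc_ends[OF assms]) (simp add: uv)
  then have "{tail G e, head G e} \<subseteq> verts G" unfolding verts_eq by auto
  then show "tail G e \<in> verts G" "head G e \<in> verts G" by simp_all
qed

lemma wf_G: "wf_digraph G"
  using arc_ends_in_verts by (simp add: wf_digraph_def)

definition eps :: "'v set set \<Rightarrow> real" where "eps e = gain_sign \<Gamma> (\<psi> e)"

lemma reflection_graph: "reflection_graph E \<sigma> rep (tail G) (head G) eps"
proof
  fix u v :: 'v and e :: "'v set set"
  show "\<sigma> (\<sigma> v) = v" by (rule \<sigma>_\<sigma>)
  show "simple_graph E" by (rule simple)
  show "eps e = 1 \<or> eps e = - 1" by (simp add: eps_def gain_sign_def)
  have "graph_automorphism E \<sigma>" using acts carrier unfolding acts_on_graph_def by blast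
  then show "{\<sigma> u, \<sigma> v} \<in> E" if "{u, v} \<in> E" using that unfolding graph_automorphism_def by blast
  have "{v, \<sigma> v} \<in> verts G" unfolding verts_eq by blast
  then show "rep {v, \<sigma> v} \<in> {v, \<sigma> v}" using quot unfolding quotient_gain_graph_def by blast
  have arc: "{{u, v}, {\<sigma> u, \<sigma> v}} \<in> arcs G" if "{u, v} \<in> E" using that unfolding arcs_eq by blast
  then show "{tail G {{u, v}, {\<sigma> u, \<sigma> v}}, head G {{u, v}, {\<sigma> u, \<sigma> v}}} = {{u, \<sigma> u}, {v, \<sigma> v}}"
    if "{u, v} \<in> E" using arc_ends[OF arc[OF that], of u v] by simp
  assume uv: "{u, v} \<in> E" "e = {{u, v}, {\<sigma> u, \<sigma> v}}" "tail G e \<notin> fixed_orbits \<sigma>" "head G e \<notin> fixed_orbits \<sigma>"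
  have e: "e \<in> arcs G" using arc uv(1,2) by simp
  then have "{rep (tail G e), \<phi> (\<psi> e) (rep (head G e))} \<in> e"
    using quot uv(3,4) arc_ends_in_verts[OF e] unfolding quotient_gain_graph_def free_vertices_eq by blast
  moreover have "\<phi> (\<psi> e) (rep (head G e)) = (if eps e = 1 then rep (head G e) else \<sigma> (rep (head G e)))"
    using gain_carrier[OF e] act_one unfolding carrier eps_def gain_sign_def by auto
  ultimately show "{rep (tail G e), if eps e = 1 then rep (head G e) else \<sigma> (rep (head G e))} \<in> e" by simp
qed

sublocale reflection_graph E \<sigma> rep "tail G" "head G" eps by (rule reflection_graph)

lemma edge_orbs_eq_arcs: "edge_orbs = arcs G"
  unfolding arcs_eq edge_orbs_def ..

lemma balanced_iff_switchable:
  assumes "subgraph H G"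
  shows "balanced \<Gamma> \<phi> \<psi> H \<longleftrightarrow> switchable (arcs H)"
proof -
  have H: "wf_digraph H" "arcs H \<subseteq> arcs G" "tail H = tail G" "head H = head G"
    using assms by (simp_all add: subgraph_def compatible_def)
  have "balanced \<Gamma> \<phi> \<psi> H \<longleftrightarrow> (\<exists>\<theta>. (\<forall>v. \<theta> v = 1 \<or> \<theta> v = (- 1 :: real)) \<and>
     (\<forall>e\<in>arcs H. tail H e \<notin> fixed_vertices \<Gamma> \<phi> \<and> head H e \<notin> fixed_vertices \<Gamma> \<phi> \<longrightarrow>
        \<theta> (tail H e) = gain_sign \<Gamma> (\<psi> e) * \<theta> (head H e)))"
    using H(2) gain_carrier by (intro balanced_iff_potential[OF grp ord H(1)]) auto
  then show ?thesis unfolding H(3,4) fixed_vertices_eq switchable_def eps_def Compl_iff .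
qed

lemma sparsity_count_eq:
  assumes "verts H \<subseteq> verts G"
  shows "sparsity_count \<Gamma> \<phi> 1 l H =
    2 * int (card (verts H \<inter> - fixed_orbits \<sigma>)) + int (card (verts H - - fixed_orbits \<sigma>)) - l"
proof -
  have "verts H \<inter> free_vertices \<Gamma> \<phi> = verts H \<inter> - fixed_orbits \<sigma>"
    "verts H \<inter> fixed_vertices \<Gamma> \<phi> = verts H - - fixed_orbits \<sigma>"
    using assms unfolding free_vertices_eq fixed_vertices_eq by auto
  then show ?thesis by (simp add: sparsity_count_def)
qed

text \<open>An edge set is tested by the subgraph on exactly its ends. Conversely, further vertices
  of a subgraph enlarge both bounds, and balance depends on the arcs only.\<close>

lemma gain_sparse_iff_count_sparse:
  assumes "spanning H G"
  shows "gain_sparse \<Gamma> \<phi> 1 l H \<psi> \<longleftrightarrow> count_sparse l (arcs H)"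
proof
  have H: "wf_digraph H" "arcs H \<subseteq> arcs G" "tail H = tail G" "head H = head G" "verts H = verts G"
    using assms by (simp_all add: spanning_def subgraph_def compatible_def)
  have subG: "subgraph H' G" if "subgraph H' H" for H'
    using that assms H wf_G by (auto simp: subgraph_def compatible_def)
  show "count_sparse l (arcs H)" if sp: "gain_sparse \<Gamma> \<phi> 1 l H \<psi>"
    unfolding count_sparse_def
  proof (intro allI impI)
    fix F assume F: "F \<subseteq> arcs H" "F \<noteq> {}"
    let ?H = "\<lparr>verts = ends F, arcs = F, tail = tail G, head = head G\<rparr>"
    have V: "ends F \<subseteq> verts G" using F(1) H(2) arc_ends_in_verts by (auto simp: ends_def)
    have "wf_digraph ?H" by (simp add: wf_digraph_def ends_def)
    then have sub: "subgraph ?H H"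
      using F(1) V H by (simp add: subgraph_def compatible_def)
    have "balanced \<Gamma> \<phi> \<psi> ?H \<longleftrightarrow> switchable F" using balanced_iff_switchable[OF subG[OF sub]] by simp
    moreover have "balanced \<Gamma> \<phi> \<psi> ?H \<longrightarrow> int (card (arcs ?H)) \<le> 2 * int (card (verts ?H)) - 3"
      "int (card (arcs ?H)) \<le> sparsity_count \<Gamma> \<phi> 1 l ?H"
      using conjunct1[OF sp[unfolded gain_sparse_def], rule_format, of ?H]
        conjunct2[OF sp[unfolded gain_sparse_def], rule_format, of ?H] sub F(2) by simp_all
    ultimately show "(switchable F \<longrightarrow> int (card F) \<le> 2 * int (card (ends F)) - 3) \<and>
      int (card F) \<le> 2 * int (card (ends F \<inter> - fixed_orbits \<sigma>)) + int (card (ends F - - fixed_orbits \<sigma>)) - l"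
      using sparsity_count_eq[of ?H l] V by simp
  qed
  show "gain_sparse \<Gamma> \<phi> 1 l H \<psi>" if sp: "count_sparse l (arcs H)"
  proof -
    have "(balanced \<Gamma> \<phi> \<psi> H' \<longrightarrow> int (card (arcs H')) \<le> 2 * int (card (verts H')) - 3) \<and>
      int (card (arcs H')) \<le> sparsity_count \<Gamma> \<phi> 1 l H'" if sub: "subgraph H' H" and ne: "arcs H' \<noteq> {}" for H'
    proof -
      let ?F = "arcs H'"
      have H': "wf_digraph H'" "?F \<subseteq> arcs H" "tail H' = tail G" "head H' = head G" "verts H' \<subseteq> verts G"
        using sub H by (auto simp: subgraph_def compatible_def)
      have V: "ends ?F \<subseteq> verts H'"
        using H'(1,3,4) by (auto simp: ends_def wf_digraph_def)
      have "card (ends ?F) \<le> card (verts H')"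
        "card (ends ?F \<inter> - fixed_orbits \<sigma>) \<le> card (verts H' \<inter> - fixed_orbits \<sigma>)"
        "card (ends ?F - - fixed_orbits \<sigma>) \<le> card (verts H' - - fixed_orbits \<sigma>)"
        using V by (auto intro!: card_mono)
      moreover have "switchable ?F \<longrightarrow> int (card ?F) \<le> 2 * int (card (ends ?F)) - 3"
        "int (card ?F) \<le> 2 * int (card (ends ?F \<inter> - fixed_orbits \<sigma>)) + int (card (ends ?F - - fixed_orbits \<sigma>)) - l"
        using sp H'(2) ne unfolding count_sparse_def by blast+
      ultimately show ?thesis
        unfolding balanced_iff_switchable[OF subG[OF sub]] sparsity_count_eq[OF H'(5)] by linarith
    qed
    then show ?thesis unfolding gain_sparse_def by simp
  qed
qed

text \<open>A spanning subgraph amounts to its set of arcs, and \<open>dim (coords orbs)\<close> is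
  twice the number of free orbits plus the number of fixed ones.\<close>

lemma exists_gain_tight_iff:
  "(\<exists>H. spanning H G \<and> gain_tight \<Gamma> \<phi> 1 (int l) H \<psi>) \<longleftrightarrow>
    (\<exists>F\<subseteq>edge_orbs. count_sparse (int l) F \<and> card F + l = dim (coords orbs))"
proof -
  have dims: "int (dim (coords orbs)) = 2 * int (card (verts G \<inter> - fixed_orbits \<sigma>)) + int (card (verts G - - fixed_orbits \<sigma>))"
  proof -
    have "card orbs = card ((orbs \<inter> - fixed_orbits \<sigma>) \<union> (orbs - - fixed_orbits \<sigma>))"
      by (simp only: Int_Diff_Un)
    also have "\<dots> = card (orbs \<inter> - fixed_orbits \<sigma>) + card (orbs - - fixed_orbits \<sigma>)"
      by (rule card_Un_disjoint) auto
    finally show ?thesis unfolding dim_coords verts_eq by simp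
  qed
  have tight: "gain_tight \<Gamma> \<phi> 1 (int l) H \<psi> \<longleftrightarrow>
      count_sparse (int l) (arcs H) \<and> card (arcs H) + l = dim (coords orbs)" if H: "spanning H G" for H
  proof -
    have V: "verts H = verts G" using H by (simp add: spanning_def)
    have "sparsity_count \<Gamma> \<phi> 1 (int l) H = int (dim (coords orbs)) - int l"
      using sparsity_count_eq[of H "int l"] unfolding dims V by simp
    then have "int (card (arcs H)) = sparsity_count \<Gamma> \<phi> 1 (int l) H \<longleftrightarrow> card (arcs H) + l = dim (coords orbs)"
      by (intro iffI) linarith+
    then show ?thesis using gain_sparse_iff_count_sparse[OF H] by (simp add: gain_tight_def)
  qed
  show ?thesis
  proof
    assume "\<exists>H. spanning H G \<and> gain_tight \<Gamma> \<phi> 1 (int l) H \<psi>"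
    then obtain H where H: "spanning H G" "gain_tight \<Gamma> \<phi> 1 (int l) H \<psi>" by blast
    then have "arcs H \<subseteq> edge_orbs" by (simp add: spanning_def subgraph_def edge_orbs_eq_arcs)
    then show "\<exists>F\<subseteq>edge_orbs. count_sparse (int l) F \<and> card F + l = dim (coords orbs)"
      using tight H by blast
  next
    assume "\<exists>F\<subseteq>edge_orbs. count_sparse (int l) F \<and> card F + l = dim (coords orbs)"
    then obtain F where F: "F \<subseteq> arcs G" "count_sparse (int l) F" "card F + l = dim (coords orbs)"
      unfolding edge_orbs_eq_arcs by blast
    let ?H = "\<lparr>verts = verts G, arcs = F, tail = tail G, head = head G\<rparr>"
    have "wf_digraph ?H" using F(1) arc_ends_in_verts by (auto simp: wf_digraph_def)
    then have "spanning ?H G" using F(1) wf_G by (simp add: spanning_def subgraph_def compatible_def)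
    then show "\<exists>H. spanning H G \<and> gain_tight \<Gamma> \<phi> 1 (int l) H \<psi>"
      using tight[of ?H] F by auto
  qed
qed

lemma symmetric_framework_iff:
  assumes "Cs_representation \<Gamma> \<tau>"
  shows "symmetric_framework \<Gamma> \<phi> \<tau> E p \<longleftrightarrow> symmetric_placement p"
proof -
  have \<tau>: "\<tau> \<one>\<^bsub>\<Gamma>\<^esub> = mat 1" "\<tau> \<gamma> = reflection"
    using Cs_representation_values[OF grp assms] carrier ne by auto
  have "(\<forall>g\<in>carrier \<Gamma>. \<forall>v. \<tau> g *v p v = p (\<phi> g v)) \<longleftrightarrow> (\<forall>v. p (\<sigma> v) = vector [- p v $ 1, p v $ 2])"
    unfolding carrier by (auto simp: \<tau> act_one reflection_mult_vec)
  also have "\<dots> \<longleftrightarrow> (\<forall>v. p (\<sigma> v) $ 1 = - p v $ 1 \<and> p (\<sigma> v) $ 2 = p v $ 2)"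
    by (simp add: vec_eq_iff forall_2)
  finally show ?thesis
    using simple by (simp add: symmetric_framework_def framework_def symmetric_placement_def)
qed

end

theorem theorem7p8:
  fixes \<Gamma> :: "'g monoid"
    and \<phi> :: "'g \<Rightarrow> 'v::finite \<Rightarrow> 'v"
    and \<tau> :: "'g \<Rightarrow> real^2^2"
    and E :: "'v set set"
    and p :: "'v \<Rightarrow> real^2"
    and rep :: "'v set \<Rightarrow> 'v"
    and G :: "('v set, 'v set set) pre_digraph"
    and \<psi> :: "'v set set \<Rightarrow> 'g"
    and q :: "'v set \<Rightarrow> real^2"
  assumes "group \<Gamma>" and "cyclic_group \<Gamma>" and "order \<Gamma> = 2"
    and "acts_on_graph \<Gamma> \<phi> E"
    and "Cs_representation \<Gamma> \<tau>"
    and "generic_framework \<Gamma> \<phi> \<tau> E p"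
    and "gain_framework \<Gamma> \<phi> E p rep G \<psi> q"
  shows "infinitesimally_rigid E p \<longleftrightarrow>
    (\<exists>H. spanning H G \<and> gain_tight \<Gamma> \<phi> 1 1 H \<psi>) \<and>
    (\<exists>H. spanning H G \<and> gain_tight \<Gamma> \<phi> 1 2 H \<psi>)"
proof -
  interpret group \<Gamma> by fact
  have "card (carrier \<Gamma>) = 2" using assms(3) by (simp add: order_def)
  then obtain a b where ab: "carrier \<Gamma> = {a, b}" "a \<noteq> b" by (auto simp: card_2_iff)
  have "\<one>\<^bsub>\<Gamma>\<^esub> \<in> carrier \<Gamma>" by simp
  then obtain \<gamma> where \<gamma>: "carrier \<Gamma> = {\<one>\<^bsub>\<Gamma>\<^esub>, \<gamma>}" "\<gamma> \<noteq> \<one>\<^bsub>\<Gamma>\<^esub>" using ab by auto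
  interpret reflection_action \<Gamma> \<phi> \<gamma> E rep G \<psi>
  proof
    show "simple_graph E"
      using assms(6) by (simp add: generic_framework_def symmetric_framework_def framework_def)
    show "quotient_gain_graph \<Gamma> \<phi> E rep G \<psi>" using assms(7) by (simp add: gain_framework_def)
  qed (use assms \<gamma> in auto)
  note sym = symmetric_framework_iff[OF assms(5)]
  have "symmetric_placement p" "\<And>q. symmetric_placement q \<Longrightarrow> rigidity_rank E q \<le> rigidity_rank E p"
    using assms(6) unfolding generic_framework_def sym by auto
  from generic_rigid_iff_sparse_sets[OF this] show ?thesis
    using exists_gain_tight_iff[of 1] exists_gain_tight_iff[of 2] by simp
qed

end
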